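(* Let $N\geq 3$, let $\Omega\subset\mathbb{R}^N$ be a smooth bounded starshaped domain, let $\lambda_1$ be the first eigenvalue of the Laplace operator $-\Delta$ in $\Omega$ with Dirichlet boundary conditions on $\partial\Omega$, and let $\lambda\in\mathbb{R}$ satisfy $\lambda\leq\frac{N-2}{N}\lambda_1$. Let $f:\mathbb{R}\to\mathbb{R}$ be a locally Lipschitz function satisfying $\int_0^s f(t)\,dt\leq 0$ for every $s\in\mathbb{R}$. Then the problem $$-\Delta u=\lambda u+f(u)\ \text{ in }\Omega,\qquad u=0\ \text{ on }\partial\Omega,$$ has no nontrivial solutions.
   Context: A solution to the problem $-\Delta u=\lambda u+f(u)$ in $\Omega$, $u=0$ on $\partial\Omega$, means a bounded weak solution: a function $u\in H_0^1(\Omega)\cap L^\infty(\Omega)$ such that $\int_\Omega \nabla u\cdot\nabla\varphi=\lambda\int_\Omega u\varphi+\int_\Omega f(u)\varphi$ for all $\varphi\in H_0^1(\Omega)$. (By regularity, every such solution is a classical solution.) A solution is nontrivial if it is not identically zero. Starshaped means starshaped with respect to some point of $\Omega$. *)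

theory Defs
  imports "HOL-Analysis.Analysis"
begin

primrec Ck :: "nat \<Rightarrow> (real^'n \<Rightarrow> real) \<Rightarrow> bool" where
  "Ck 0 f \<longleftrightarrow> continuous_on UNIV f"
| "Ck (Suc k) f \<longleftrightarrow>
     (\<forall>x. f differentiable (at x)) \<and> (\<forall>v. Ck k (\<lambda>x. frechet_derivative f (at x) v))"

definition smooth :: "(real^'n \<Rightarrow> real) \<Rightarrow> bool" where
  "smooth f \<longleftrightarrow> (\<forall>k. Ck k f)"

definition partial_deriv :: "'n \<Rightarrow> (real^'n \<Rightarrow> real) \<Rightarrow> real^'n \<Rightarrow> real" where
  "partial_deriv i f x = frechet_derivative f (at x) (axis i 1)"

definition gradient :: "(real^'n \<Rightarrow> real) \<Rightarrow> real^'n \<Rightarrow> real^'n" where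
  "gradient f x = (\<chi> i. partial_deriv i f x)"

text \<open>
  The boundary is \<open>C\<^sup>\<infinity>\<close> if, near each of its points and in suitable orthonormal coordinates,
  the set is the strict epigraph of a \<open>C\<^sup>\<infinity>\<close> function. The unit vector \<open>e\<close> is the vertical
  direction and \<open>x - (x \<bullet> e) *\<^sub>R e\<close> is the horizontal part of \<open>x\<close>; only the values of \<open>\<gamma>\<close> on
  the hyperplane orthogonal to \<open>e\<close> matter.
\<close>

definition smooth_boundary :: "(real^'n) set \<Rightarrow> bool" where
  "smooth_boundary \<Omega> \<longleftrightarrow>
     (\<forall>p \<in> frontier \<Omega>. \<exists>r>0. \<exists>e \<gamma>. norm e = 1 \<and> smooth \<gamma> \<and>
        \<Omega> \<inter> ball p r = {x \<in> ball p r. \<gamma> (x - (x \<bullet> e) *\<^sub>R e) < x \<bullet> e})"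

definition smooth_bounded_domain :: "(real^'n) set \<Rightarrow> bool" where
  "smooth_bounded_domain \<Omega> \<longleftrightarrow>
     open \<Omega> \<and> connected \<Omega> \<and> \<Omega> \<noteq> {} \<and> bounded \<Omega> \<and> smooth_boundary \<Omega>"

text \<open>
  Elements of the function spaces below are represented by functions on the whole space of which
  only the values almost everywhere in \<open>\<Omega>\<close> matter.
\<close>

definition L2 :: "(real^'n) set \<Rightarrow> (real^'n \<Rightarrow> 'b::euclidean_space) set" where
  "L2 \<Omega> = {u. u \<in> borel_measurable (lebesgue_on \<Omega>) \<and>
               integrable (lebesgue_on \<Omega>) (\<lambda>x. (norm (u x))\<^sup>2)}"

definition Linf :: "(real^'n) set \<Rightarrow> (real^'n \<Rightarrow> real) set" where
  "Linf \<Omega> = {u. u \<in> borel_measurable (lebesgue_on \<Omega>) \<and>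
                 (\<exists>C. AE x in lebesgue_on \<Omega>. \<bar>u x\<bar> \<le> C)}"

definition test_functions :: "(real^'n) set \<Rightarrow> (real^'n \<Rightarrow> real) set" where
  "test_functions \<Omega> =
     {\<phi>. smooth \<phi> \<and> compact (closure {x. \<phi> x \<noteq> 0}) \<and> closure {x. \<phi> x \<noteq> 0} \<subseteq> \<Omega>}"

definition has_weak_gradient ::
    "(real^'n) set \<Rightarrow> (real^'n \<Rightarrow> real) \<Rightarrow> (real^'n \<Rightarrow> real^'n) \<Rightarrow> bool" where
  "has_weak_gradient \<Omega> u g \<longleftrightarrow> u \<in> L2 \<Omega> \<and> g \<in> L2 \<Omega> \<and>
     (\<forall>\<phi> \<in> test_functions \<Omega>. \<forall>i.
        (LINT x|lebesgue_on \<Omega>. u x * partial_deriv i \<phi> x)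
        = - (LINT x|lebesgue_on \<Omega>. g x $ i * \<phi> x))"

definition H1 :: "(real^'n) set \<Rightarrow> (real^'n \<Rightarrow> real) set" where
  "H1 \<Omega> = {u. \<exists>g. has_weak_gradient \<Omega> u g}"

text \<open>For \<open>u \<in> H1 \<Omega>\<close> the weak gradient is determined almost everywhere in \<open>\<Omega>\<close>.\<close>

definition weak_gradient :: "(real^'n) set \<Rightarrow> (real^'n \<Rightarrow> real) \<Rightarrow> real^'n \<Rightarrow> real^'n" where
  "weak_gradient \<Omega> u = (SOME g. has_weak_gradient \<Omega> u g)"

definition H10 :: "(real^'n) set \<Rightarrow> (real^'n \<Rightarrow> real) set" where
  "H10 \<Omega> = {u \<in> H1 \<Omega>. \<exists>\<phi> :: nat \<Rightarrow> real^'n \<Rightarrow> real. (\<forall>k. \<phi> k \<in> test_functions \<Omega>) \<and>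
     (\<lambda>k. (LINT x|lebesgue_on \<Omega>. (\<phi> k x - u x)\<^sup>2)
        + (LINT x|lebesgue_on \<Omega>. (norm (gradient (\<phi> k) x - weak_gradient \<Omega> u x))\<^sup>2))
     \<longlonglongrightarrow> 0}"

definition nontrivial_on :: "(real^'n) set \<Rightarrow> (real^'n \<Rightarrow> real) \<Rightarrow> bool" where
  "nontrivial_on \<Omega> u \<longleftrightarrow> \<not> (AE x in lebesgue_on \<Omega>. u x = 0)"

definition dirichlet_eigenvalue :: "(real^'n) set \<Rightarrow> real \<Rightarrow> bool" where
  "dirichlet_eigenvalue \<Omega> \<mu> \<longleftrightarrow>
     (\<exists>u \<in> H10 \<Omega>. nontrivial_on \<Omega> u \<and>
        (\<forall>\<phi> \<in> H10 \<Omega>.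
           (LINT x|lebesgue_on \<Omega>. weak_gradient \<Omega> u x \<bullet> weak_gradient \<Omega> \<phi> x)
           = \<mu> * (LINT x|lebesgue_on \<Omega>. u x * \<phi> x)))"

definition first_dirichlet_eigenvalue :: "(real^'n) set \<Rightarrow> real" where
  "first_dirichlet_eigenvalue \<Omega> = (LEAST \<mu>. dirichlet_eigenvalue \<Omega> \<mu>)"

definition bounded_weak_solution ::
    "(real^'n) set \<Rightarrow> real \<Rightarrow> (real \<Rightarrow> real) \<Rightarrow> (real^'n \<Rightarrow> real) \<Rightarrow> bool" where
  "bounded_weak_solution \<Omega> lam f u \<longleftrightarrow> u \<in> H10 \<Omega> \<inter> Linf \<Omega> \<and>
     (\<forall>\<phi> \<in> H10 \<Omega>.
        (LINT x|lebesgue_on \<Omega>. weak_gradient \<Omega> u x \<bullet> weak_gradient \<Omega> \<phi> x)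
        = lam * (LINT x|lebesgue_on \<Omega>. u x * \<phi> x)
          + (LINT x|lebesgue_on \<Omega>. f (u x) * \<phi> x))"

definition locally_lipschitz :: "(real \<Rightarrow> real) \<Rightarrow> bool" where
  "locally_lipschitz f \<longleftrightarrow> (\<forall>s. \<exists>d>0. \<exists>L. L-lipschitz_on (ball s d) f)"

end

(*
  With u extended by zero and u_t(x) = u(a + t(x - a)), t > 1, where a is the center of the star,
  the function u_t is again in H10, and no boundary regularity is needed to test the equation with it.
  Let g(s) = lam s + f(s) with primitive G. By Cauchy-Schwarz the left side of the tested equation is at
  most t^(1 - N/2) times the Dirichlet energy E of u. On the right, g(u) (u_t - u) equals G(u_t) - G(u)
  up to O((u_t - u)^2), where the integral of G(u_t) is t^(-N) times that of G(u) and u_t - u is O(t - 1)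
  in L2. Differentiating at t = 1 gives the Pohozaev inequality (N - 2)/2 E <= N (integral of G(u)).
  Combined with lambda_1 |u|^2 <= E this forces F(u) = 0, where F is the primitive of f, so u(x) is a
  maximum point of F and f(u) = 0 almost everywhere. Testing with u then gives E = lam |u|^2, so
  lam >= lambda_1, which contradicts the bound on lam because lambda_1 > 0.
  The inequality lambda_1 |u|^2 <= E needs a minimizer of the Rayleigh quotient, obtained from Rellich
  compactness: averages over small balls are equi-Lipschitz and uniformly close in L2 to the functions.
*)
theory Submission
  imports Defs "HOL-Complex_Analysis.Great_Picard" "HOL-Library.Diagonal_Subsequence"
begin

subsection \<open>Square integrable functions\<close>

text \<open>The usual proof of the Pohozaev identity multiplies the equation by (x - a) . grad u,
  which needs second derivatives up to the boundary, and then discards a boundary integral of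
  favourable sign. Here the difference quotient of u_t replaces that multiplier, and the restriction
  t > 1 replaces the boundary integral: for t < 1 the dilated zero extension need not vanish outside
  Omega, so only a one-sided comparison is available and an inequality remains. The exponent 1 - N/2
  comes from the square root of t^2 t^(-N): the chain rule puts a factor t on the gradient, the
  change of variables a factor t^(-N) on its squared norm. The local Lipschitz bound makes the error
  in G(u_t) - G(u) quadratic, and the L2 displacement bound then makes it O((t - 1)^2), invisible at
  first order. The first eigenvalue is defined by \<open>LEAST\<close>, so its value is known only
  once a smallest eigenvalue is exhibited; hence a minimizer is constructed. The parallelogram law
  turns L2 convergence of a minimizing sequence into strong convergence of its gradients, so weak
  compactness is avoided.\<close>

definition sq_int :: "'a measure \<Rightarrow> ('a \<Rightarrow> 'b::euclidean_space) \<Rightarrow> bool" where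
  "sq_int M u \<longleftrightarrow> u \<in> borel_measurable M \<and> integrable M (\<lambda>x. (norm (u x))\<^sup>2)"

text \<open>The square of the norm is the basic quantity because the energies and the definition of
  \<open>H10\<close> are written with squares. The measure is a parameter because the estimates move
  between \<open>lborel\<close> and \<open>lebesgue_on \<Omega>\<close>.\<close>

definition sqn :: "'a measure \<Rightarrow> ('a \<Rightarrow> 'b::euclidean_space) \<Rightarrow> real" where
  "sqn M u = (LINT x|M. (norm (u x))\<^sup>2)"

lemma sq_int_measurable: "sq_int M u \<Longrightarrow> u \<in> borel_measurable M"
  by (simp add: sq_int_def)

lemma sqn_nonneg [simp]: "0 \<le> sqn M u"
  by (simp add: sqn_def)

lemma integrable_inner:
  assumes "sq_int M u" "sq_int M v"
  shows "integrable M (\<lambda>x. u x \<bullet> v x)"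
proof (rule Bochner_Integration.integrable_bound)
  show "integrable M (\<lambda>x. (norm (u x))\<^sup>2 + (norm (v x))\<^sup>2)"
    using assms by (simp add: sq_int_def)
  show "(\<lambda>x. u x \<bullet> v x) \<in> borel_measurable M"
    using assms by (auto simp: sq_int_def)
  have "\<bar>a \<bullet> b\<bar> \<le> (norm a)\<^sup>2 + (norm b)\<^sup>2" for a b :: 'b
    using Cauchy_Schwarz_ineq2[of a b] sum_squares_bound[of "norm a" "norm b"]
      zero_le_mult_iff[of "norm a" "norm b"] by (simp; linarith)
  then show "AE x in M. norm (u x \<bullet> v x) \<le> norm ((norm (u x))\<^sup>2 + (norm (v x))\<^sup>2)"
    by (intro always_eventually) simp
qed

lemma integrable_mult_real:
  fixes u v :: "'a \<Rightarrow> real"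
  assumes "sq_int M u" "sq_int M v"
  shows "integrable M (\<lambda>x. u x * v x)"
  using integrable_inner[OF assms] by simp

lemma sq_int_add:
  assumes "sq_int M u" "sq_int M v"
  shows "sq_int M (\<lambda>x. u x + v x)"
proof -
  have "integrable M (\<lambda>x. (norm (u x))\<^sup>2 + (norm (v x))\<^sup>2 + 2 * (u x \<bullet> v x))"
    using assms integrable_inner[OF assms] by (simp add: sq_int_def)
  then show ?thesis
    using assms by (auto simp: sq_int_def power2_norm_eq_inner inner_add inner_commute algebra_simps)
qed

lemma sq_int_scaleR: "sq_int M u \<Longrightarrow> sq_int M (\<lambda>x. c *\<^sub>R u x)"
  by (auto simp: sq_int_def power_mult_distrib)

lemma sq_int_diff: "sq_int M u \<Longrightarrow> sq_int M v \<Longrightarrow> sq_int M (\<lambda>x. u x - v x)"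
  using sq_int_add[of M u "\<lambda>x. (-1) *\<^sub>R v x"] sq_int_scaleR[of M v "-1"] by simp

lemma sqn_add:
  assumes "sq_int M u" "sq_int M v"
  shows "sqn M (\<lambda>x. u x + v x) = sqn M u + 2 * (LINT x|M. u x \<bullet> v x) + sqn M v"
proof -
  have "sqn M (\<lambda>x. u x + v x) = (LINT x|M. (norm (u x))\<^sup>2 + 2 * (u x \<bullet> v x) + (norm (v x))\<^sup>2)"
    unfolding sqn_def
    by (rule Bochner_Integration.integral_cong)
       (simp_all add: power2_norm_eq_inner inner_add inner_commute algebra_simps)
  then show ?thesis
    using assms integrable_inner[OF assms] by (simp add: sqn_def sq_int_def)
qed

lemma sqn_scaleR: "sqn M (\<lambda>x. c *\<^sub>R u x) = c\<^sup>2 * sqn M u"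
  by (simp add: sqn_def power_mult_distrib)

lemma sqn_diff:
  assumes "sq_int M u" "sq_int M v"
  shows "sqn M (\<lambda>x. u x - v x) = sqn M u - 2 * (LINT x|M. u x \<bullet> v x) + sqn M v"
  using sqn_add[OF assms(1) sq_int_scaleR[OF assms(2), of "-1"]] sqn_scaleR[of M "-1" v] by simp

lemma sqn_minus_commute: "sqn M (\<lambda>x. u x - v x) = sqn M (\<lambda>x. v x - u x)"
  by (simp add: sqn_def norm_minus_commute)

text \<open>The polynomial t -> \<open>sqn M (u + t v)\<close> is nonnegative for every real
  t.\<close>

lemma Cauchy_Schwarz_sqn:
  assumes "sq_int M u" "sq_int M v"
  shows "\<bar>LINT x|M. u x \<bullet> v x\<bar> \<le> sqrt (sqn M u) * sqrt (sqn M v)"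
proof -
  define B where "B = (LINT x|M. u x \<bullet> v x)"
  have q: "0 \<le> sqn M u + 2 * t * B + t\<^sup>2 * sqn M v" for t
  proof -
    have "0 \<le> sqn M (\<lambda>x. u x + t *\<^sub>R v x)" by simp
    also have "\<dots> = sqn M u + 2 * t * B + t\<^sup>2 * sqn M v"
      using sqn_add[OF assms(1) sq_int_scaleR[OF assms(2), of t]]
      by (simp add: sqn_scaleR B_def)
    finally show ?thesis .
  qed
  have "B\<^sup>2 \<le> sqn M u * sqn M v"
  proof (cases "sqn M v = 0")
    case True
    have "B = 0"
    proof (rule ccontr)
      assume "B \<noteq> 0"
      \<comment> \<open>For a vanishing quadratic coefficient the polynomial is affine in t; at this
        t it takes the value -1.\<close>
      with q[of "-(sqn M u + 1) / (2 * B)"] True show False by (simp add: field_simps)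
    qed
    then show ?thesis by simp
  next
    case False
    then have "0 < sqn M v" using sqn_nonneg[of M v] by linarith
    \<comment> \<open>This t is the vertex of the parabola.\<close>
    with q[of "- B / sqn M v"] show ?thesis by (simp add: field_simps power2_eq_square)
  qed
  then have "sqrt (B\<^sup>2) \<le> sqrt (sqn M u * sqn M v)" by (rule real_sqrt_le_mono)
  then show ?thesis by (simp add: real_sqrt_mult B_def)
qed

lemma sqrt_sqn_triangle:
  assumes "sq_int M u" "sq_int M v"
  shows "sqrt (sqn M (\<lambda>x. u x + v x)) \<le> sqrt (sqn M u) + sqrt (sqn M v)"
proof (rule real_le_lsqrt)
  have "sqn M (\<lambda>x. u x + v x) \<le> sqn M u + 2 * (sqrt (sqn M u) * sqrt (sqn M v)) + sqn M v"
    using Cauchy_Schwarz_sqn[OF assms] by (simp add: sqn_add[OF assms])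
  then show "sqn M (\<lambda>x. u x + v x) \<le> (sqrt (sqn M u) + sqrt (sqn M v))\<^sup>2"
    by (simp add: power2_sum)
qed (auto)

lemma sqrt_sqn_triangle_diff:
  assumes "sq_int M u" "sq_int M v" "sq_int M w"
  shows "sqrt (sqn M (\<lambda>x. u x - w x)) \<le> sqrt (sqn M (\<lambda>x. u x - v x)) + sqrt (sqn M (\<lambda>x. v x - w x))"
  using sqrt_sqn_triangle[OF sq_int_diff[OF assms(1,2)] sq_int_diff[OF assms(2,3)]] by simp

lemma sqrt_sqn_triangle_abs:
  assumes "sq_int M u" "sq_int M v"
  shows "\<bar>sqrt (sqn M u) - sqrt (sqn M v)\<bar> \<le> sqrt (sqn M (\<lambda>x. u x - v x))"
  using sqrt_sqn_triangle[OF sq_int_diff[OF assms] assms(2)]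
    sqrt_sqn_triangle[OF sq_int_diff[OF assms(2,1)] assms(1)]
  by (simp add: sqn_minus_commute[of M v u])

lemma sqn_cong_AE:
  assumes "AE x in M. u x = v x" "u \<in> borel_measurable M" "v \<in> borel_measurable M"
  shows "sqn M u = sqn M v"
  unfolding sqn_def by (rule integral_cong_AE) (use assms in auto)

lemma sqn_eq_0_iff:
  assumes "sq_int M u"
  shows "sqn M u = 0 \<longleftrightarrow> (AE x in M. u x = 0)"
  using assms by (simp add: sqn_def sq_int_def integral_nonneg_eq_0_iff_AE)

lemma tendsto_sqrt_0:
  assumes "f \<longlonglongrightarrow> 0" shows "(\<lambda>k. sqrt (f k)) \<longlonglongrightarrow> 0"
  using tendsto_real_sqrt[OF assms] by simp

lemma tendsto_sqn:
  assumes "\<And>k. sq_int M (u k)" "sq_int M v" "(\<lambda>k. sqn M (\<lambda>x. u k x - v x)) \<longlonglongrightarrow> 0"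
  shows "(\<lambda>k. sqn M (u k)) \<longlonglongrightarrow> sqn M v"
proof -
  have "(\<lambda>k. sqrt (sqn M (u k)) - sqrt (sqn M v)) \<longlonglongrightarrow> 0"
    by (rule Lim_null_comparison[OF _ tendsto_sqrt_0[OF assms(3)]])
       (use sqrt_sqn_triangle_abs[OF assms(1,2)] in auto)
  then have "(\<lambda>k. sqrt (sqn M (u k))) \<longlonglongrightarrow> sqrt (sqn M v)" by (simp add: LIM_zero_iff)
  from tendsto_power[OF this, of 2] show ?thesis by simp
qed

lemma tendsto_inner_sqn:
  assumes "\<And>k. sq_int M (u k)" "sq_int M v" "(\<lambda>k. sqn M (\<lambda>x. u k x - v x)) \<longlonglongrightarrow> 0" "sq_int M w"
  shows "(\<lambda>k. LINT x|M. u k x \<bullet> w x) \<longlonglongrightarrow> (LINT x|M. v x \<bullet> w x)"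
proof -
  have "\<bar>(LINT x|M. u k x \<bullet> w x) - (LINT x|M. v x \<bullet> w x)\<bar>
      \<le> sqrt (sqn M (\<lambda>x. u k x - v x)) * sqrt (sqn M w)" for k
    using Cauchy_Schwarz_sqn[OF sq_int_diff[OF assms(1)[of k] assms(2)] assms(4)]
      integrable_inner[OF assms(1)[of k] assms(4)] integrable_inner[OF assms(2,4)]
    by (simp add: inner_diff_left)
  moreover have "(\<lambda>k. sqrt (sqn M (\<lambda>x. u k x - v x)) * sqrt (sqn M w)) \<longlonglongrightarrow> 0"
    using tendsto_mult_right[OF tendsto_sqrt_0[OF assms(3)]] by simp
  ultimately have "(\<lambda>k. (LINT x|M. u k x \<bullet> w x) - (LINT x|M. v x \<bullet> w x)) \<longlonglongrightarrow> 0"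
    by (auto intro!: always_eventually elim!: Lim_null_comparison[rotated])
  then show ?thesis by (simp add: LIM_zero_iff)
qed

text \<open>Serves linear combinations in \<open>H10\<close> for general t, and differences through
  t = -1.\<close>

lemma tendsto_sqn_lincomb:
  fixes a b :: "nat \<Rightarrow> 'a \<Rightarrow> 'b::euclidean_space"
  assumes "(\<lambda>k. sqn M (\<lambda>x. a k x - a' x)) \<longlonglongrightarrow> 0" "(\<lambda>k. sqn M (\<lambda>x. b k x - b' x)) \<longlonglongrightarrow> 0"
    "\<And>k. sq_int M (a k)" "\<And>k. sq_int M (b k)" "sq_int M a'" "sq_int M b'"
  shows "(\<lambda>k. sqn M (\<lambda>x. (a k x + t *\<^sub>R b k x) - (a' x + t *\<^sub>R b' x))) \<longlonglongrightarrow> 0"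
proof -
  have le: "sqrt (sqn M (\<lambda>x. (a k x + t *\<^sub>R b k x) - (a' x + t *\<^sub>R b' x)))
      \<le> sqrt (sqn M (\<lambda>x. a k x - a' x)) + \<bar>t\<bar> * sqrt (sqn M (\<lambda>x. b k x - b' x))" for k
  proof -
    have e: "(\<lambda>x. (a k x + t *\<^sub>R b k x) - (a' x + t *\<^sub>R b' x)) = (\<lambda>x. (a k x - a' x) + t *\<^sub>R (b k x - b' x))"
      by (simp add: algebra_simps)
    have "sqrt (sqn M (\<lambda>x. t *\<^sub>R (b k x - b' x))) = \<bar>t\<bar> * sqrt (sqn M (\<lambda>x. b k x - b' x))"
      by (subst sqn_scaleR) (simp add: real_sqrt_mult)
    then show ?thesis
      unfolding e using sqrt_sqn_triangle[OF sq_int_diff[OF assms(3,5)] sq_int_scaleR[OF sq_int_diff[OF assms(4,6)], of t], of k k]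
      by linarith
  qed
  have "(\<lambda>k. sqrt (sqn M (\<lambda>x. a k x - a' x)) + \<bar>t\<bar> * sqrt (sqn M (\<lambda>x. b k x - b' x))) \<longlonglongrightarrow> 0 + \<bar>t\<bar> * 0"
    by (intro tendsto_add tendsto_mult tendsto_const tendsto_sqrt_0 assms(1,2))
  then have L: "(\<lambda>k. sqrt (sqn M (\<lambda>x. a k x - a' x)) + \<bar>t\<bar> * sqrt (sqn M (\<lambda>x. b k x - b' x))) \<longlonglongrightarrow> 0"
    by simp
  have "(\<lambda>k. sqrt (sqn M (\<lambda>x. (a k x + t *\<^sub>R b k x) - (a' x + t *\<^sub>R b' x)))) \<longlonglongrightarrow> 0"
    by (rule tendsto_sandwich[OF _ _ tendsto_const L]) (simp_all only: real_sqrt_ge_zero sqn_nonneg le always_eventually simp_thms)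
  from tendsto_power[OF this, of 2] show ?thesis by simp
qed

lemma (in finite_measure) integrable_sq_int:
  fixes u :: "'a \<Rightarrow> 'b::euclidean_space"
  assumes "sq_int M u"
  shows "integrable M u"
proof (rule Bochner_Integration.integrable_bound)
  show "integrable M (\<lambda>x. 1 + (norm (u x))\<^sup>2)" using assms by (simp add: sq_int_def)
  have "norm a \<le> 1 + (norm a)\<^sup>2" for a :: 'b
    using sum_squares_bound[of 1 "norm a"] norm_ge_zero[of a] by (simp; linarith)
  then show "AE x in M. norm (u x) \<le> norm (1 + (norm (u x))\<^sup>2)" by simp
qed (use assms in \<open>simp add: sq_int_def\<close>)

lemma (in finite_measure) integral_norm_le_sqn:
  fixes u :: "'a \<Rightarrow> 'b::euclidean_space"
  assumes "sq_int M u"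
  shows "(LINT x|M. norm (u x)) \<le> sqrt (sqn M u) * sqrt (measure M (space M))"
proof -
  have "sq_int M (\<lambda>x. norm (u x))" "sq_int M (\<lambda>_. 1::real)" using assms by (auto simp: sq_int_def)
  from Cauchy_Schwarz_sqn[OF this] show ?thesis by (simp add: sqn_def)
qed

lemma nn_integral_sqn: "sq_int M u \<Longrightarrow> (\<integral>\<^sup>+x. ennreal ((norm (u x))\<^sup>2) \<partial>M) = ennreal (sqn M u)"
  unfolding sq_int_def sqn_def by (intro nn_integral_eq_integral) auto

section \<open>Completeness of L2 over a finite measure\<close>

lemma strict_mono_choice:
  fixes P :: "nat \<Rightarrow> nat \<Rightarrow> bool"
  assumes "\<And>j. \<exists>N. \<forall>k\<ge>N. P j k"
  obtains r :: "nat \<Rightarrow> nat" where "strict_mono r" "\<And>j. P j (r j)"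
proof -
  obtain N where N: "\<And>j k. k \<ge> N j \<Longrightarrow> P j k" using assms by metis
  \<comment> \<open>The sum dominates each \<open>N j\<close>, and the summand j makes the sequence
    strictly increasing even where \<open>N\<close> vanishes.\<close>
  define r where "r j = (\<Sum>i\<le>j. N i) + j" for j
  have "strict_mono r" unfolding strict_mono_Suc_iff r_def by simp
  moreover have "N j \<le> r j" for j
    using member_le_sum[of j "{..j}" N] unfolding r_def by simp
  ultimately show thesis using that[of r] N by blast
qed

text \<open>Riesz-Fischer: a subsequence whose consecutive L2 distances are at most 2^(-j) converges
  almost everywhere, and Fatou's lemma turns the Cauchy condition into L2 convergence of the whole
  sequence to the pointwise limit.\<close>

lemma (in finite_measure) sq_int_complete:
  fixes u :: "nat \<Rightarrow> 'a \<Rightarrow> 'b::euclidean_space"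
  assumes u: "\<And>k. sq_int M (u k)"
    and cauchy: "\<And>e. e > 0 \<Longrightarrow> \<exists>N. \<forall>j\<ge>N. \<forall>k\<ge>N. sqn M (\<lambda>x. u j x - u k x) < e"
  obtains v where "sq_int M v" "(\<lambda>k. sqn M (\<lambda>x. u k x - v x)) \<longlonglongrightarrow> 0"
proof -
  have um[measurable]: "u k \<in> borel_measurable M" for k using u by (simp add: sq_int_def)
  obtain r :: "nat \<Rightarrow> nat" where r: "strict_mono r"
    and rj: "\<And>j. \<forall>k\<ge>r j. \<forall>l\<ge>r j. sqn M (\<lambda>x. u k x - u l x) < ((1/2) ^ j)\<^sup>2"
  proof (rule strict_mono_choice[of "\<lambda>j n. \<forall>k\<ge>n. \<forall>l\<ge>n. sqn M (\<lambda>x. u k x - u l x) < ((1/2) ^ j)\<^sup>2"])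
    show "\<exists>N. \<forall>n\<ge>N. \<forall>k\<ge>n. \<forall>l\<ge>n. sqn M (\<lambda>x. u k x - u l x) < ((1/2) ^ j)\<^sup>2" for j
      using cauchy[of "((1/2) ^ j)\<^sup>2"] by (meson le_trans zero_less_power half_gt_zero zero_less_one)
  qed blast
  define d where "d j x = u (r (Suc j)) x - u (r j) x" for j x
  have dm[measurable]: "d j \<in> borel_measurable M" for j unfolding d_def by measurable
  have sd: "sq_int M (d j)" for j unfolding d_def by (intro sq_int_diff u)
  have "sqn M (d j) \<le> ((1/2) ^ j)\<^sup>2" for j
    using rj[of j] strict_mono_leD[OF r, of j "Suc j"] unfolding d_def by (auto intro: less_imp_le)
  then have dj: "sqrt (sqn M (d j)) \<le> (1/2) ^ j" for j by (simp add: real_le_lsqrt)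
  \<comment> \<open>Finiteness of the measure bounds the L1 norms of the increments by a geometric
    sequence, so the telescoping series converges absolutely almost everywhere.\<close>
  have fin: "(\<integral>\<^sup>+x. (\<Sum>j. ennreal (norm (d j x))) \<partial>M) < \<infinity>"
  proof -
    let ?c = "sqrt (measure M (space M))"
    have "(\<integral>\<^sup>+x. (\<Sum>j. ennreal (norm (d j x))) \<partial>M) = (\<Sum>j. \<integral>\<^sup>+x. ennreal (norm (d j x)) \<partial>M)"
      by (rule nn_integral_suminf) simp
    also have "\<dots> = (\<Sum>j. ennreal (LINT x|M. norm (d j x)))"
      by (intro suminf_cong nn_integral_eq_integral integrable_norm integrable_sq_int sd) auto
    also have "\<dots> \<le> (\<Sum>j. ennreal ((1/2) ^ j * ?c))"
    proof (intro suminf_le ennreal_leI)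
      show "(LINT x|M. norm (d j x)) \<le> (1/2) ^ j * ?c" for j
        by (rule order_trans[OF integral_norm_le_sqn[OF sd]]) (intro mult_right_mono dj, simp)
    qed (rule summableI)+
    also have "\<dots> = ennreal (\<Sum>j. (1/2) ^ j * ?c)"
      using summable_mult2[OF summable_geometric[of "1/2 :: real"], of ?c]
      by (intro suminf_ennreal2) simp_all
    finally show ?thesis by (rule order_le_less_trans) simp
  qed
  have "AE x in M. (\<Sum>j. ennreal (norm (d j x))) \<noteq> \<infinity>"
    by (rule nn_integral_PInf_AE) (use fin in auto)
  then have ae: "AE x in M. convergent (\<lambda>j. u (r j) x)"
  proof eventually_elim
    case (elim x)
    have "summable (\<lambda>j. norm (d j x))"
      by (rule summable_suminf_not_top) (use elim in \<open>auto simp: infinity_ennreal_def\<close>)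
    then have "summable (\<lambda>j. d j x)" by (rule summable_norm_cancel)
    then have "convergent (\<lambda>n. \<Sum>j<n. d j x)" by (simp add: summable_iff_convergent)
    moreover have "(\<Sum>j<n. d j x) = u (r n) x - u (r 0) x" for n
      unfolding d_def by (rule sum_lessThan_telescope)
    ultimately show ?case
      using convergent_add_const_iff[of "- u (r 0) x" "\<lambda>j. u (r j) x"] by simp
  qed
  \<comment> \<open>On the null set of divergence \<open>lim\<close> has an unspecified value;
    \<open>v\<close> is measurable all the same.\<close>
  define v where "v x = lim (\<lambda>j. u (r j) x)" for x
  have vm[measurable]: "v \<in> borel_measurable M" unfolding v_def by measurable
  have aev: "AE x in M. (\<lambda>j. u (r j) x) \<longlonglongrightarrow> v x"
    using ae by eventually_elim (simp add: v_def convergent_LIMSEQ_iff)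
  \<comment> \<open>Fatou's lemma in the second index: \<open>u (r j)\<close> tends to
    \<open>v\<close> while \<open>u k\<close> stays fixed.\<close>
  have est: "(\<integral>\<^sup>+x. ennreal ((norm (u k x - v x))\<^sup>2) \<partial>M) \<le> ennreal e"
    if N: "\<forall>j\<ge>N. \<forall>k\<ge>N. sqn M (\<lambda>x. u j x - u k x) < e" and k: "k \<ge> N" for e N k
  proof -
    have "(\<integral>\<^sup>+x. ennreal ((norm (u k x - v x))\<^sup>2) \<partial>M)
        = (\<integral>\<^sup>+x. liminf (\<lambda>j. ennreal ((norm (u k x - u (r j) x))\<^sup>2)) \<partial>M)"
    proof (intro nn_integral_cong_AE)
      show "AE x in M. ennreal ((norm (u k x - v x))\<^sup>2) = liminf (\<lambda>j. ennreal ((norm (u k x - u (r j) x))\<^sup>2))"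
        using aev
      proof eventually_elim
        case (elim x)
        have "(\<lambda>j. ennreal ((norm (u k x - u (r j) x))\<^sup>2)) \<longlonglongrightarrow> ennreal ((norm (u k x - v x))\<^sup>2)"
          by (intro tendsto_ennrealI tendsto_intros elim)
        from lim_imp_Liminf[OF trivial_limit_sequentially this] show ?case by (rule sym)
      qed
    qed
    also have "\<dots> \<le> liminf (\<lambda>j. \<integral>\<^sup>+x. ennreal ((norm (u k x - u (r j) x))\<^sup>2) \<partial>M)"
      by (rule nn_integral_liminf) simp
    also have "\<dots> \<le> ennreal e"
    proof (rule Liminf_le)
      show "\<forall>\<^sub>F j in sequentially. (\<integral>\<^sup>+x. ennreal ((norm (u k x - u (r j) x))\<^sup>2) \<partial>M) \<le> ennreal e"
        unfolding eventually_sequentially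
      proof (intro exI[of _ N] allI impI)
        fix j assume "N \<le> j"
        then have "N \<le> r j" using seq_suble[OF r, of j] by linarith
        then have "sqn M (\<lambda>x. u k x - u (r j) x) < e" using N k by blast
        then show "(\<integral>\<^sup>+x. ennreal ((norm (u k x - u (r j) x))\<^sup>2) \<partial>M) \<le> ennreal e"
          by (simp add: nn_integral_sqn[OF sq_int_diff[OF u u]] ennreal_leI)
      qed
    qed simp
    finally show ?thesis .
  qed
  have si: "sq_int M (\<lambda>x. u k x - v x)"
    if N: "\<forall>j\<ge>N. \<forall>k\<ge>N. sqn M (\<lambda>x. u j x - u k x) < e" and k: "k \<ge> N" for e N k
    unfolding sq_int_def using est[OF that]
    by (auto intro!: integrableI_nonneg simp: order_le_less_trans[OF _ ennreal_less_top])
  have sle: "sqn M (\<lambda>x. u k x - v x) \<le> e"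
    if N: "\<forall>j\<ge>N. \<forall>k\<ge>N. sqn M (\<lambda>x. u j x - u k x) < e" and k: "k \<ge> N" for e N k
  proof -
    \<comment> \<open>The strict Cauchy bound with both indices equal forces e > 0, without which
      \<open>ennreal e\<close> would not determine e.\<close>
    have "0 < e" using N sqn_nonneg[of M "\<lambda>x. u k x - u k x"] k by (meson le_less_trans)
    then show ?thesis using est[OF that] unfolding nn_integral_sqn[OF si[OF that]] by simp
  qed
  obtain N where N: "\<forall>j\<ge>N. \<forall>k\<ge>N. sqn M (\<lambda>x. u j x - u k x) < 1"
    using cauchy[of 1] by auto
  \<comment> \<open>\<open>v\<close> is the difference of \<open>u N\<close> and
    \<open>u N - v\<close>, both square integrable.\<close>
  have sv: "sq_int M v" using sq_int_diff[OF u[of N] si[OF N, of N]] by simp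
  moreover have "(\<lambda>k. sqn M (\<lambda>x. u k x - v x)) \<longlonglongrightarrow> 0"
  proof (rule LIMSEQ_I)
    fix e :: real assume e: "0 < e"
    obtain N where N: "\<forall>j\<ge>N. \<forall>k\<ge>N. sqn M (\<lambda>x. u j x - u k x) < e/2"
      using cauchy[of "e/2"] e by auto
    have "sqn M (\<lambda>x. u k x - v x) < e" if "k \<ge> N" for k
      using sle[OF N that] e by linarith
    then show "\<exists>no. \<forall>k\<ge>no. norm (sqn M (\<lambda>x. u k x - v x) - 0) < e" by auto
  qed
  ultimately show thesis by (rule that)
qed

subsection \<open>Smooth functions\<close>

lemma Ck_continuous: "Ck k f \<Longrightarrow> continuous_on UNIV f"
  by (cases k) (auto intro!: differentiable_imp_continuous_on simp: differentiable_on_def)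

lemma Ck_Suc_imp: "Ck (Suc k) f \<Longrightarrow> Ck k f"
proof (induction k arbitrary: f)
  case 0
  then show ?case using Ck_continuous[of "Suc 0" f] by simp
next
  case (Suc k)
  have "Ck k (\<lambda>x. frechet_derivative f (at x) v)" for v
    using Suc.prems by (intro Suc.IH) simp
  then show ?case using Suc.prems by simp
qed

lemma frechet_derivative_eq:
  "(f has_derivative f') (at x) \<Longrightarrow> frechet_derivative f (at x) = f'"
  using frechet_derivative_at by metis

lemma frechet_has_derivative:
  "f differentiable (at x) \<Longrightarrow> (f has_derivative frechet_derivative f (at x)) (at x)"
  by (simp add: frechet_derivative_works)

text \<open>Lets any explicitly given derivative stand for the chosen
  \<open>frechet_derivative\<close>, so each closure property of \<open>Ck\<close> becomes a single
  induction on the order.\<close>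

lemma Ck_SucI:
  assumes "\<And>x. (f has_derivative f' x) (at x)" "\<And>v. Ck k (\<lambda>x. f' x v)"
  shows "Ck (Suc k) f"
proof -
  have "frechet_derivative f (at x) = f' x" for x
    using frechet_derivative_eq[OF assms(1)] .
  then show ?thesis using assms by (auto simp: differentiable_def)
qed

lemma Ck_const: "Ck k (\<lambda>x. c)"
proof (induction k arbitrary: c)
  case (Suc k)
  show ?case by (rule Ck_SucI[where f' = "\<lambda>x v. 0"]) (auto intro: Suc)
qed simp

lemma Ck_add: "Ck k f \<Longrightarrow> Ck k g \<Longrightarrow> Ck k (\<lambda>x. f x + g x)"
proof (induction k arbitrary: f g)
  case 0
  then show ?case by (simp add: continuous_on_add)
next
  case (Suc k)
  show ?case
  proof (rule Ck_SucI)
    show "((\<lambda>x. f x + g x) has_derivative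
        (\<lambda>v. frechet_derivative f (at x) v + frechet_derivative g (at x) v)) (at x)" for x
      using Suc.prems by (intro has_derivative_add frechet_has_derivative) auto
    show "Ck k (\<lambda>x. frechet_derivative f (at x) v + frechet_derivative g (at x) v)" for v
      using Suc.prems by (intro Suc.IH) auto
  qed
qed

lemma Ck_mult: "Ck k f \<Longrightarrow> Ck k g \<Longrightarrow> Ck k (\<lambda>x. f x * g x)"
proof (induction k arbitrary: f g)
  case 0
  then show ?case by (simp add: continuous_on_mult)
next
  case (Suc k)
  show ?case
  proof (rule Ck_SucI)
    show "((\<lambda>x. f x * g x) has_derivative
        (\<lambda>v. f x * frechet_derivative g (at x) v + frechet_derivative f (at x) v * g x)) (at x)" for x
      using Suc.prems by (intro has_derivative_mult frechet_has_derivative) auto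
    show "Ck k (\<lambda>x. f x * frechet_derivative g (at x) v + frechet_derivative f (at x) v * g x)" for v
      \<comment> \<open>The product rule leaves one factor undifferentiated, so that factor has to
        be lowered from order \<open>Suc k\<close> to order k.\<close>
      using Suc.prems Ck_Suc_imp[OF Suc.prems(1)] Ck_Suc_imp[OF Suc.prems(2)]
      by (intro Ck_add Suc.IH) auto
  qed
qed

lemma Ck_affine: "Ck k f \<Longrightarrow> Ck k (\<lambda>x. f (b + t *\<^sub>R x))"
proof (induction k arbitrary: f)
  case 0
  have "continuous_on UNIV (\<lambda>x. b + t *\<^sub>R x)" by (intro continuous_intros)
  then show ?case using 0 continuous_on_compose2[of UNIV f UNIV] by simp
next
  case (Suc k)
  show ?case
  proof (rule Ck_SucI)
    show "((\<lambda>x. f (b + t *\<^sub>R x)) has_derivative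
        (\<lambda>v. frechet_derivative f (at (b + t *\<^sub>R x)) (t *\<^sub>R v))) (at x)" for x
    proof (rule has_derivative_compose[where g = f and f = "\<lambda>x. b + t *\<^sub>R x"])
      show "((\<lambda>x. b + t *\<^sub>R x) has_derivative (\<lambda>v. t *\<^sub>R v)) (at x)"
        by (auto intro!: derivative_eq_intros)
      show "(f has_derivative frechet_derivative f (at (b + t *\<^sub>R x))) (at (b + t *\<^sub>R x))"
        using Suc.prems by (intro frechet_has_derivative) simp
    qed
    show "Ck k (\<lambda>x. frechet_derivative f (at (b + t *\<^sub>R x)) (t *\<^sub>R v))" for v
      using Suc.prems by (intro Suc.IH) simp
  qed
qed

lemma Ck_prod: "finite I \<Longrightarrow> (\<And>i. i \<in> I \<Longrightarrow> Ck k (f i)) \<Longrightarrow> Ck k (\<lambda>x. \<Prod>i\<in>I. f i x)"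
  by (induction I rule: finite_induct) (auto intro: Ck_const Ck_mult)

lemma smooth_differentiable: "smooth f \<Longrightarrow> f differentiable (at x)"
  by (simp add: smooth_def) (metis Ck.simps(2))

lemma smooth_frechet: "smooth f \<Longrightarrow> smooth (\<lambda>x. frechet_derivative f (at x) v)"
  by (simp add: smooth_def) (metis Ck.simps(2))

lemma smooth_lincomb: "smooth f \<Longrightarrow> smooth g \<Longrightarrow> smooth (\<lambda>x. c * f x + d * g x)"
  by (simp add: smooth_def Ck_add Ck_mult Ck_const)

lemma smooth_affine: "smooth f \<Longrightarrow> smooth (\<lambda>x. f (b + t *\<^sub>R x))"
  by (simp add: smooth_def Ck_affine)

lemma smooth_continuous: "smooth f \<Longrightarrow> continuous_on UNIV f"
  unfolding smooth_def using Ck.simps(1) by blast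

lemma gradient_inner: "gradient f x \<bullet> v = frechet_derivative f (at x) v"
  if "f differentiable (at x)" for f :: "real^'n \<Rightarrow> real"
proof -
  interpret linear "frechet_derivative f (at x)"
    using that by (rule linear_frechet_derivative)
  have "frechet_derivative f (at x) v = frechet_derivative f (at x) (\<Sum>i\<in>UNIV. (v $ i) *\<^sub>R axis i 1)"
    using basis_expansion[of v] by (simp add: scalar_mult_eq_scaleR)
  also have "\<dots> = gradient f x \<bullet> v"
    by (simp add: sum scale gradient_def partial_deriv_def inner_vec_def mult.commute)
  finally show ?thesis by simp
qed

lemma gradient_eqI:
  assumes "(f has_derivative (\<lambda>v. g \<bullet> v)) (at x)" shows "gradient f x = g"
  unfolding gradient_def partial_deriv_def frechet_derivative_eq[OF assms]
  by (simp add: vec_eq_iff inner_axis)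

lemma smooth_has_derivative: "smooth f \<Longrightarrow> (f has_derivative (\<lambda>v. gradient f x \<bullet> v)) (at x)"
  using frechet_has_derivative[OF smooth_differentiable, of f x] gradient_inner[OF smooth_differentiable, of f x]
  by (simp add: eta_contract_eq)

lemma smooth_gradient_continuous: "smooth f \<Longrightarrow> continuous_on UNIV (gradient f)"
  unfolding gradient_def partial_deriv_def
  by (intro continuous_on_vec_lambda smooth_continuous smooth_frechet)

lemma partial_deriv_gradient: "partial_deriv i f x = gradient f x $ i"
  by (simp add: gradient_def)

lemma test_smooth: "\<phi> \<in> test_functions \<Omega> \<Longrightarrow> smooth \<phi>"
  by (simp add: test_functions_def)

lemma gradient_zero_outside:
  assumes "x \<notin> closure {x. f x \<noteq> 0}" shows "gradient f x = 0"
proof (rule gradient_eqI)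
  have "((\<lambda>x. 0) has_derivative (\<lambda>v. 0 \<bullet> v)) (at x)" by simp
  then show "(f has_derivative (\<lambda>v. 0 \<bullet> v)) (at x)"
  proof (rule has_derivative_transform_within_open[where s = "- closure {x. f x \<noteq> 0}"])
    show "0 = f y" if "y \<in> - closure {x. f x \<noteq> 0}" for y
      using that closure_subset[of "{x. f x \<noteq> 0}"] by auto
  qed (use assms in auto)
qed

lemma test_support:
  assumes "\<phi> \<in> test_functions \<Omega>"
  obtains K where "compact K" "K \<subseteq> \<Omega>" "\<And>x. x \<notin> K \<Longrightarrow> \<phi> x = 0" "\<And>x. x \<notin> K \<Longrightarrow> gradient \<phi> x = 0"
proof (rule that)
  let ?K = "closure {x. \<phi> x \<noteq> 0}"
  show "compact ?K" "?K \<subseteq> \<Omega>" using assms by (auto simp: test_functions_def)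
  show "\<phi> x = 0" if "x \<notin> ?K" for x using that closure_subset[of "{x. \<phi> x \<noteq> 0}"] by auto
  show "gradient \<phi> x = 0" if "x \<notin> ?K" for x using that by (rule gradient_zero_outside)
qed

lemma test_functionsI:
  assumes "smooth \<phi>" "compact K" "K \<subseteq> \<Omega>" "\<And>x. x \<notin> K \<Longrightarrow> \<phi> x = 0"
  shows "\<phi> \<in> test_functions \<Omega>"
proof -
  have "closure {x. \<phi> x \<noteq> 0} \<subseteq> K"
    using assms(4) by (intro closure_minimal compact_imp_closed assms) auto
  then show ?thesis
    using assms compact_closure bounded_subset[OF compact_imp_bounded[OF assms(2)]] closure_subset[of "{x. \<phi> x \<noteq> 0}"]
    unfolding test_functions_def by (auto intro: dual_order.trans)
qed

lemma test_zero_outside: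
  assumes "\<phi> \<in> test_functions \<Omega>" "x \<notin> \<Omega>" shows "\<phi> x = 0" "gradient \<phi> x = 0"
  using test_support[OF assms(1)] assms(2) by (metis subsetD)+

lemma test_lincomb:
  assumes "\<phi> \<in> test_functions \<Omega>" "\<psi> \<in> test_functions \<Omega>"
  shows "(\<lambda>x. c * \<phi> x + d * \<psi> x) \<in> test_functions \<Omega>"
    and "gradient (\<lambda>x. c * \<phi> x + d * \<psi> x) = (\<lambda>x. c *\<^sub>R gradient \<phi> x + d *\<^sub>R gradient \<psi> x)"
proof -
  obtain K where K: "compact K" "K \<subseteq> \<Omega>" "\<And>x. x \<notin> K \<Longrightarrow> \<phi> x = 0" using test_support[OF assms(1)] by metis
  obtain L where L: "compact L" "L \<subseteq> \<Omega>" "\<And>x. x \<notin> L \<Longrightarrow> \<psi> x = 0" using test_support[OF assms(2)] by metis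
  show "(\<lambda>x. c * \<phi> x + d * \<psi> x) \<in> test_functions \<Omega>"
    using smooth_lincomb[OF assms[THEN test_smooth], of c d] K L
    by (intro test_functionsI[where K = "K \<union> L"]) auto
  show "gradient (\<lambda>x. c * \<phi> x + d * \<psi> x) = (\<lambda>x. c *\<^sub>R gradient \<phi> x + d *\<^sub>R gradient \<psi> x)"
  proof
    fix x
    show "gradient (\<lambda>x. c * \<phi> x + d * \<psi> x) x = c *\<^sub>R gradient \<phi> x + d *\<^sub>R gradient \<psi> x"
    proof (rule gradient_eqI)
      show "((\<lambda>x. c * \<phi> x + d * \<psi> x) has_derivative (\<lambda>v. (c *\<^sub>R gradient \<phi> x + d *\<^sub>R gradient \<psi> x) \<bullet> v)) (at x)"
        using assms[THEN test_smooth, THEN smooth_has_derivative, of x]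
        by (auto intro!: derivative_eq_intros simp: inner_add_left)
    qed
  qed
qed

lemma gradient_affine:
  assumes "smooth \<phi>"
  shows "gradient (\<lambda>x. \<phi> (b + t *\<^sub>R x)) x = t *\<^sub>R gradient \<phi> (b + t *\<^sub>R x)"
proof (rule gradient_eqI)
  have "((\<lambda>x. \<phi> (b + t *\<^sub>R x)) has_derivative (\<lambda>v. gradient \<phi> (b + t *\<^sub>R x) \<bullet> (t *\<^sub>R v))) (at x)"
  proof (rule has_derivative_compose[where g = \<phi> and f = "\<lambda>x. b + t *\<^sub>R x"])
    show "((\<lambda>x. b + t *\<^sub>R x) has_derivative (\<lambda>v. t *\<^sub>R v)) (at x)"
      by (auto intro!: derivative_eq_intros)
  qed (rule smooth_has_derivative[OF assms])
  then show "((\<lambda>x. \<phi> (b + t *\<^sub>R x)) has_derivative (\<lambda>v. (t *\<^sub>R gradient \<phi> (b + t *\<^sub>R x)) \<bullet> v)) (at x)"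
    by simp
qed

subsection \<open>Bump functions\<close>

text \<open>The derivatives of exp(-1/t) are linear combinations of the functions t^(-j) exp(-1/t).
  Taking the whole family in j makes it closed under differentiation, and smoothness follows by one
  induction.\<close>

definition flat :: "nat \<Rightarrow> real \<Rightarrow> real" where
  "flat j t = (if t > 0 then exp (- 1 / t) / t ^ j else 0)"

text \<open>The term of degree j + 2 in the series of exp(1/t) is at most exp(1/t). Degree j + 2
  rather than j leaves the factor t^2 that makes the derivative at 0 vanish.\<close>

lemma flat_bound: "\<bar>flat j t\<bar> \<le> fact (j + 2) * t\<^sup>2"
proof (cases "t > 0")
  case True
  have "(1 / t) ^ (j + 2) / fact (j + 2) \<le> (\<Sum>k. (1 / t) ^ k / fact k)"
    using sum_le_suminf[of "\<lambda>k. (1 / t) ^ k / fact k" "{j + 2}"] True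
      summable_exp[of "1 / t"] by (simp add: divide_inverse mult.commute)
  also have "\<dots> = exp (1 / t)"
    by (simp add: exp_def divide_inverse mult.commute)
  finally have "(1 / t) ^ (j + 2) \<le> exp (1 / t) * fact (j + 2)"
    by (simp only: pos_divide_le_eq fact_gt_zero)
  then have "1 \<le> exp (1 / t) * fact (j + 2) * t ^ (j + 2)"
    using mult_right_mono[of "(1 / t) ^ (j + 2)" _ "t ^ (j + 2)"] True
    by (simp add: power_mult_distrib[symmetric] del: power_add power_Suc)
  then have "exp (- (1 / t)) * 1 \<le> exp (- (1 / t)) * (exp (1 / t) * fact (j + 2) * t ^ (j + 2))"
    by (intro mult_left_mono) auto
  also have "\<dots> = (exp (- (1 / t)) * exp (1 / t)) * (fact (j + 2) * t ^ (j + 2))"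
    by (simp only: mult.assoc)
  finally have "exp (- 1 / t) \<le> fact (j + 2) * t ^ (j + 2)"
    by (simp only: mult_exp_exp) simp
  then have "exp (- 1 / t) / t ^ j \<le> fact (j + 2) * t\<^sup>2"
    using True by (simp add: pos_divide_le_eq power_add mult_ac power2_eq_square del: fact_Suc)
  then show ?thesis using True by (simp add: flat_def del: fact_Suc)
qed (simp add: flat_def)

lemma flat_DERIV: "DERIV (flat j) t :> flat (j + 2) t - real j * flat (j + 1) t"
proof (cases t "0 :: real" rule: linorder_cases)
  case less
  have "DERIV (\<lambda>_. 0) t :> (0::real)" by simp
  then have "DERIV (flat j) t :> 0"
    by (rule has_field_derivative_transform_within_open[where S = "{..<0}"])
       (use less in \<open>auto simp: flat_def\<close>)
  then show ?thesis using less by (simp add: flat_def)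
next
  case equal
  \<comment> \<open>By \<open>flat_bound\<close> the difference quotient at 0 is at most (j + 2)!
    |h|.\<close>
  have "(\<lambda>h. (flat j (0 + h) - flat j 0) / h) \<midarrow>0\<rightarrow> 0"
  proof (rule Lim_null_comparison)
    show "\<forall>\<^sub>F h in at 0. norm ((flat j (0 + h) - flat j 0) / h) \<le> fact (j + 2) * \<bar>h\<bar>"
    proof (intro always_eventually allI)
      fix h :: real
      show "norm ((flat j (0 + h) - flat j 0) / h) \<le> fact (j + 2) * \<bar>h\<bar>"
        using flat_bound[of j h] flat_bound[of j 0]
        by (cases "h = 0") (simp_all add: divide_le_eq power2_eq_square abs_mult_self_eq mult.assoc)
    qed
    show "(\<lambda>h. fact (j + 2) * \<bar>h\<bar>) \<midarrow>0\<rightarrow> (0::real)"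
      by (auto intro!: tendsto_eq_intros)
  qed
  then show ?thesis using equal by (simp add: DERIV_def flat_def)
next
  case greater
  have "DERIV (\<lambda>t. exp (- 1 / t) / t ^ j) t :> flat (j + 2) t - real j * flat (j + 1) t"
    using greater
    apply (cases j)
     apply (auto intro!: derivative_eq_intros simp: flat_def field_simps power2_eq_square)
    subgoal for n by (cases n) auto
    done
  then show ?thesis
    by (rule has_field_derivative_transform_within_open[where S = "{0<..}"])
       (use greater in \<open>auto simp: flat_def\<close>)
qed

lemma Ck_flat: "Ck k (\<lambda>x. flat j (v \<bullet> x + c))"
proof (induction k arbitrary: j)
  case 0
  have "continuous_on UNIV (flat j)"
    using flat_DERIV by (intro DERIV_continuous_on) blast
  then show ?case by (auto intro!: continuous_on_compose2[of UNIV "flat j"] continuous_intros)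
next
  case (Suc k)
  show ?case
  proof (rule Ck_SucI)
    show "((\<lambda>x. flat j (v \<bullet> x + c)) has_derivative
       (\<lambda>h. (flat (j + 2) (v \<bullet> x + c) + (- real j) * flat (j + 1) (v \<bullet> x + c)) * (v \<bullet> h))) (at x)" for x
    proof (rule has_derivative_compose[where g = "flat j" and f = "\<lambda>x. v \<bullet> x + c" and f' = "\<lambda>h. v \<bullet> h"])
      show "((\<lambda>x. v \<bullet> x + c) has_derivative (\<lambda>h. v \<bullet> h)) (at x)"
        by (auto intro!: derivative_eq_intros)
      show "(flat j has_derivative (*) (flat (j + 2) (v \<bullet> x + c) + (- real j) * flat (j + 1) (v \<bullet> x + c)))
         (at (v \<bullet> x + c))"
        using flat_DERIV[of j "v \<bullet> x + c"] by (simp add: has_field_derivative_def)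
    qed
  qed (intro Ck_mult Ck_add Ck_const Suc)
qed

text \<open>As \<open>m\<close> grows, this increases to the indicator function of \<open>box a b\<close>.\<close>

definition bump :: "real^'n \<Rightarrow> real^'n \<Rightarrow> real \<Rightarrow> real^'n \<Rightarrow> real" where
  "bump a b m x = (\<Prod>i\<in>UNIV. flat 0 (m * (x $ i - a $ i)) * flat 0 (m * (b $ i - x $ i)))"

lemma smooth_bump: "smooth (bump a b m)"
proof -
  have "Ck k (\<lambda>x. flat 0 ((m *\<^sub>R axis i 1) \<bullet> x + (- m * a $ i)) * flat 0 ((- m *\<^sub>R axis i 1) \<bullet> x + m * b $ i))" for k i
    by (intro Ck_mult Ck_flat)
  then have "Ck k (\<lambda>x. flat 0 (m * (x $ i - a $ i)) * flat 0 (m * (b $ i - x $ i)))" for k i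
    by (simp add: inner_axis' algebra_simps)
  then show ?thesis unfolding smooth_def bump_def by (intro allI Ck_prod) auto
qed

lemma bump_eq_0:
  assumes "m > 0" "x \<notin> box a b" shows "bump a b m x = 0"
proof -
  obtain i where "x $ i \<le> a $ i \<or> b $ i \<le> x $ i" using assms(2) by (auto simp: mem_box_cart not_less)
  then have "flat 0 (m * (x $ i - a $ i)) * flat 0 (m * (b $ i - x $ i)) = 0"
    using assms(1) by (auto simp: flat_def zero_less_mult_iff)
  then show ?thesis unfolding bump_def by (meson UNIV_I finite prod_zero)
qed

lemma flat_0_bounds: "0 \<le> flat 0 t" "flat 0 t \<le> 1"
  by (auto simp: flat_def)

lemma bump_bounds: "0 \<le> bump a b m x" "bump a b m x \<le> 1"
proof -
  have *: "0 \<le> flat 0 s * flat 0 t \<and> flat 0 s * flat 0 t \<le> 1" for s t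
    using flat_0_bounds[of s] flat_0_bounds[of t] by (simp only: mult_nonneg_nonneg mult_le_one simp_thms)
  then show "0 \<le> bump a b m x" unfolding bump_def by (intro prod_nonneg) (use * in blast)
  show "bump a b m x \<le> 1" unfolding bump_def by (rule prod_le_1) (rule *)
qed

lemma bump_pos:
  assumes "m > 0" "x \<in> box a b" shows "0 < bump a b m x"
proof -
  have "0 < flat 0 (m * (x $ i - a $ i)) * flat 0 (m * (b $ i - x $ i))" for i
    using assms by (simp add: flat_def mem_box_cart)
  then show ?thesis unfolding bump_def by (rule prod_pos)
qed

lemma bump_in_test_functions:
  assumes "m > 0" "cbox a b \<subseteq> \<Omega>" shows "bump a b m \<in> test_functions \<Omega>"
proof (rule test_functionsI[OF smooth_bump compact_cbox assms(2)])
  fix x assume "x \<notin> cbox a b"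
  then have "x \<notin> box a b" using box_subset_cbox by blast
  then show "bump a b m x = 0" by (rule bump_eq_0[OF assms(1)])
qed

lemma flat_limit: "t > 0 \<Longrightarrow> (\<lambda>n. flat 0 (real (Suc n) * t)) \<longlonglongrightarrow> 1"
proof -
  assume t: "t > 0"
  have "(\<lambda>n. exp (- (1 / t) * inverse (real (Suc n)))) \<longlonglongrightarrow> exp (- (1 / t) * 0)"
    by (intro tendsto_intros LIMSEQ_inverse_real_of_nat)
  moreover have "flat 0 (real (Suc n) * t) = exp (- (1 / t) * inverse (real (Suc n)))" for n
    using mult_pos_pos[of "real (Suc n)" t] t by (simp add: flat_def field_simps)
  ultimately show ?thesis by simp
qed

lemma bump_limit: "(\<lambda>n. bump a b (real (Suc n)) x) \<longlonglongrightarrow> indicator (box a b) x"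
proof (cases "x \<in> box a b")
  case True
  have "(\<lambda>n. bump a b (real (Suc n)) x) \<longlonglongrightarrow> (\<Prod>i\<in>(UNIV::'a set). 1 * 1)"
    unfolding bump_def using True
    by (intro tendsto_prod tendsto_mult flat_limit) (auto simp: mem_box_cart)
  then show ?thesis using True by simp
qed (simp add: bump_eq_0)

subsection \<open>Integration by parts and weak gradients\<close>

text \<open>The compact set is any one that contains the support, so products and affine
  substitutions do not require a support to be recomputed. The values are vectors so that functions
  and gradients are treated alike.\<close>

definition cont_supp :: "(real^'n) set \<Rightarrow> (real^'n \<Rightarrow> 'b::euclidean_space) \<Rightarrow> bool" where
  "cont_supp S f \<longleftrightarrow> continuous_on UNIV f \<and> (\<exists>K. compact K \<and> K \<subseteq> S \<and> (\<forall>x. x \<notin> K \<longrightarrow> f x = 0))"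

lemma cont_supp_test: "\<phi> \<in> test_functions \<Omega> \<Longrightarrow> cont_supp \<Omega> \<phi>"
  unfolding cont_supp_def using test_support smooth_continuous[OF test_smooth] by metis

lemma cont_supp_gradient: "\<phi> \<in> test_functions \<Omega> \<Longrightarrow> cont_supp \<Omega> (gradient \<phi>)"
  unfolding cont_supp_def using test_support smooth_gradient_continuous[OF test_smooth] by metis

lemma cont_supp_borel: "cont_supp S f \<Longrightarrow> f \<in> borel_measurable borel"
  by (simp add: cont_supp_def borel_measurable_continuous_onI)

lemma cont_supp_integrable:
  assumes "cont_supp S f" shows "integrable lborel f"
proof -
  obtain K where K: "compact K" "\<And>x. x \<notin> K \<Longrightarrow> f x = 0" using assms by (auto simp: cont_supp_def)
  have "integrable lborel (\<lambda>x. indicator K x *\<^sub>R f x)"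
    using assms K by (intro borel_integrable_compact) (auto simp: cont_supp_def intro: continuous_on_subset)
  moreover have "(\<lambda>x. indicator K x *\<^sub>R f x) = f" using K by (auto simp: indicator_def)
  ultimately show ?thesis by simp
qed

lemma cont_supp_bounded:
  assumes "cont_supp S f" obtains B where "B > 0" "\<And>x. norm (f x) \<le> B"
proof -
  obtain K where K: "compact K" "\<And>x. x \<notin> K \<Longrightarrow> f x = 0" using assms by (auto simp: cont_supp_def)
  have "compact (f ` K)"
    using assms K by (intro compact_continuous_image) (auto simp: cont_supp_def intro: continuous_on_subset)
  then obtain B where "B > 0" "\<forall>y\<in>f ` K. norm y \<le> B" using compact_imp_bounded bounded_pos by metis
  then show thesis using that[of B] K(2) by (metis imageI less_imp_le norm_zero)
qed

lemma cont_supp_outside: "cont_supp S f \<Longrightarrow> x \<notin> S \<Longrightarrow> f x = 0"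
  unfolding cont_supp_def by blast

lemma cont_supp_compose:
  assumes "cont_supp S f" "continuous_on UNIV g" "\<And>x. f x = 0 \<Longrightarrow> g x = 0"
  shows "cont_supp S g"
  using assms unfolding cont_supp_def by metis

lemma cont_supp_norm2: "cont_supp S f \<Longrightarrow> cont_supp S (\<lambda>x. (norm (f x))\<^sup>2)"
  by (rule cont_supp_compose) (auto intro!: continuous_intros simp: cont_supp_def)

lemma cont_supp_mult:
  fixes f g :: "real^'n \<Rightarrow> real"
  shows "cont_supp S f \<Longrightarrow> continuous_on UNIV g \<Longrightarrow> cont_supp S (\<lambda>x. f x * g x)"
  by (rule cont_supp_compose) (auto intro!: continuous_intros simp: cont_supp_def)

lemma cont_supp_component: "cont_supp S f \<Longrightarrow> cont_supp S (\<lambda>x. f x $ i)"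
  by (rule cont_supp_compose) (auto intro!: continuous_intros simp: cont_supp_def)

text \<open>The problem is stated with \<open>lebesgue_on \<Omega>\<close>, whereas Tonelli's
  theorem, translations and the fundamental theorem of calculus are applied over
  \<open>lborel\<close>. Functions that vanish outside \<open>\<Omega>\<close> can be moved from one
  to the other.\<close>

lemma
  fixes f :: "real^'n \<Rightarrow> 'b::euclidean_space"
  assumes \<Omega>: "\<Omega> \<in> sets lebesgue" and f: "f \<in> borel_measurable borel" "\<And>x. x \<notin> \<Omega> \<Longrightarrow> f x = 0"
  shows integral_lebesgue_on_eq: "(LINT x|lebesgue_on \<Omega>. f x) = (LINT x|lborel. f x)"
    and integrable_lebesgue_on_eq: "integrable (lebesgue_on \<Omega>) f \<longleftrightarrow> integrable lborel f"
proof -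
  have eq: "(\<lambda>x. indicator \<Omega> x *\<^sub>R f x) = f" using f(2) by (auto simp: indicator_def)
  show "(LINT x|lebesgue_on \<Omega>. f x) = (LINT x|lborel. f x)"
    using \<Omega> f(1) by (simp add: integral_restrict_space eq integral_completion)
  show "integrable (lebesgue_on \<Omega>) f \<longleftrightarrow> integrable lborel f"
    using \<Omega> f(1) by (simp add: integrable_restrict_space eq integrable_completion)
qed

lemma borel_measurable_lebesgue_on: "f \<in> borel_measurable borel \<Longrightarrow> f \<in> borel_measurable (lebesgue_on \<Omega>)"
  by (intro measurable_restrict_space1 measurable_completion) simp

lemma
  fixes f :: "real^'n \<Rightarrow> 'b::euclidean_space"
  assumes f: "cont_supp \<Omega> f"
  shows cont_supp_sq_int_lborel: "sq_int lborel f"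
    and cont_supp_sq_int: "\<Omega> \<in> sets lebesgue \<Longrightarrow> sq_int (lebesgue_on \<Omega>) f"
    and cont_supp_sqn: "\<Omega> \<in> sets lebesgue \<Longrightarrow> sqn (lebesgue_on \<Omega>) f = sqn lborel f"
proof -
  note f2 = cont_supp_norm2[OF f]
  show 1: "sq_int lborel f" using cont_supp_integrable[OF f2] cont_supp_borel[OF f] by (simp add: sq_int_def)
  assume \<Omega>: "\<Omega> \<in> sets lebesgue"
  show "sq_int (lebesgue_on \<Omega>) f"
    using cont_supp_integrable[OF f2] integrable_lebesgue_on_eq[OF \<Omega> cont_supp_borel[OF f2] cont_supp_outside[OF f2]]
      borel_measurable_lebesgue_on[OF cont_supp_borel[OF f]]
    by (simp add: sq_int_def)
  show "sqn (lebesgue_on \<Omega>) f = sqn lborel f"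
    unfolding sqn_def using integral_lebesgue_on_eq[OF \<Omega> cont_supp_borel[OF f2] cont_supp_outside[OF f2]] .
qed

lemma lipschitz_of_gradient_bound:
  fixes F :: "real^'n \<Rightarrow> real"
  assumes "\<And>x. (F has_derivative (\<lambda>v. G x \<bullet> v)) (at x)" "\<And>x. norm (G x) \<le> B"
  shows "\<bar>F x - F y\<bar> \<le> B * norm (x - y)"
proof -
  have "onorm (\<lambda>v. G x \<bullet> v) \<le> B" for x
    by (rule onorm_le) (metis Cauchy_Schwarz_ineq2 assms(2) mult_right_mono norm_ge_zero order_trans real_norm_def)
  then show ?thesis
    using differentiable_bound[of UNIV F "\<lambda>x v. G x \<bullet> v" B x y] assms(1) by simp
qed

lemma lborel_integral_translation:
  fixes f :: "'a::euclidean_space \<Rightarrow> 'b::euclidean_space"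
  assumes "f \<in> borel_measurable borel"
  shows "(LINT x|lborel. f (x + z)) = (LINT x|lborel. f x)"
proof -
  have "(LINT x|lborel. f x) = (LINT x|distr lborel borel ((+) z). f x)" by (simp add: lborel_distr_plus)
  also have "\<dots> = (LINT x|lborel. f (z + x))" using assms by (subst integral_distr) auto
  finally show ?thesis by (simp add: add.commute)
qed

text \<open>Difference quotients have integral zero by translation invariance.\<close>

lemma integral_derivative_zero:
  fixes F :: "real^'n \<Rightarrow> real"
  assumes F: "cont_supp UNIV F" and G: "cont_supp UNIV G"
    and FG: "\<And>x. (F has_derivative (\<lambda>v. G x \<bullet> v)) (at x)"
  shows "(LINT x|lborel. G x \<bullet> e) = 0"
proof -
  obtain K where K: "compact K" "\<And>x. x \<notin> K \<Longrightarrow> F x = 0" using F by (auto simp: cont_supp_def)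
  obtain R where R: "\<And>x. x \<in> K \<Longrightarrow> norm x \<le> R" using K(1) compact_imp_bounded bounded_iff by metis
  obtain B where B: "B > 0" "\<And>x. norm (G x) \<le> B" using cont_supp_bounded[OF G] by metis
  \<comment> \<open>Steps of length at most 1 keep all shifted supports inside one ball.\<close>
  define h where "h n = inverse (real (Suc n))" for n
  have h: "0 < h n" "h n \<le> 1" for n by (auto simp: h_def field_simps)
  have h0: "h \<longlonglongrightarrow> 0" unfolding h_def by (rule LIMSEQ_inverse_real_of_nat)
  have Fm[measurable]: "F \<in> borel_measurable borel" using cont_supp_borel[OF F] .
  have Gm[measurable]: "G \<in> borel_measurable borel" using cont_supp_borel[OF G] .
  define s where "s n x = (F (x + h n *\<^sub>R e) - F x) / h n" for n x
  have "(\<lambda>n. LINT x|lborel. s n x) \<longlonglongrightarrow> (LINT x|lborel. G x \<bullet> e)"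
  proof (rule integral_dominated_convergence)
    show "integrable lborel (\<lambda>x. B * norm e * indicator (cball 0 (R + norm e)) x)"
      by (intro integrable_mult_right) (intro integrable_real_indicator emeasure_lborel_cball_finite, simp)
    show "AE x in lborel. (\<lambda>n. s n x) \<longlonglongrightarrow> G x \<bullet> e"
    proof (intro always_eventually allI)
      fix x
      have "((\<lambda>t. F (x + t *\<^sub>R e)) has_derivative (\<lambda>t. G x \<bullet> (t *\<^sub>R e))) (at 0)"
        by (rule has_derivative_compose[where g = F and f' = "\<lambda>t. t *\<^sub>R e"])
           (auto intro!: derivative_eq_intros FG)
      then have "DERIV (\<lambda>t. F (x + t *\<^sub>R e)) 0 :> G x \<bullet> e"
        by (simp add: has_field_derivative_def mult_commute_abs)
      then have "((\<lambda>t. (F (x + t *\<^sub>R e) - F x) / t) \<longlongrightarrow> G x \<bullet> e) (at 0)"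
        by (simp add: DERIV_def)
      moreover have "filterlim h (at 0) sequentially"
        using h(1) h0 by (auto simp: filterlim_at intro!: always_eventually) (metis less_irrefl)
      ultimately show "(\<lambda>n. s n x) \<longlonglongrightarrow> G x \<bullet> e"
        unfolding s_def using filterlim_compose by blast
    qed
    \<comment> \<open>The mean value inequality bounds the quotients uniformly, and the quotients
      vanish unless x or the shifted point meets the support.\<close>
    show "AE x in lborel. norm (s n x) \<le> B * norm e * indicator (cball 0 (R + norm e)) x" for n
    proof (intro always_eventually allI)
      fix x
      have "\<bar>F (x + h n *\<^sub>R e) - F x\<bar> \<le> B * (h n * norm e)"
        using lipschitz_of_gradient_bound[OF FG B(2), of "x + h n *\<^sub>R e" x] h(1)[of n] by simp
      then have 1: "norm (s n x) \<le> B * norm e"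
        unfolding s_def using h(1)[of n] by (simp add: abs_divide divide_le_eq mult_ac)
      have 2: "s n x = 0" if x: "x \<notin> cball 0 (R + norm e)"
      proof -
        have *: "norm (h n *\<^sub>R e) \<le> norm e"
          using h[of n] by (simp add: mult_left_le_one_le)
        have "R + norm e < norm x" using x by simp
        moreover have "norm x \<le> norm (x + h n *\<^sub>R e) + norm (h n *\<^sub>R e)"
          using norm_triangle_ineq4[of "x + h n *\<^sub>R e" "h n *\<^sub>R e"] by simp
        ultimately have "x \<notin> K" "x + h n *\<^sub>R e \<notin> K"
          using R[of x] R[of "x + h n *\<^sub>R e"] * norm_ge_zero[of e] by (auto simp del: norm_ge_zero)
        then show ?thesis by (simp add: s_def K(2))
      qed
      show "norm (s n x) \<le> B * norm e * indicator (cball 0 (R + norm e)) x"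
        using 1 2 by (cases "x \<in> cball 0 (R + norm e)") auto
    qed
  qed (simp_all add: s_def)
  moreover have "(LINT x|lborel. s n x) = 0" for n
  proof -
    have "integrable lborel F" by (rule cont_supp_integrable[OF F])
    moreover have "integrable lborel (\<lambda>x. F (x + h n *\<^sub>R e))"
    proof (rule cont_supp_integrable)
      show "cont_supp UNIV (\<lambda>x. F (x + h n *\<^sub>R e))"
        unfolding cont_supp_def
      proof (intro conjI exI[of _ "(\<lambda>x. - (h n *\<^sub>R e) + x) ` K"] allI impI)
        show "continuous_on UNIV (\<lambda>x. F (x + h n *\<^sub>R e))"
          using F by (auto simp: cont_supp_def intro!: continuous_on_compose2[of UNIV F] continuous_intros)
        show "compact ((+) (- (h n *\<^sub>R e)) ` K)" using K(1) by (rule compact_translation)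
        show "F (x + h n *\<^sub>R e) = 0" if "x \<notin> (+) (- (h n *\<^sub>R e)) ` K" for x
          using that by (intro K(2)) (auto simp: image_iff)
      qed auto
    qed
    ultimately show ?thesis
      unfolding s_def by (simp add: lborel_integral_translation diff_divide_distrib)
  qed
  ultimately show ?thesis by (simp add: LIMSEQ_const_iff)
qed

text \<open>The product of the two functions has compact support, so the integral of its i-th
  partial derivative is zero.\<close>

lemma integration_by_parts:
  fixes \<phi> \<psi> :: "real^'n \<Rightarrow> real"
  assumes \<phi>: "\<phi> \<in> test_functions \<Omega>" and \<psi>: "\<psi> \<in> test_functions \<Omega>"
  shows "(LINT x|lborel. \<phi> x * partial_deriv i \<psi> x) = - (LINT x|lborel. gradient \<phi> x $ i * \<psi> x)"
proof -
  note c = cont_supp_test[OF \<phi>] cont_supp_test[OF \<psi>] cont_supp_gradient[OF \<phi>] cont_supp_gradient[OF \<psi>]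
  have cc: "continuous_on UNIV \<phi>" "continuous_on UNIV \<psi>" using c by (auto simp: cont_supp_def)
  have mono: "cont_supp UNIV f" if "cont_supp \<Omega> f" for f :: "real^'n \<Rightarrow> 'c::euclidean_space"
    using that by (auto simp: cont_supp_def)
  let ?G = "\<lambda>x. \<phi> x *\<^sub>R gradient \<psi> x + \<psi> x *\<^sub>R gradient \<phi> x"
  have "(LINT x|lborel. ?G x \<bullet> axis i 1) = 0"
  proof (rule integral_derivative_zero)
    show "cont_supp UNIV (\<lambda>x. \<phi> x * \<psi> x)" by (intro mono cont_supp_mult c cc)
    have "continuous_on UNIV ?G"
      using c by (auto simp: cont_supp_def intro!: continuous_intros)
    moreover obtain K where "compact K" "\<And>x. x \<notin> K \<Longrightarrow> \<phi> x = 0" "\<And>x. x \<notin> K \<Longrightarrow> gradient \<phi> x = 0"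
      using test_support[OF \<phi>] by metis
    ultimately show "cont_supp UNIV ?G" unfolding cont_supp_def by (intro conjI exI[of _ K]) auto
    show "((\<lambda>x. \<phi> x * \<psi> x) has_derivative (\<lambda>v. ?G x \<bullet> v)) (at x)" for x
      using \<phi>[THEN test_smooth, THEN smooth_has_derivative, of x] \<psi>[THEN test_smooth, THEN smooth_has_derivative, of x]
      by (auto intro!: derivative_eq_intros simp: inner_add_left)
  qed
  moreover have "integrable lborel (\<lambda>x. \<phi> x * gradient \<psi> x $ i)" "integrable lborel (\<lambda>x. gradient \<phi> x $ i * \<psi> x)"
    using c cc by (auto intro!: cont_supp_integrable cont_supp_mult cont_supp_component continuous_intros
       simp: cont_supp_def[of _ "gradient \<psi>"])
  ultimately show ?thesis
    by (simp add: inner_axis' inner_axis inner_add_left partial_deriv_gradient mult.commute[of "\<psi> _"])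
qed

section \<open>The fundamental lemma of the calculus of variations\<close>

lemma sigma_finite_lebesgue: "sigma_finite_measure (lebesgue :: 'a::euclidean_space measure)"
proof
  obtain A :: "'a set set" where "countable A" "A \<subseteq> sets lborel" "\<Union> A = space lborel"
    "\<And>a. a \<in> A \<Longrightarrow> emeasure lborel a \<noteq> \<infinity>"
    using lborel.sigma_finite_countable by metis
  then show "\<exists>A::'a set set. countable A \<and> A \<subseteq> sets lebesgue \<and> \<Union> A = space lebesgue \<and> (\<forall>a\<in>A. emeasure lebesgue a \<noteq> \<infinity>)"
    by (intro exI[of _ A]) (auto simp: subset_iff)
qed

text \<open>Open boxes form an intersection-stable generator of the Borel sets, so the signed
  measure with density \<open>w\<close> vanishes on every Borel set, and then on every Lebesgue
  set.\<close>

lemma integral_box_zero_imp_AE_zero: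
  fixes w :: "real^'n \<Rightarrow> real"
  assumes w: "integrable lebesgue w"
    and z: "\<And>a b. (LINT x|lebesgue. indicator (box a b) x * w x) = 0" 
  shows "AE x in lebesgue. w x = 0"
proof (rule sigma_finite_measure.density_zero[OF sigma_finite_lebesgue w])
  let ?G = "range (\<lambda>(a, b). box a b :: (real^'n) set)"
  have wi: "set_integrable lebesgue A w" if "A \<in> sets lebesgue" for A
    unfolding set_integrable_def using integrable_mult_indicator[OF that w] .
  \<comment> \<open>The complement step of the induction needs the total integral; it is reached by
    exhausting the space with boxes.\<close>
  have tot: "(LINT x|lebesgue. w x) = 0"
  proof -
    have "(\<lambda>n. LINT x|lebesgue. indicator (box (\<chi> i. - real n) (\<chi> i. real n)) x * w x) \<longlonglongrightarrow> (LINT x|lebesgue. w x)"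
    proof (rule integral_dominated_convergence[where w = "\<lambda>x. norm (w x)"])
      show "AE x in lebesgue. (\<lambda>n. indicator (box (\<chi> i. - real n) (\<chi> i. real n)) x * w x) \<longlonglongrightarrow> w x"
      proof (intro always_eventually allI)
        fix x :: "real^'n"
        obtain N :: nat where N: "norm x < real N" using reals_Archimedean2 by blast
        have "indicator (box (\<chi> i. - real n) (\<chi> i. real n)) x * w x = w x" if "n \<ge> N" for n
        proof -
          have "\<bar>x $ i\<bar> < real n" for i using component_le_norm_cart[of x i] N that by linarith
          then have "x \<in> box (\<chi> i. - real n) (\<chi> i. real n)" by (simp add: mem_box_cart abs_less_iff) (metis minus_less_iff)
          then show ?thesis by simp
        qed
        then show "(\<lambda>n. indicator (box (\<chi> i. - real n) (\<chi> i. real n)) x * w x) \<longlonglongrightarrow> w x"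
          by (intro tendsto_eventually) (auto simp: eventually_sequentially)
      qed
      show "(\<lambda>x. indicator (box (\<chi> i. - real n) (\<chi> i. real n)) x * w x) \<in> borel_measurable lebesgue" for n
        using w by (intro borel_measurable_times borel_measurable_indicator borel_measurable_integrable) auto
    qed (use w in \<open>auto simp: indicator_def\<close>)
    then show ?thesis by (simp add: z LIMSEQ_const_iff)
  qed
  have borel: "set_lebesgue_integral lebesgue A w = 0" if "A \<in> sets borel" for A
  proof -
    have "Int_stable ?G" by (auto simp: Int_stable_def box_Int_box)
    moreover have "?G \<subseteq> Pow UNIV" by simp
    moreover have "A \<in> sigma_sets UNIV ?G" using that by (simp add: borel_eq_box)
    ultimately show ?thesis
    proof (induction rule: sigma_sets_induct_disjoint)
      case (basic A)
      then show ?case by (auto simp: set_lebesgue_integral_def z)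
    next
      case empty
      then show ?case by (simp add: set_lebesgue_integral_def)
    next
      case (compl A)
      then have A: "A \<in> sets lebesgue" by (simp add: borel_eq_box)
      have "set_lebesgue_integral lebesgue UNIV w = set_lebesgue_integral lebesgue A w + set_lebesgue_integral lebesgue (UNIV - A) w"
        using A by (subst set_integral_Un[symmetric]) (auto intro!: wi)
      then show ?case using tot compl by (simp add: set_lebesgue_integral_def)
    next
      case (union A)
      then have "A i \<in> sets borel" for i by (simp add: borel_eq_box image_subset_iff)
      then have A: "A i \<in> sets lebesgue" for i by simp
      then show ?case using union
        by (subst lebesgue_integral_countable_add) (auto intro!: wi simp: disjoint_family_on_def)
    qed
  qed
  \<comment> \<open>A Lebesgue set differs from a Borel set only inside a null set.\<close>
  show "set_lebesgue_integral lebesgue A w = 0" if AL: "A \<in> sets lebesgue" for A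
  proof -
    obtain S N N' where A: "A = S \<union> N" "N \<subseteq> N'" "N' \<in> null_sets lborel" "S \<in> sets lborel"
      using sets_completionE[OF AL] by metis
    have "AE x in lebesgue. x \<notin> N'" using A(3) by (intro AE_not_in) (auto simp: null_sets_completionI)
    then have ae: "AE x in lebesgue. indicator A x *\<^sub>R w x = indicator S x *\<^sub>R w x"
      by eventually_elim (use A(1,2) in \<open>auto simp: indicator_def\<close>)
    have "(\<lambda>x. indicator B x *\<^sub>R w x) \<in> borel_measurable lebesgue" if "B \<in> sets lebesgue" for B
      using w that by (intro borel_measurable_scaleR borel_measurable_indicator borel_measurable_integrable)
    then have "set_lebesgue_integral lebesgue A w = set_lebesgue_integral lebesgue S w"
      unfolding set_lebesgue_integral_def using AL A(4) ae by (intro integral_cong_AE) auto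
    then show ?thesis using borel[of S] A by simp
  qed
qed

lemma finite_measure_lebesgue_on:
  assumes "open \<Omega>" "bounded \<Omega>" shows "finite_measure (lebesgue_on \<Omega>)"
proof
  have "emeasure lebesgue \<Omega> < \<infinity>" using assms emeasure_bounded_finite[OF assms(2)] by simp
  then show "emeasure (lebesgue_on \<Omega>) (space (lebesgue_on \<Omega>)) \<noteq> \<infinity>"
    using assms by (simp add: emeasure_restrict_space)
qed

text \<open>The bumps tend pointwise to the indicator of the box and are bounded by 1, so |w|
  dominates the products.\<close>

lemma integral_bump_zero_imp_box:
  fixes w :: "real^'n \<Rightarrow> real"
  assumes "open \<Omega>" and w: "integrable (lebesgue_on \<Omega>) w" and ab: "cbox a b \<subseteq> \<Omega>"
    and z: "\<And>\<phi>. \<phi> \<in> test_functions \<Omega> \<Longrightarrow> (LINT x|lebesgue_on \<Omega>. w x * \<phi> x) = 0"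
  shows "(LINT x|lebesgue_on \<Omega>. indicator (box a b) x * w x) = 0"
proof -
  have wm: "w \<in> borel_measurable (lebesgue_on \<Omega>)" using w by simp
  have "(\<lambda>n. LINT x|lebesgue_on \<Omega>. w x * bump a b (real (Suc n)) x) \<longlonglongrightarrow> (LINT x|lebesgue_on \<Omega>. w x * indicator (box a b) x)"
  proof (rule integral_dominated_convergence[where w = "\<lambda>x. norm (w x)"])
    show "AE x in lebesgue_on \<Omega>. (\<lambda>n. w x * bump a b (real (Suc n)) x) \<longlonglongrightarrow> w x * indicator (box a b) x"
      by (intro always_eventually allI tendsto_mult_left bump_limit)
    show "AE x in lebesgue_on \<Omega>. norm (w x * bump a b (real (Suc n)) x) \<le> norm (w x)" for n
      using bump_bounds[of a b "real (Suc n)"]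
      by (intro always_eventually allI) (simp add: abs_mult mult_left_le)
    show "(\<lambda>x. w x * bump a b (real (Suc n)) x) \<in> borel_measurable (lebesgue_on \<Omega>)" for n
      by (intro borel_measurable_times[OF wm] borel_measurable_lebesgue_on borel_measurable_continuous_onI
          smooth_continuous smooth_bump)
    show "(\<lambda>x. w x * indicator (box a b) x) \<in> borel_measurable (lebesgue_on \<Omega>)"
      by (intro borel_measurable_times[OF wm] borel_measurable_lebesgue_on borel_measurable_indicator) simp
  qed (use w in auto)
  then show ?thesis
    using z[OF bump_in_test_functions[OF _ ab]] by (simp add: LIMSEQ_const_iff mult.commute)
qed

text \<open>Locally the test functions see all boxes: inside a box whose closure lies in
  \<open>\<Omega>\<close>, every intersection with another box is again such a box, and its bumps
  are admissible.\<close>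

lemma fundamental_lemma:
  fixes w :: "real^'n \<Rightarrow> real"
  assumes \<Omega>: "open \<Omega>" and w: "integrable (lebesgue_on \<Omega>) w"
    and z: "\<And>\<phi>. \<phi> \<in> test_functions \<Omega> \<Longrightarrow> (LINT x|lebesgue_on \<Omega>. w x * \<phi> x) = 0"
  shows "AE x in lebesgue_on \<Omega>. w x = 0"
proof -
  have \<Omega>l: "\<Omega> \<inter> space lebesgue \<in> sets lebesgue" using \<Omega> by simp
  define W where "W x = indicator \<Omega> x * w x" for x
  have W: "integrable lebesgue W"
    using w \<Omega>l by (simp add: W_def[abs_def] integrable_restrict_space)
  have box: "AE x in lebesgue. x \<in> box c d \<longrightarrow> w x = 0" if cd: "cbox c d \<subseteq> \<Omega>" for c d
  proof -
    have "AE x in lebesgue. indicator (box c d) x * W x = 0"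
    proof (rule integral_box_zero_imp_AE_zero)
      show "integrable lebesgue (\<lambda>x. indicator (box c d) x * W x)"
        using integrable_mult_indicator[OF _ W, of "box c d"] by simp
      show "(LINT x|lebesgue. indicator (box a b) x * (indicator (box c d) x * W x)) = 0" for a b
      proof (cases "box a b \<inter> box c d = {}")
        case True
        then have "indicator (box a b) x * (indicator (box c d) x * W x) = 0" for x
          by (auto simp: indicator_def)
        then show ?thesis by (simp only: Bochner_Integration.integral_zero)
      next
        case False
        obtain a' b' where ab': "box a b \<inter> box c d = box a' b'" by (auto simp: box_Int_box)
        with False have ne: "box a' b' \<noteq> {}" by simp
        have "closure (box a' b') \<subseteq> cbox c d"
          using ab' box_subset_cbox[of c d] by (intro closure_minimal) auto
        then have "cbox a' b' \<subseteq> \<Omega>" using closure_box[OF ne] cd by auto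
        from integral_bump_zero_imp_box[OF \<Omega> w this z]
        have "(LINT x|lebesgue. indicator \<Omega> x * (indicator (box a' b') x * w x)) = 0"
          using \<Omega>l by (simp add: integral_restrict_space)
        moreover have "indicator (box a b) x * (indicator (box c d) x * W x) = indicator \<Omega> x * (indicator (box a' b') x * w x)" for x
          unfolding ab'[symmetric] W_def by (simp add: indicator_inter_arith)
        ultimately show ?thesis by simp
      qed
    qed
    then show ?thesis
    proof eventually_elim
      case (elim x)
      have "x \<in> box c d \<Longrightarrow> x \<in> \<Omega>" using box_subset_cbox[of c d] cd by auto
      with elim show ?case by (auto simp: W_def)
    qed
  qed
  \<comment> \<open>The open boxes that cover \<open>\<Omega>\<close> may touch its boundary. Each
    is therefore covered once more by closed boxes inside it, whose faces are null sets.\<close>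
  obtain \<D> where D: "countable \<D>" "\<D> \<subseteq> Pow \<Omega>" "\<And>X. X \<in> \<D> \<Longrightarrow> \<exists>a b. X = box a b" "\<Union>\<D> = \<Omega>"
    using open_countable_Union_open_box[OF \<Omega>] by metis
  have sub: "AE x in lebesgue. x \<in> X \<longrightarrow> w x = 0" if X: "X \<in> \<D>" for X
  proof -
    obtain \<E> where E: "countable \<E>" "\<E> \<subseteq> Pow X" "\<And>Y. Y \<in> \<E> \<Longrightarrow> \<exists>a b. Y = cbox a b" "\<Union>\<E> = X"
      using open_countable_Union_open_cbox[of X] D(3)[OF X] open_box by metis
    have "AE x in lebesgue. \<forall>Y\<in>\<E>. x \<in> Y \<longrightarrow> w x = 0"
    proof (rule AE_ball_countable[THEN iffD2, OF E(1)], intro ballI)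
      fix Y assume Y: "Y \<in> \<E>"
      then obtain a b where ab: "Y = cbox a b" using E(3) by blast
      have "cbox a b - box a b \<in> null_sets lebesgue"
        using negligible_frontier_interval[of a b] by (simp add: negligible_iff_null_sets)
      then have "AE x in lebesgue. x \<notin> cbox a b - box a b" by (rule AE_not_in)
      moreover have "cbox a b \<subseteq> \<Omega>" using Y E(2) D(2) X ab by auto
      from box[OF this] have "AE x in lebesgue. x \<in> box a b \<longrightarrow> w x = 0" .
      ultimately show "AE x in lebesgue. x \<in> Y \<longrightarrow> w x = 0"
        by eventually_elim (auto simp: ab)
    qed
    then show ?thesis by eventually_elim (use E(4) in auto)
  qed
  have "AE x in lebesgue. \<forall>X\<in>\<D>. x \<in> X \<longrightarrow> w x = 0"
    by (subst AE_ball_countable[OF D(1)]) (use sub in blast)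
  then have "AE x in lebesgue. x \<in> \<Omega> \<longrightarrow> w x = 0"
    by eventually_elim (use D(4) in auto)
  then show ?thesis using \<Omega>l by (simp add: AE_restrict_space_iff)
qed

section \<open>Weak gradients and \<open>H10\<close> on a bounded open set\<close>

lemma L2_iff_sq_int: "u \<in> L2 \<Omega> \<longleftrightarrow> sq_int (lebesgue_on \<Omega>) u"
  by (simp add: L2_def sq_int_def)

locale bounded_open =
  fixes \<Omega> :: "(real^'n) set"
  assumes open_\<Omega>: "open \<Omega>" and bounded_\<Omega>: "bounded \<Omega>"
begin

abbreviation "LO \<equiv> lebesgue_on \<Omega>"

sublocale finite_measure LO
  by (rule finite_measure_lebesgue_on[OF open_\<Omega> bounded_\<Omega>])

lemma sets_\<Omega> [simp]: "\<Omega> \<in> sets lebesgue" using open_\<Omega> by simp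

lemma test_sq_int:
  assumes "\<phi> \<in> test_functions \<Omega>" shows "sq_int LO \<phi>" "sq_int LO (gradient \<phi>)"
  using assms by (auto intro!: cont_supp_sq_int cont_supp_test cont_supp_gradient)

lemma sq_int_component:
  fixes g :: "real^'n \<Rightarrow> real^'m"
  assumes "sq_int LO g" shows "sq_int LO (\<lambda>x. g x $ i)"
  unfolding sq_int_def
proof
  have [measurable]: "g \<in> borel_measurable LO" using assms by (simp add: sq_int_def)
  show m: "(\<lambda>x. g x $ i) \<in> borel_measurable LO"
    using borel_measurable_inner[of g LO "\<lambda>_. axis i 1"] by (simp add: inner_axis)
  show "integrable LO (\<lambda>x. (norm (g x $ i))\<^sup>2)"
  proof (rule Bochner_Integration.integrable_bound)
    show "integrable LO (\<lambda>x. (norm (g x))\<^sup>2)" using assms by (simp add: sq_int_def)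
    show "AE x in LO. norm ((norm (g x $ i))\<^sup>2) \<le> norm ((norm (g x))\<^sup>2)"
      using component_le_norm_cart[of "g _" i] by (intro always_eventually allI) (simp add: power_mono del: norm_le_zero_iff; metis abs_ge_zero power2_abs power_mono)
  qed (use m in simp)
qed

lemma sqn_component_le:
  fixes g :: "real^'n \<Rightarrow> real^'m"
  assumes "sq_int LO g" shows "sqn LO (\<lambda>x. g x $ i) \<le> sqn LO g"
  unfolding sqn_def
proof (rule integral_mono)
  show "(norm (g x $ i))\<^sup>2 \<le> (norm (g x))\<^sup>2" for x
    using component_le_norm_cart[of "g x" i] by (intro power_mono) auto
qed (use assms sq_int_component[OF assms, of i] in \<open>auto simp: sq_int_def\<close>)

lemma partial_cont_supp: "\<phi> \<in> test_functions \<Omega> \<Longrightarrow> cont_supp \<Omega> (partial_deriv i \<phi>)"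
  using cont_supp_component[OF cont_supp_gradient, of \<phi> \<Omega> i] by (simp add: partial_deriv_gradient[abs_def])

lemma test_weak_gradient:
  assumes "\<phi> \<in> test_functions \<Omega>" shows "has_weak_gradient \<Omega> \<phi> (gradient \<phi>)"
  unfolding has_weak_gradient_def L2_iff_sq_int
proof (intro conjI ballI allI)
  fix \<psi> i assume \<psi>: "\<psi> \<in> test_functions \<Omega>"
  note c = cont_supp_test[OF assms] cont_supp_component[OF cont_supp_gradient[OF assms], of i]
  have 1: "cont_supp \<Omega> (\<lambda>x. \<phi> x * partial_deriv i \<psi> x)" "cont_supp \<Omega> (\<lambda>x. gradient \<phi> x $ i * \<psi> x)"
    using partial_cont_supp[OF \<psi>, of i] cont_supp_test[OF \<psi>]
    by (auto intro!: cont_supp_mult c simp: cont_supp_def[of _ \<psi>] cont_supp_def[of _ "partial_deriv i \<psi>"])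
  show "(LINT x|LO. \<phi> x * partial_deriv i \<psi> x) = - (LINT x|LO. gradient \<phi> x $ i * \<psi> x)"
    using integration_by_parts[OF assms \<psi>, of i]
      integral_lebesgue_on_eq[OF sets_\<Omega> cont_supp_borel[OF 1(1)] cont_supp_outside[OF 1(1)]]
      integral_lebesgue_on_eq[OF sets_\<Omega> cont_supp_borel[OF 1(2)] cont_supp_outside[OF 1(2)]]
    by simp
qed (use test_sq_int[OF assms] in auto)

text \<open>Each component of the difference is orthogonal to all test functions. This is what makes
  the function picked by \<open>SOME\<close> in \<open>weak_gradient\<close> computable.\<close>

lemma weak_gradient_unique:
  assumes g: "has_weak_gradient \<Omega> u g" and h: "has_weak_gradient \<Omega> u h"
  shows "AE x in LO. g x = h x"
proof -
  have gh: "sq_int LO g" "sq_int LO h" using g h by (auto simp: has_weak_gradient_def L2_iff_sq_int)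
  have "AE x in LO. g x $ i - h x $ i = 0" for i
  proof (rule fundamental_lemma[OF open_\<Omega>])
    show "integrable LO (\<lambda>x. g x $ i - h x $ i)"
      by (intro Bochner_Integration.integrable_diff integrable_sq_int sq_int_component gh)
    fix \<phi> assume \<phi>: "\<phi> \<in> test_functions \<Omega>"
    have "integrable LO (\<lambda>x. g x $ i * \<phi> x)" "integrable LO (\<lambda>x. h x $ i * \<phi> x)"
      by (intro integrable_mult_real sq_int_component gh test_sq_int \<phi>)+
    then show "(LINT x|LO. (g x $ i - h x $ i) * \<phi> x) = 0"
      using g h \<phi> by (auto simp: has_weak_gradient_def left_diff_distrib)
  qed
  then have "AE x in LO. \<forall>i\<in>UNIV. g x $ i - h x $ i = 0" by (intro AE_finite_allI) auto
  then show ?thesis by eventually_elim (auto simp: vec_eq_iff)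
qed

text \<open>Both sides of the integration by parts formula are continuous under L2 convergence of
  the function and of the gradient.\<close>

lemma weak_gradient_limit:
  assumes \<phi>: "\<And>k. \<phi> k \<in> test_functions \<Omega>" and u: "sq_int LO u" and g: "sq_int LO g"
    and lu: "(\<lambda>k. sqn LO (\<lambda>x. \<phi> k x - u x)) \<longlonglongrightarrow> 0"
    and lg: "(\<lambda>k. sqn LO (\<lambda>x. gradient (\<phi> k) x - g x)) \<longlonglongrightarrow> 0"
  shows "has_weak_gradient \<Omega> u g"
  unfolding has_weak_gradient_def L2_iff_sq_int
proof (intro conjI ballI allI u g)
  fix \<psi> i assume \<psi>: "\<psi> \<in> test_functions \<Omega>"
  have 1: "(\<lambda>k. LINT x|LO. \<phi> k x * partial_deriv i \<psi> x) \<longlonglongrightarrow> (LINT x|LO. u x * partial_deriv i \<psi> x)"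
    using tendsto_inner_sqn[OF test_sq_int(1)[OF \<phi>] u lu cont_supp_sq_int[OF partial_cont_supp[OF \<psi>], of i]] by simp
  have "sqn LO (\<lambda>x. gradient (\<phi> k) x $ i - g x $ i) \<le> sqn LO (\<lambda>x. gradient (\<phi> k) x - g x)" for k
    using sqn_component_le[OF sq_int_diff[OF test_sq_int(2)[OF \<phi>[of k]] g], of i] by simp
  then have "(\<lambda>k. sqn LO (\<lambda>x. gradient (\<phi> k) x $ i - g x $ i)) \<longlonglongrightarrow> 0"
    by (intro tendsto_sandwich[OF _ _ tendsto_const lg]) (auto intro!: always_eventually)
  then have "(\<lambda>k. LINT x|LO. gradient (\<phi> k) x $ i * \<psi> x) \<longlonglongrightarrow> (LINT x|LO. g x $ i * \<psi> x)"
    using tendsto_inner_sqn[of LO "\<lambda>k x. gradient (\<phi> k) x $ i" "\<lambda>x. g x $ i" \<psi>]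
      sq_int_component[OF test_sq_int(2)[OF \<phi>]] sq_int_component[OF g] test_sq_int(1)[OF \<psi>] by simp
  moreover have "(LINT x|LO. \<phi> k x * partial_deriv i \<psi> x) = - (LINT x|LO. gradient (\<phi> k) x $ i * \<psi> x)" for k
    using test_weak_gradient[OF \<phi>] \<psi> by (auto simp: has_weak_gradient_def)
  ultimately have "(\<lambda>k. LINT x|LO. \<phi> k x * partial_deriv i \<psi> x) \<longlonglongrightarrow> - (LINT x|LO. g x $ i * \<psi> x)"
    by (simp add: tendsto_minus)
  with 1 show "(LINT x|LO. u x * partial_deriv i \<psi> x) = - (LINT x|LO. g x $ i * \<psi> x)"
    by (rule LIMSEQ_unique)
qed

lemma weak_gradient_works: "has_weak_gradient \<Omega> u g \<Longrightarrow> has_weak_gradient \<Omega> u (weak_gradient \<Omega> u)"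
  unfolding weak_gradient_def by (rule someI[where P = "has_weak_gradient \<Omega> u"])

text \<open>The definition of \<open>H10\<close> measures distances to the chosen
  \<open>weak_gradient\<close>. Here any L2 limit \<open>g\<close> of the gradients may be used
  instead, because uniqueness identifies it with the chosen one.\<close>

lemma H10I:
  assumes \<phi>: "\<And>k. \<phi> k \<in> test_functions \<Omega>" and u: "sq_int LO u" and g: "sq_int LO g"
    and lu: "(\<lambda>k. sqn LO (\<lambda>x. \<phi> k x - u x)) \<longlonglongrightarrow> 0"
    and lg: "(\<lambda>k. sqn LO (\<lambda>x. gradient (\<phi> k) x - g x)) \<longlonglongrightarrow> 0"
  shows "u \<in> H10 \<Omega>" "AE x in LO. weak_gradient \<Omega> u x = g x"
proof -
  note wg = weak_gradient_limit[OF assms]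
  note ww = weak_gradient_works[OF wg]
  show ae: "AE x in LO. weak_gradient \<Omega> u x = g x" by (rule weak_gradient_unique[OF ww wg])
  have wm: "sq_int LO (weak_gradient \<Omega> u)" using ww by (auto simp: has_weak_gradient_def L2_iff_sq_int)
  have "sqn LO (\<lambda>x. gradient (\<phi> k) x - weak_gradient \<Omega> u x) = sqn LO (\<lambda>x. gradient (\<phi> k) x - g x)" for k
  proof (rule sqn_cong_AE)
    show "AE x in LO. gradient (\<phi> k) x - weak_gradient \<Omega> u x = gradient (\<phi> k) x - g x"
      using ae by eventually_elim simp
  qed (rule sq_int_measurable[OF sq_int_diff[OF test_sq_int(2)[OF \<phi>] wm]]
      sq_int_measurable[OF sq_int_diff[OF test_sq_int(2)[OF \<phi>] g]])+
  then have "(\<lambda>k. sqn LO (\<lambda>x. \<phi> k x - u x) + sqn LO (\<lambda>x. gradient (\<phi> k) x - weak_gradient \<Omega> u x)) \<longlonglongrightarrow> 0"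
    using tendsto_add[OF lu lg] by simp
  then have "(\<lambda>k. (LINT x|LO. (\<phi> k x - u x)\<^sup>2)
        + (LINT x|LO. (norm (gradient (\<phi> k) x - weak_gradient \<Omega> u x))\<^sup>2)) \<longlonglongrightarrow> 0"
    by (simp add: sqn_def)
  moreover have "u \<in> H1 \<Omega>" using wg unfolding H1_def by blast
  ultimately show "u \<in> H10 \<Omega>"
    unfolding H10_def using \<phi> by blast
qed

lemma H10D:
  assumes "u \<in> H10 \<Omega>"
  shows "sq_int LO u" "sq_int LO (weak_gradient \<Omega> u)" "has_weak_gradient \<Omega> u (weak_gradient \<Omega> u)"
proof -
  obtain g where "has_weak_gradient \<Omega> u g" using assms unfolding H10_def H1_def by blast
  then show 1: "has_weak_gradient \<Omega> u (weak_gradient \<Omega> u)" by (rule weak_gradient_works)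
  show "sq_int LO u" "sq_int LO (weak_gradient \<Omega> u)"
    using 1 unfolding has_weak_gradient_def L2_iff_sq_int by blast+
qed

lemma H10E:
  assumes "u \<in> H10 \<Omega>"
  obtains \<phi> where "\<And>k. \<phi> k \<in> test_functions \<Omega>"
    "(\<lambda>k. sqn LO (\<lambda>x. \<phi> k x - u x)) \<longlonglongrightarrow> 0"
    "(\<lambda>k. sqn LO (\<lambda>x. gradient (\<phi> k) x - weak_gradient \<Omega> u x)) \<longlonglongrightarrow> 0"
proof -
  obtain \<phi> where \<phi>: "\<And>k. \<phi> k \<in> test_functions \<Omega>"
    and l: "(\<lambda>k. sqn LO (\<lambda>x. \<phi> k x - u x) + sqn LO (\<lambda>x. gradient (\<phi> k) x - weak_gradient \<Omega> u x)) \<longlonglongrightarrow> 0"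
    using assms unfolding H10_def sqn_def by auto
  have "(\<lambda>k. sqn LO (\<lambda>x. \<phi> k x - u x)) \<longlonglongrightarrow> 0"
    by (rule tendsto_sandwich[OF _ _ tendsto_const l]) (simp_all add: always_eventually)
  moreover have "(\<lambda>k. sqn LO (\<lambda>x. gradient (\<phi> k) x - weak_gradient \<Omega> u x)) \<longlonglongrightarrow> 0"
    by (rule tendsto_sandwich[OF _ _ tendsto_const l]) (simp_all add: always_eventually)
  ultimately show thesis by (rule that[OF \<phi>])
qed

lemma H10_lincomb:
  assumes u: "u \<in> H10 \<Omega>" and v: "v \<in> H10 \<Omega>"
  shows "(\<lambda>x. u x + t * v x) \<in> H10 \<Omega>"
    "AE x in LO. weak_gradient \<Omega> (\<lambda>x. u x + t * v x) x = weak_gradient \<Omega> u x + t *\<^sub>R weak_gradient \<Omega> v x"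
proof -
  obtain \<phi> where \<phi>: "\<And>k. \<phi> k \<in> test_functions \<Omega>"
    "(\<lambda>k. sqn LO (\<lambda>x. \<phi> k x - u x)) \<longlonglongrightarrow> 0"
    "(\<lambda>k. sqn LO (\<lambda>x. gradient (\<phi> k) x - weak_gradient \<Omega> u x)) \<longlonglongrightarrow> 0" by (rule H10E[OF u]) (rule that)
  obtain \<psi> where \<psi>: "\<And>k. \<psi> k \<in> test_functions \<Omega>"
    "(\<lambda>k. sqn LO (\<lambda>x. \<psi> k x - v x)) \<longlonglongrightarrow> 0"
    "(\<lambda>k. sqn LO (\<lambda>x. gradient (\<psi> k) x - weak_gradient \<Omega> v x)) \<longlonglongrightarrow> 0" by (rule H10E[OF v]) (rule that)
  note si = H10D(1,2)[OF u] H10D(1,2)[OF v] test_sq_int[OF \<phi>(1)] test_sq_int[OF \<psi>(1)]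
  have t: "(\<lambda>x. \<phi> k x + t * \<psi> k x) \<in> test_functions \<Omega>"
    "gradient (\<lambda>x. \<phi> k x + t * \<psi> k x) = (\<lambda>x. gradient (\<phi> k) x + t *\<^sub>R gradient (\<psi> k) x)" for k
    using test_lincomb[OF \<phi>(1)[of k] \<psi>(1)[of k], of 1 t] by auto
  have "sq_int LO (\<lambda>x. u x + t * v x)" "sq_int LO (\<lambda>x. weak_gradient \<Omega> u x + t *\<^sub>R weak_gradient \<Omega> v x)"
    using sq_int_add[OF si(1) sq_int_scaleR[OF si(3), of t]] sq_int_add[OF si(2) sq_int_scaleR[OF si(4), of t]] by auto
  moreover have "(\<lambda>k. sqn LO (\<lambda>x. (\<phi> k x + t * \<psi> k x) - (u x + t * v x))) \<longlonglongrightarrow> 0"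
    using tendsto_sqn_lincomb[OF \<phi>(2) \<psi>(2), of t] si by simp
  moreover have "(\<lambda>k. sqn LO (\<lambda>x. gradient (\<lambda>x. \<phi> k x + t * \<psi> k x) x
      - (weak_gradient \<Omega> u x + t *\<^sub>R weak_gradient \<Omega> v x))) \<longlonglongrightarrow> 0"
    unfolding t(2) by (rule tendsto_sqn_lincomb[OF \<phi>(3) \<psi>(3)]) (use si in auto)
  ultimately show "(\<lambda>x. u x + t * v x) \<in> H10 \<Omega>"
    "AE x in LO. weak_gradient \<Omega> (\<lambda>x. u x + t * v x) x = weak_gradient \<Omega> u x + t *\<^sub>R weak_gradient \<Omega> v x"
    using H10I[of "\<lambda>k x. \<phi> k x + t * \<psi> k x"] t(1) by auto
qed

end

subsection \<open>Displacement estimates\<close>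

lemma nn_integral_affine:
  fixes f :: "'a::euclidean_space \<Rightarrow> ennreal"
  assumes "f \<in> borel_measurable borel" "c \<noteq> 0"
  shows "(\<integral>\<^sup>+x. f x \<partial>lborel) = ennreal (\<bar>c\<bar> ^ DIM('a)) * (\<integral>\<^sup>+x. f (b + c *\<^sub>R x) \<partial>lborel)"
proof -
  have "(\<integral>\<^sup>+x. f x \<partial>lborel) = (\<integral>\<^sup>+x. f x \<partial>density (distr lborel borel (\<lambda>x. b + c *\<^sub>R x)) (\<lambda>_. ennreal (\<bar>c\<bar> ^ DIM('a))))"
    using lborel_affine[OF assms(2), of b] by (simp only:)
  also have "\<dots> = ennreal (\<bar>c\<bar> ^ DIM('a)) * (\<integral>\<^sup>+x. f (b + c *\<^sub>R x) \<partial>lborel)"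
    using assms(1) by (subst nn_integral_density; simp?; subst nn_integral_distr; simp add: nn_integral_cmult)
  finally show ?thesis .
qed

lemma nn_integral_affine_le:
  fixes f :: "'a::euclidean_space \<Rightarrow> ennreal"
  assumes "f \<in> borel_measurable borel" "1 \<le> c"
  shows "(\<integral>\<^sup>+x. f (b + c *\<^sub>R x) \<partial>lborel) \<le> (\<integral>\<^sup>+x. f x \<partial>lborel)"
proof -
  have "1 * (\<integral>\<^sup>+x. f (b + c *\<^sub>R x) \<partial>lborel) \<le> ennreal (\<bar>c\<bar> ^ DIM('a)) * (\<integral>\<^sup>+x. f (b + c *\<^sub>R x) \<partial>lborel)"
    using assms(2) by (intro mult_right_mono) (simp_all add: one_le_power)
  then show ?thesis using nn_integral_affine[OF assms(1), of c b] assms(2) by simp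
qed

section \<open>Square means over a set of finite measure\<close>

lemma sq_int_bounded_indicator:
  fixes g :: "'a::euclidean_space \<Rightarrow> real"
  assumes [measurable]: "g \<in> borel_measurable borel" "Q \<in> sets borel" 
    and "emeasure lborel Q < \<infinity>" "\<And>y. \<bar>g y\<bar> \<le> C"
  shows "sq_int lborel (\<lambda>y. indicator Q y * g y)"
  unfolding sq_int_def
proof
  show "integrable lborel (\<lambda>y. (norm (indicator Q y * g y))\<^sup>2)"
  proof (rule Bochner_Integration.integrable_bound)
    show "integrable lborel (\<lambda>y. C\<^sup>2 * indicator Q y)"
      using assms by (intro integrable_mult_right integrable_real_indicator) auto
    have "(g y)\<^sup>2 \<le> C\<^sup>2" for y using assms(4)[of y] abs_le_square_iff[of "g y" C] by linarith
    then show "AE y in lborel. norm ((norm (indicator Q y * g y))\<^sup>2) \<le> norm (C\<^sup>2 * indicator Q y)"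
      by (intro always_eventually) (simp add: indicator_def)
  qed measurable
qed measurable

text \<open>Cauchy-Schwarz against the indicator of \<open>Q\<close>.\<close>

lemma square_of_mean:
  fixes g :: "'a::euclidean_space \<Rightarrow> real"
  assumes g[measurable]: "g \<in> borel_measurable borel" and Q[measurable]: "Q \<in> sets borel" 
    and "emeasure lborel Q < \<infinity>" "\<And>y. \<bar>g y\<bar> \<le> C"
  shows "ennreal ((LINT y|lborel. indicator Q y * g y)\<^sup>2)
    \<le> ennreal (measure lborel Q) * (\<integral>\<^sup>+y. indicator Q y * ennreal ((g y)\<^sup>2) \<partial>lborel)"
proof -
  let ?u = "\<lambda>y. indicator Q y * g y"
  have u: "sq_int lborel ?u" by (rule sq_int_bounded_indicator[OF assms])
  have one: "sq_int lborel (\<lambda>y. indicator Q y * (1::real))"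
    by (rule sq_int_bounded_indicator[of _ _ 1]) (use assms in auto)
  have "\<bar>LINT y|lborel. ?u y \<bullet> (indicator Q y * 1)\<bar> \<le> sqrt (sqn lborel ?u) * sqrt (sqn lborel (\<lambda>y. indicator Q y * (1::real)))"
    by (rule Cauchy_Schwarz_sqn[OF u one])
  moreover have "sqn lborel (\<lambda>y. indicator Q y * (1::real)) = measure lborel Q"
  proof -
    have "sqn lborel (\<lambda>y. indicator Q y * (1::real)) = (LINT y|lborel. indicator Q y)"
      unfolding sqn_def by (intro Bochner_Integration.integral_cong) (auto simp: indicator_def)
    then show ?thesis by simp
  qed
  moreover have "(LINT y|lborel. ?u y \<bullet> (indicator Q y * 1)) = (LINT y|lborel. ?u y)"
    by (intro Bochner_Integration.integral_cong) (auto simp: indicator_def)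
  ultimately have "\<bar>LINT y|lborel. ?u y\<bar> \<le> sqrt (sqn lborel ?u * measure lborel Q)"
    by (simp add: real_sqrt_mult)
  then have "(LINT y|lborel. ?u y)\<^sup>2 \<le> sqn lborel ?u * measure lborel Q"
    using sqrt_ge_absD by blast
  then have "ennreal ((LINT y|lborel. ?u y)\<^sup>2) \<le> ennreal (measure lborel Q) * ennreal (sqn lborel ?u)"
    by (simp add: ennreal_mult'[symmetric] ennreal_leI mult.commute)
  also have "ennreal (sqn lborel ?u) = (\<integral>\<^sup>+y. ennreal ((norm (?u y))\<^sup>2) \<partial>lborel)"
    by (rule nn_integral_sqn[OF u, symmetric])
  also have "\<dots> = (\<integral>\<^sup>+y. indicator Q y * ennreal ((g y)\<^sup>2) \<partial>lborel)"
    by (intro nn_integral_cong) (auto simp: indicator_def)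
  finally show ?thesis .
qed

text \<open>The pointwise estimate integrated in x, with the order of integration exchanged. It is
  applied with \<open>Q\<close> the unit interval, for increments along segments, and with
  \<open>Q\<close> a ball, for averages.\<close>

lemma integral_square_of_mean:
  fixes g :: "'a::euclidean_space \<Rightarrow> 'c::euclidean_space \<Rightarrow> real"
  assumes g[measurable]: "(\<lambda>(x, y). g x y) \<in> borel_measurable (lborel \<Otimes>\<^sub>M lborel)"
    and Q[measurable]: "Q \<in> sets borel" and Qf: "emeasure lborel Q < \<infinity>"
    and C: "\<And>x y. \<bar>g x y\<bar> \<le> C"
    and D: "0 \<le> D" "\<And>y. y \<in> Q \<Longrightarrow> (\<integral>\<^sup>+x. ennreal ((g x y)\<^sup>2) \<partial>lborel) \<le> ennreal D"
  shows "(\<integral>\<^sup>+x. ennreal ((LINT y|lborel. indicator Q y * g x y)\<^sup>2) \<partial>lborel) \<le> ennreal ((measure lborel Q)\<^sup>2 * D)"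
proof -
  let ?v = "measure lborel Q"
  have gx: "g x \<in> borel_measurable borel" for x
    using measurable_Pair2[OF g, of x] by simp
  have "(\<integral>\<^sup>+x. ennreal ((LINT y|lborel. indicator Q y * g x y)\<^sup>2) \<partial>lborel)
      \<le> (\<integral>\<^sup>+x. ennreal ?v * (\<integral>\<^sup>+y. indicator Q y * ennreal ((g x y)\<^sup>2) \<partial>lborel) \<partial>lborel)"
    by (intro nn_integral_mono square_of_mean[OF gx Q Qf C])
  also have "\<dots> = ennreal ?v * (\<integral>\<^sup>+x. (\<integral>\<^sup>+y. indicator Q y * ennreal ((g x y)\<^sup>2) \<partial>lborel) \<partial>lborel)"
    by (rule nn_integral_cmult) measurable
  also have "(\<integral>\<^sup>+x. (\<integral>\<^sup>+y. indicator Q y * ennreal ((g x y)\<^sup>2) \<partial>lborel) \<partial>lborel)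
      = (\<integral>\<^sup>+y. (\<integral>\<^sup>+x. indicator Q y * ennreal ((g x y)\<^sup>2) \<partial>lborel) \<partial>lborel)"
    by (rule lborel_pair.Fubini'[symmetric]) measurable
  also have "\<dots> \<le> (\<integral>\<^sup>+y. ennreal D * indicator Q y \<partial>lborel)"
  proof (intro nn_integral_mono)
    fix y :: 'c
    show "(\<integral>\<^sup>+x. indicator Q y * ennreal ((g x y)\<^sup>2) \<partial>lborel) \<le> ennreal D * indicator Q y"
      using D(2)[of y] by (cases "y \<in> Q") auto
  qed
  also have "\<dots> = ennreal D * ennreal ?v"
    using Qf by (simp add: nn_integral_cmult_indicator emeasure_eq_ennreal_measure)
  finally have "(\<integral>\<^sup>+x. ennreal ((LINT y|lborel. indicator Q y * g x y)\<^sup>2) \<partial>lborel)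
      \<le> ennreal ?v * (ennreal D * ennreal ?v)" by (simp add: mult_left_mono)
  also have "\<dots> = ennreal (?v\<^sup>2 * D)"
    using D(1) by (simp add: ennreal_mult'[symmetric] power2_eq_square mult_ac)
  finally show ?thesis .
qed

lemma cont_supp_affine:
  assumes f: "cont_supp S f" and c: "c \<noteq> 0" and T: "\<And>x. b + c *\<^sub>R x \<in> S \<Longrightarrow> x \<in> T"
  shows "cont_supp T (\<lambda>x. f (b + c *\<^sub>R x))"
proof -
  obtain K where K: "compact K" "K \<subseteq> S" "\<And>x. x \<notin> K \<Longrightarrow> f x = 0" using f by (auto simp: cont_supp_def)
  let ?L = "(\<lambda>y. inverse c *\<^sub>R (y - b)) ` K"
  have inv: "inverse c *\<^sub>R ((b + c *\<^sub>R x) - b) = x" "b + c *\<^sub>R (inverse c *\<^sub>R (x - b)) = x" for x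
    using c by simp_all
  have "compact ?L" by (intro compact_continuous_image continuous_intros K)
  moreover have "?L \<subseteq> T"
  proof clarify
    fix y assume "y \<in> K"
    then have "b + c *\<^sub>R (inverse c *\<^sub>R (y - b)) \<in> S" unfolding inv(2) using K(2) by blast
    then show "inverse c *\<^sub>R (y - b) \<in> T" by (rule T)
  qed
  moreover have "f (b + c *\<^sub>R x) = 0" if "x \<notin> ?L" for x
    using that inv(1)[of x] by (intro K(3)) (metis image_eqI)
  moreover have "continuous_on UNIV (\<lambda>x. f (b + c *\<^sub>R x))"
    using f by (auto simp: cont_supp_def intro!: continuous_on_compose2[of UNIV f] continuous_intros)
  ultimately show ?thesis unfolding cont_supp_def by blast
qed

lemma gradient_borel: "smooth \<phi> \<Longrightarrow> gradient \<phi> \<in> borel_measurable borel"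
  by (intro borel_measurable_continuous_onI smooth_gradient_continuous)

text \<open>The increment is the integral of the derivative along the segment from \<open>x\<close> to
  \<open>x + (p + \<tau> *\<^sub>R x)\<close>. Translations are the case \<open>\<tau> = 0\<close>, dilations about \<open>a\<close> the case \<open>p = - \<tau> *\<^sub>R a\<close>.\<close>

lemma displacement_estimate:
  fixes \<phi> :: "real^'n \<Rightarrow> real"
  assumes \<phi>: "\<phi> \<in> test_functions \<Omega>" and \<tau>: "0 \<le> \<tau>" and M: "0 \<le> M"
    and disp: "\<And>x s. 0 \<le> s \<Longrightarrow> s \<le> 1 \<Longrightarrow> s *\<^sub>R p + (1 + s * \<tau>) *\<^sub>R x \<in> \<Omega> \<Longrightarrow> norm (p + \<tau> *\<^sub>R x) \<le> M"
  shows "sqn lborel (\<lambda>x. \<phi> (p + (1 + \<tau>) *\<^sub>R x) - \<phi> x) \<le> M\<^sup>2 * sqn lborel (gradient \<phi>)"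
proof -
  have sm: "smooth \<phi>" by (rule test_smooth[OF \<phi>])
  have [measurable]: "gradient \<phi> \<in> borel_measurable borel" by (rule gradient_borel[OF sm])
  note cg = cont_supp_gradient[OF \<phi>]
  obtain B where B: "B > 0" "\<And>x. norm (gradient \<phi> x) \<le> B" using cont_supp_bounded[OF cg] by metis
  define S where "S x s = s *\<^sub>R p + (1 + s * \<tau>) *\<^sub>R x" for x and s :: real
  define g where "g x s = indicator {0..1} s * (gradient \<phi> (S x s) \<bullet> (p + \<tau> *\<^sub>R x))" for x and s :: real
  \<comment> \<open>The displacement bound is assumed only where the segment point lies in
    \<open>\<Omega>\<close>; elsewhere the gradient is zero.\<close>
  have gb: "\<bar>g x s\<bar> \<le> norm (gradient \<phi> (S x s)) * M" for x s
  proof (cases "s \<in> {0..1} \<and> S x s \<in> \<Omega>")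
    case True
    then have "norm (p + \<tau> *\<^sub>R x) \<le> M" using disp[of s x] by (simp add: S_def)
    then have "\<bar>gradient \<phi> (S x s) \<bullet> (p + \<tau> *\<^sub>R x)\<bar> \<le> norm (gradient \<phi> (S x s)) * M"
      by (meson Cauchy_Schwarz_ineq2 mult_left_mono norm_ge_zero order_trans)
    then show ?thesis using True by (simp add: g_def)
  next
    case False
    then have "g x s = 0" using test_zero_outside(2)[OF \<phi>] by (auto simp: g_def)
    then show ?thesis using M by simp
  qed
  have ftc: "(LINT s|lborel. indicator {0..1} s * g x s) = \<phi> (p + (1 + \<tau>) *\<^sub>R x) - \<phi> x" for x
  proof -
    have "(LINT s|lborel. (gradient \<phi> (S x s) \<bullet> (p + \<tau> *\<^sub>R x)) * indicator {0..1} s) = \<phi> (S x 1) - \<phi> (S x 0)"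
    proof (rule integral_FTC_Icc_real)
      fix s :: real
      have S': "((\<lambda>s. S x s) has_derivative (\<lambda>h. h *\<^sub>R (p + \<tau> *\<^sub>R x))) (at s)"
        unfolding S_def by (auto intro!: derivative_eq_intros simp: algebra_simps)
      have "((\<lambda>s. \<phi> (S x s)) has_derivative (\<lambda>h. gradient \<phi> (S x s) \<bullet> (h *\<^sub>R (p + \<tau> *\<^sub>R x)))) (at s)"
        by (rule has_derivative_compose[OF S' smooth_has_derivative[OF sm]])
      then show "DERIV (\<lambda>s. \<phi> (S x s)) s :> gradient \<phi> (S x s) \<bullet> (p + \<tau> *\<^sub>R x)"
        by (simp add: has_field_derivative_def mult_commute_abs)
      have "continuous_on UNIV (\<lambda>s. gradient \<phi> (S x s) \<bullet> (p + \<tau> *\<^sub>R x))"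
        unfolding S_def
        by (auto intro!: continuous_on_compose2[OF smooth_gradient_continuous[OF sm]] continuous_intros)
      then show "isCont (\<lambda>s. gradient \<phi> (S x s) \<bullet> (p + \<tau> *\<^sub>R x)) s"
        by (simp add: continuous_on_eq_continuous_at)
    qed simp
    moreover
    have "indicator {0..1} s * g x s = (gradient \<phi> (S x s) \<bullet> (p + \<tau> *\<^sub>R x)) * indicator {0..1} s" for s
      by (simp add: g_def indicator_def)
    then have "(LINT s|lborel. indicator {0..1} s * g x s) = (LINT s|lborel. (gradient \<phi> (S x s) \<bullet> (p + \<tau> *\<^sub>R x)) * indicator {0..1} s)"
      by (simp only:)
    ultimately show ?thesis by (simp add: S_def)
  qed
  have sub: "(\<integral>\<^sup>+x. ennreal ((g x s)\<^sup>2) \<partial>lborel) \<le> ennreal (M\<^sup>2 * sqn lborel (gradient \<phi>))" if s: "s \<in> {0..1}" for s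
  proof -
    have "(\<integral>\<^sup>+x. ennreal ((g x s)\<^sup>2) \<partial>lborel) \<le> (\<integral>\<^sup>+x. ennreal (M\<^sup>2) * ennreal ((norm (gradient \<phi> (S x s)))\<^sup>2) \<partial>lborel)"
    proof (rule nn_integral_mono)
      fix x
      have "(g x s)\<^sup>2 \<le> (norm (gradient \<phi> (S x s)) * M)\<^sup>2" using gb[of x s] by (simp add: abs_le_square_iff[symmetric] M)
      then show "ennreal ((g x s)\<^sup>2) \<le> ennreal (M\<^sup>2) * ennreal ((norm (gradient \<phi> (S x s)))\<^sup>2)"
        by (simp add: ennreal_mult'[symmetric] power_mult_distrib mult.commute ennreal_leI)
    qed
    also have "\<dots> = ennreal (M\<^sup>2) * (\<integral>\<^sup>+x. ennreal ((norm (gradient \<phi> (S x s)))\<^sup>2) \<partial>lborel)"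
      unfolding S_def by (rule nn_integral_cmult) measurable
    \<comment> \<open>For fixed s the map x -> \<open>S x s\<close> is affine with factor 1 + s
      \<tau> >= 1.\<close>
    also have "\<dots> \<le> ennreal (M\<^sup>2) * (\<integral>\<^sup>+x. ennreal ((norm (gradient \<phi> x))\<^sup>2) \<partial>lborel)"
      unfolding S_def using s \<tau> by (intro mult_left_mono nn_integral_affine_le) auto
    also have "\<dots> = ennreal (M\<^sup>2 * sqn lborel (gradient \<phi>))"
      by (simp add: nn_integral_sqn[OF cont_supp_sq_int_lborel[OF cg]] ennreal_mult'[symmetric])
    finally show ?thesis .
  qed
  have "(\<integral>\<^sup>+x. ennreal ((LINT s|lborel. indicator {0..1} s * g x s)\<^sup>2) \<partial>lborel)
      \<le> ennreal ((measure lborel {0..1::real})\<^sup>2 * (M\<^sup>2 * sqn lborel (gradient \<phi>)))"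
  proof (rule integral_square_of_mean)
    show "(\<lambda>(x, y). g x y) \<in> borel_measurable (lborel \<Otimes>\<^sub>M lborel)"
      unfolding g_def S_def by measurable
    \<comment> \<open>This crude pointwise bound serves integrability only; the final constant comes
      from \<open>sub\<close>.\<close>
    show "\<bar>g x s\<bar> \<le> B * M" for x s
      using gb[of x s] mult_right_mono[OF B(2)[of "S x s"] M] by linarith
  qed (use sub in auto)
  then have *: "(\<integral>\<^sup>+x. ennreal ((norm (\<phi> (p + (1 + \<tau>) *\<^sub>R x) - \<phi> x))\<^sup>2) \<partial>lborel) \<le> ennreal (M\<^sup>2 * sqn lborel (gradient \<phi>))"
    by (simp add: ftc)
  have "cont_supp UNIV (\<lambda>x. \<phi> (p + (1 + \<tau>) *\<^sub>R x))"
    by (rule cont_supp_affine[OF cont_supp_test[OF \<phi>]]) (use \<tau> in auto)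
  then have "sq_int lborel (\<lambda>x. \<phi> (p + (1 + \<tau>) *\<^sub>R x) - \<phi> x)"
    using cont_supp_sq_int_lborel cont_supp_sq_int_lborel[OF cont_supp_test[OF \<phi>]] by (intro sq_int_diff) auto
  from *[unfolded nn_integral_sqn[OF this]] show ?thesis by simp
qed

lemma translation_estimate:
  fixes \<phi> :: "real^'n \<Rightarrow> real"
  assumes "\<phi> \<in> test_functions \<Omega>"
  shows "sqn lborel (\<lambda>x. \<phi> (z + x) - \<phi> x) \<le> (norm z)\<^sup>2 * sqn lborel (gradient \<phi>)"
  using displacement_estimate[OF assms, of 0 "norm z" z] by simp

subsection \<open>The Poincare inequality and Rellich compactness\<close>

definition ball_mean :: "real \<Rightarrow> (real^'n \<Rightarrow> real) \<Rightarrow> real^'n \<Rightarrow> real" where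
  "ball_mean h \<phi> x = (LINT y|lborel. indicator (ball 0 h) y * \<phi> (x + y)) / measure lborel (ball (0::real^'n) h)"

lemma measure_ball_pos: "h > 0 \<Longrightarrow> 0 < measure lborel (ball (0::'a::euclidean_space) h)"
  using content_ball_pos[of h "0::'a"] by simp

lemma square_le_of_ennreal:
  assumes "ennreal (a\<^sup>2) \<le> ennreal b" "0 \<le> b" shows "a\<^sup>2 \<le> b"
  using assms by simp

context
  fixes \<Omega> :: "(real^'n) set" and \<phi> :: "real^'n \<Rightarrow> real" and h :: real
  assumes \<phi>: "\<phi> \<in> test_functions \<Omega>" and h: "h > 0"
begin

private abbreviation "B \<equiv> ball (0::real^'n) h"
private lemma vpos: "0 < measure lborel B" by (rule measure_ball_pos[OF h])

private lemma Bf: "emeasure lborel B < \<infinity>" by (rule emeasure_lborel_ball_finite)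

private lemma \<phi>m [measurable]: "\<phi> \<in> borel_measurable borel"
  by (rule cont_supp_borel[OF cont_supp_test[OF \<phi>]])

private lemma Bm [measurable]: "B \<in> sets borel" by simp

private lemma integrable_ball: "integrable lborel (\<lambda>y. indicator B y * \<phi> (x + y))"
proof -
  obtain C where C: "\<And>x. norm (\<phi> x) \<le> C" using cont_supp_bounded[OF cont_supp_test[OF \<phi>]] by metis
  show ?thesis
  proof (rule Bochner_Integration.integrable_bound)
    show "integrable lborel (\<lambda>y. C * indicator B y)"
      by (intro integrable_mult_right integrable_real_indicator Bf) simp
    show "AE y in lborel. norm (indicator B y * \<phi> (x + y)) \<le> norm (C * indicator B y)"
      using C by (intro always_eventually) (auto simp: indicator_def intro: order_trans[OF _ abs_ge_self])
  qed measurable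
qed

private lemma mean_diff:
  "(LINT y|lborel. indicator B y * (\<phi> (x + y) - \<phi> (x' + y))) = measure lborel B * (ball_mean h \<phi> x - ball_mean h \<phi> x')"
  using vpos integrable_ball[of x] integrable_ball[of x']
  by (simp add: ball_mean_def right_diff_distrib)

private lemma mean_diff_const:
  "(LINT y|lborel. indicator B y * (\<phi> (x + y) - c)) = measure lborel B * (ball_mean h \<phi> x - c)"
proof -
  have "integrable lborel (\<lambda>y. indicator B y * c)"
    by (intro integrable_mult_left integrable_real_indicator Bf) simp
  then show ?thesis
    using vpos integrable_ball[of x] by (simp add: ball_mean_def right_diff_distrib)
qed

lemma ball_mean_borel: "ball_mean h \<phi> \<in> borel_measurable borel"
proof -
  have [measurable]: "(\<lambda>(x, y). indicator B y * \<phi> (x + y)) \<in> borel_measurable (lborel \<Otimes>\<^sub>M lborel)"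
    by measurable
  have "(\<lambda>x. LINT y|lborel. indicator B y * \<phi> (x + y)) \<in> borel_measurable lborel"
    by measurable
  then show ?thesis unfolding ball_mean_def by simp
qed

text \<open>The error is the mean of the increments from x to x + y over |y| < h, and each such
  translation changes the function by at most h times its gradient in L2.\<close>

lemma ball_mean_close:
  "(\<integral>\<^sup>+x. ennreal ((ball_mean h \<phi> x - \<phi> x)\<^sup>2) \<partial>lborel) \<le> ennreal (h\<^sup>2 * sqn lborel (gradient \<phi>))"
proof -
  obtain C where C: "\<And>x. norm (\<phi> x) \<le> C" using cont_supp_bounded[OF cont_supp_test[OF \<phi>]] by metis
  let ?D = "h\<^sup>2 * sqn lborel (gradient \<phi>)"
  have "(\<integral>\<^sup>+x. ennreal ((LINT y|lborel. indicator B y * (\<phi> (x + y) - \<phi> x))\<^sup>2) \<partial>lborel) \<le> ennreal ((measure lborel B)\<^sup>2 * ?D)"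
  proof (rule integral_square_of_mean)
    show "(\<lambda>(x, y). \<phi> (x + y) - \<phi> x) \<in> borel_measurable (lborel \<Otimes>\<^sub>M lborel)" by measurable
    show "\<bar>\<phi> (x + y) - \<phi> x\<bar> \<le> 2 * C" for x y
      using C[of "x + y"] C[of x] by (simp add: abs_le_iff)
    show "(\<integral>\<^sup>+x. ennreal ((\<phi> (x + y) - \<phi> x)\<^sup>2) \<partial>lborel) \<le> ennreal ?D" if y: "y \<in> B" for y
    proof -
      have "cont_supp UNIV (\<lambda>x. \<phi> (y + 1 *\<^sub>R x))"
        by (rule cont_supp_affine[OF cont_supp_test[OF \<phi>]]) auto
      then have "sq_int lborel (\<lambda>x. \<phi> (y + x) - \<phi> x)"
        using cont_supp_sq_int_lborel[OF cont_supp_test[OF \<phi>]] cont_supp_sq_int_lborel by (intro sq_int_diff) auto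
      from nn_integral_sqn[OF this]
      have "(\<integral>\<^sup>+x. ennreal ((\<phi> (x + y) - \<phi> x)\<^sup>2) \<partial>lborel) = ennreal (sqn lborel (\<lambda>x. \<phi> (y + x) - \<phi> x))"
        by (simp add: add.commute)
      also have "\<dots> \<le> ennreal ?D"
      proof (rule ennreal_leI)
        have "(norm y)\<^sup>2 \<le> h\<^sup>2" using y by (intro power_mono) auto
        then show "sqn lborel (\<lambda>x. \<phi> (y + x) - \<phi> x) \<le> ?D"
          using translation_estimate[OF \<phi>, of y] by (meson mult_right_mono order_trans sqn_nonneg)
      qed
      finally show ?thesis .
    qed
  qed (auto simp: Bf[simplified])
  then have *: "(\<integral>\<^sup>+x. ennreal ((measure lborel B * (ball_mean h \<phi> x - \<phi> x))\<^sup>2) \<partial>lborel) \<le> ennreal ((measure lborel B)\<^sup>2 * ?D)"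
    by (simp only: mean_diff_const)
  have bm: "ball_mean h \<phi> \<in> borel_measurable lborel" using ball_mean_borel by simp
  have "(\<integral>\<^sup>+x. ennreal ((ball_mean h \<phi> x - \<phi> x)\<^sup>2) \<partial>lborel)
      = (\<integral>\<^sup>+x. ennreal (1 / (measure lborel B)\<^sup>2) * ennreal ((measure lborel B * (ball_mean h \<phi> x - \<phi> x))\<^sup>2) \<partial>lborel)"
    using vpos by (intro nn_integral_cong) (simp add: ennreal_mult'[symmetric] power_mult_distrib)
  also have "\<dots> = ennreal (1 / (measure lborel B)\<^sup>2) * (\<integral>\<^sup>+x. ennreal ((measure lborel B * (ball_mean h \<phi> x - \<phi> x))\<^sup>2) \<partial>lborel)"
    using bm by (intro nn_integral_cmult) simp
  also have "\<dots> \<le> ennreal (1 / (measure lborel B)\<^sup>2) * ennreal ((measure lborel B)\<^sup>2 * ?D)" by (intro mult_left_mono *) simp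
  also have "\<dots> = ennreal ?D" using vpos by (simp add: ennreal_mult'[symmetric])
  finally show ?thesis .
qed

text \<open>The difference of two means is the mean of the increments under the translation by x -
  x'. The constant grows as the ball shrinks, so h stays fixed when Arzela-Ascoli is
  applied.\<close>

lemma ball_mean_lipschitz:
  "(ball_mean h \<phi> x - ball_mean h \<phi> x')\<^sup>2 \<le> (norm (x - x'))\<^sup>2 * sqn lborel (gradient \<phi>) / measure lborel B"
proof -
  obtain C where C: "\<And>x. norm (\<phi> x) \<le> C" using cont_supp_bounded[OF cont_supp_test[OF \<phi>]] by metis
  let ?D = "(norm (x - x'))\<^sup>2 * sqn lborel (gradient \<phi>)"
  let ?f = "\<lambda>w. ennreal ((\<phi> ((x - x') + w) - \<phi> w)\<^sup>2)"
  have "ennreal ((LINT y|lborel. indicator B y * (\<phi> (x + y) - \<phi> (x' + y)))\<^sup>2)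
      \<le> ennreal (measure lborel B) * (\<integral>\<^sup>+y. indicator B y * ennreal ((\<phi> (x + y) - \<phi> (x' + y))\<^sup>2) \<partial>lborel)"
  proof (rule square_of_mean)
    show "\<bar>\<phi> (x + y) - \<phi> (x' + y)\<bar> \<le> 2 * C" for y
      using C[of "x + y"] C[of "x' + y"] by (simp add: abs_le_iff)
  qed (auto simp: Bf[simplified])
  also have "\<dots> \<le> ennreal (measure lborel B) * (\<integral>\<^sup>+y. ?f (x' + 1 *\<^sub>R y) \<partial>lborel)"
    by (intro mult_left_mono nn_integral_mono) (auto simp: indicator_def algebra_simps)
  also have "\<dots> \<le> ennreal (measure lborel B) * (\<integral>\<^sup>+w. ?f w \<partial>lborel)"
    by (intro mult_left_mono nn_integral_affine_le) auto
  also have "(\<integral>\<^sup>+w. ?f w \<partial>lborel) = ennreal (sqn lborel (\<lambda>w. \<phi> ((x - x') + w) - \<phi> w))"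
  proof -
    have "cont_supp UNIV (\<lambda>w. \<phi> ((x - x') + 1 *\<^sub>R w))"
      by (rule cont_supp_affine[OF cont_supp_test[OF \<phi>]]) auto
    then have "sq_int lborel (\<lambda>w. \<phi> ((x - x') + w) - \<phi> w)"
      using cont_supp_sq_int_lborel[OF cont_supp_test[OF \<phi>]] cont_supp_sq_int_lborel by (intro sq_int_diff) auto
    from nn_integral_sqn[OF this] show ?thesis by simp
  qed
  also have "ennreal (measure lborel B) * \<dots> \<le> ennreal (measure lborel B) * ennreal ?D"
    by (intro mult_left_mono ennreal_leI translation_estimate[OF \<phi>]) simp
  also have "\<dots> = ennreal (measure lborel B * ?D)" by (simp add: ennreal_mult'[symmetric])
  finally have "(measure lborel B * (ball_mean h \<phi> x - ball_mean h \<phi> x'))\<^sup>2 \<le> measure lborel B * ?D"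
    unfolding mean_diff by (rule square_le_of_ennreal) simp
  then have "measure lborel B * (measure lborel B * (ball_mean h \<phi> x - ball_mean h \<phi> x')\<^sup>2) \<le> measure lborel B * ?D"
    by (simp add: power_mult_distrib power2_eq_square mult_ac)
  then have "measure lborel B * (ball_mean h \<phi> x - ball_mean h \<phi> x')\<^sup>2 \<le> ?D"
    using vpos mult_left_le_imp_le by blast
  then show ?thesis using vpos by (simp add: pos_le_divide_eq mult.commute)
qed

text \<open>Provides the uniform bound for Arzela-Ascoli.\<close>

lemma ball_mean_bound: "(ball_mean h \<phi> x)\<^sup>2 \<le> sqn lborel \<phi> / measure lborel B"
proof -
  obtain C where C: "\<And>x. norm (\<phi> x) \<le> C" using cont_supp_bounded[OF cont_supp_test[OF \<phi>]] by metis
  have "ennreal ((LINT y|lborel. indicator B y * \<phi> (x + y))\<^sup>2)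
      \<le> ennreal (measure lborel B) * (\<integral>\<^sup>+y. indicator B y * ennreal ((\<phi> (x + y))\<^sup>2) \<partial>lborel)"
    by (rule square_of_mean[where C = C]) (use C in \<open>auto simp: Bf[simplified]\<close>)
  also have "\<dots> \<le> ennreal (measure lborel B) * (\<integral>\<^sup>+y. ennreal ((\<phi> (x + 1 *\<^sub>R y))\<^sup>2) \<partial>lborel)"
    by (intro mult_left_mono nn_integral_mono) (auto simp: indicator_def)
  also have "\<dots> \<le> ennreal (measure lborel B) * (\<integral>\<^sup>+w. ennreal ((\<phi> w)\<^sup>2) \<partial>lborel)"
    by (intro mult_left_mono nn_integral_affine_le) auto
  also have "(\<integral>\<^sup>+w. ennreal ((\<phi> w)\<^sup>2) \<partial>lborel) = ennreal (sqn lborel \<phi>)"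
    using nn_integral_sqn[OF cont_supp_sq_int_lborel[OF cont_supp_test[OF \<phi>]]] by simp
  also have "ennreal (measure lborel B) * \<dots> = ennreal (measure lborel B * sqn lborel \<phi>)" by (simp add: ennreal_mult'[symmetric])
  finally have "(measure lborel B * ball_mean h \<phi> x)\<^sup>2 \<le> measure lborel B * sqn lborel \<phi>"
    using vpos by (simp add: ball_mean_def)
  then have "measure lborel B * (measure lborel B * (ball_mean h \<phi> x)\<^sup>2) \<le> measure lborel B * sqn lborel \<phi>"
    by (simp add: power_mult_distrib power2_eq_square mult_ac)
  then have "measure lborel B * (ball_mean h \<phi> x)\<^sup>2 \<le> sqn lborel \<phi>"
    using vpos mult_left_le_imp_le by blast
  then show ?thesis using vpos by (simp add: pos_le_divide_eq mult.commute)
qed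

end

section \<open>Poincare inequality and compactness for test functions on a bounded open set\<close>

context bounded_open
begin

lemma sqn_test: "\<phi> \<in> test_functions \<Omega> \<Longrightarrow> sqn LO \<phi> = sqn lborel \<phi>"
  "\<phi> \<in> test_functions \<Omega> \<Longrightarrow> sqn LO (gradient \<phi>) = sqn lborel (gradient \<phi>)"
  by (auto intro!: cont_supp_sqn cont_supp_test cont_supp_gradient)

lemma sq_int_bounded:
  fixes u :: "real^'n \<Rightarrow> real"
  assumes "u \<in> borel_measurable LO" "\<And>x. x \<in> \<Omega> \<Longrightarrow> \<bar>u x\<bar> \<le> C"
  shows "sq_int LO u" "sqn LO u \<le> C\<^sup>2 * measure LO (space LO)"
proof -
  have le: "(u x)\<^sup>2 \<le> C\<^sup>2" if "x \<in> space LO" for x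
    using assms(2)[of x] that by (simp add: abs_le_square_iff[symmetric])
  have "integrable LO (\<lambda>x. C\<^sup>2)" by simp
  then have i: "integrable LO (\<lambda>x. (u x)\<^sup>2)"
    by (rule Bochner_Integration.integrable_bound) (use assms(1) le in \<open>auto intro: AE_I2\<close>)
  then show "sq_int LO u" using assms(1) by (simp add: sq_int_def)
  have "(LINT x|LO. (u x)\<^sup>2) \<le> (LINT x|LO. C\<^sup>2)" by (rule integral_mono) (use i le in auto)
  then show "sqn LO u \<le> C\<^sup>2 * measure LO (space LO)" by (simp add: sqn_def mult.commute)
qed

text \<open>A translation by more than the diameter of \<open>\<Omega>\<close> makes the supports disjoint.\<close>

lemma poincare:
  obtains C where "C > 0" "\<And>\<phi>. \<phi> \<in> test_functions \<Omega> \<Longrightarrow> sqn LO \<phi> \<le> C * sqn LO (gradient \<phi>)"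
proof -
  obtain R where R: "R > 0" "\<And>x. x \<in> \<Omega> \<Longrightarrow> norm x \<le> R" using bounded_\<Omega> bounded_pos by metis
  \<comment> \<open>Points of \<open>\<Omega>\<close> are at most 2 R apart, so a shift of length 3
    R separates the supports.\<close>
  obtain z :: "real^'n" where z: "norm z = 3 * R" using R(1) vector_choose_size[of "3 * R"] by auto
  have "sqn LO \<phi> \<le> (3 * R)\<^sup>2 * sqn LO (gradient \<phi>)" if \<phi>: "\<phi> \<in> test_functions \<Omega>" for \<phi>
  proof -
    note si = cont_supp_sq_int_lborel[OF cont_supp_test[OF \<phi>]]
    have "cont_supp UNIV (\<lambda>x. \<phi> (z + 1 *\<^sub>R x))"
      by (rule cont_supp_affine[OF cont_supp_test[OF \<phi>]]) auto
    then have st: "sq_int lborel (\<lambda>x. \<phi> (z + x))" using cont_supp_sq_int_lborel by auto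
    have z0: "\<phi> (z + x) * \<phi> x = 0" for x
    proof (cases "x \<in> \<Omega> \<and> z + x \<in> \<Omega>")
      case True
      have "norm z \<le> norm (z + x) + norm x" using norm_triangle_ineq4[of "z + x" x] by simp
      then have False using R(2)[of x] R(2)[of "z + x"] True R(1) z by linarith
      then show ?thesis ..
    next
      case False
      then show ?thesis using test_zero_outside(1)[OF \<phi>] by auto
    qed
    have "(LINT x|lborel. \<phi> (z + x) \<bullet> \<phi> x) = 0"
      by (simp only: inner_real_def z0 Bochner_Integration.integral_zero)
    \<comment> \<open>With the cross term gone, the norm of the increment dominates the norm of the
      function itself.\<close>
    then have "sqn lborel (\<lambda>x. \<phi> (z + x) - \<phi> x) = sqn lborel (\<lambda>x. \<phi> (z + x)) + sqn lborel \<phi>"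
      by (subst sqn_diff[OF st si]) simp
    then have "sqn lborel \<phi> \<le> sqn lborel (\<lambda>x. \<phi> (z + x) - \<phi> x)" by simp
    then show ?thesis using translation_estimate[OF \<phi>, of z] z by (simp add: sqn_test \<phi>)
  qed
  moreover have "0 < (3 * R)\<^sup>2" using R(1) by simp
  ultimately show thesis by (rule that[rotated])
qed

text \<open>For a fixed tolerance one averaging radius suffices: the averages are close to the
  functions in L2, and a subsequence of them converges uniformly. Shrinking the tolerance would
  change the radius, so this gives a Cauchy condition only up to e.\<close>

lemma rellich_step:
  assumes \<phi>: "\<And>k::nat. \<phi> k \<in> test_functions \<Omega>" and K: "\<And>k. sqn LO (gradient (\<phi> k)) \<le> K" and e: "e > 0"
  shows "\<exists>r::nat \<Rightarrow> nat. strict_mono r \<and>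
    (\<exists>N. \<forall>j\<ge>N. \<forall>k\<ge>N. sqn LO (\<lambda>x. \<phi> (r j) x - \<phi> (r k) x) < e)"
proof -
  obtain C where C: "C > 0" "\<And>\<phi>. \<phi> \<in> test_functions \<Omega> \<Longrightarrow> sqn LO \<phi> \<le> C * sqn LO (gradient \<phi>)"
    using poincare by metis
  have K0: "0 \<le> K" using K[of 0] sqn_nonneg order_trans by blast
  define m where "m = measure LO (space LO)"
  have m0: "0 \<le> m" by (simp add: m_def)
  \<comment> \<open>Two averaging errors and one distance between averages, each at most d, add up
    to 3 d < sqrt e.\<close>
  define d where "d = sqrt e / 4"
  have d: "d > 0" using e by (simp add: d_def)
  \<comment> \<open>The averaging error is at most h sqrt K. The added 1 avoids a division by zero
    when K = 0.\<close>
  define h where "h = d / (sqrt K + 1)"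
  have h: "h > 0" using d K0 by (simp add: h_def add_nonneg_pos)
  have hK: "h * sqrt K \<le> d"
  proof -
    have "h * sqrt K \<le> h * (sqrt K + 1)" using h by (intro mult_left_mono) auto
    also have "\<dots> = d" using K0 by (simp add: h_def add_nonneg_eq_0_iff)
    finally show ?thesis .
  qed
  define v where "v = measure lborel (ball (0::real^'n) h)"
  have v: "v > 0" unfolding v_def by (rule measure_ball_pos[OF h])
  let ?A = "\<lambda>n. ball_mean h (\<phi> n)"
  have Ab: "norm (?A n x) \<le> sqrt (C * K / v)" for n x
  proof -
    have "(?A n x)\<^sup>2 \<le> sqn lborel (\<phi> n) / v" unfolding v_def by (rule ball_mean_bound[OF \<phi> h])
    also have "\<dots> \<le> C * K / v"
    proof (rule divide_right_mono)
      have "sqn lborel (\<phi> n) \<le> C * sqn LO (gradient (\<phi> n))" using C(2)[OF \<phi>[of n]] by (simp add: sqn_test \<phi>)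
      also have "\<dots> \<le> C * K" using C(1) K by (intro mult_left_mono) auto
      finally show "sqn lborel (\<phi> n) \<le> C * K" .
    qed (use v in simp)
    finally show ?thesis by (simp add: real_le_rsqrt)
  qed
  have Al: "norm (?A n x - ?A n y) \<le> norm (x - y) * sqrt (K / v)" for n x y
  proof -
    have "(?A n x - ?A n y)\<^sup>2 \<le> (norm (x - y))\<^sup>2 * sqn lborel (gradient (\<phi> n)) / v"
      unfolding v_def by (rule ball_mean_lipschitz[OF \<phi> h])
    also have "\<dots> \<le> (norm (x - y))\<^sup>2 * K / v"
      using K[of n] v by (intro divide_right_mono mult_left_mono) (auto simp: sqn_test \<phi>)
    also have "\<dots> = (norm (x - y) * sqrt (K / v))\<^sup>2" using K0 v by (simp add: power_mult_distrib)
    finally have "\<bar>?A n x - ?A n y\<bar> \<le> \<bar>norm (x - y) * sqrt (K / v)\<bar>" by (simp only: abs_le_square_iff)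
    then show ?thesis using K0 v by simp
  qed
  have comp: "compact (closure \<Omega>)" using bounded_\<Omega> by (simp add: compact_closure)
  obtain g and r :: "nat \<Rightarrow> nat" where r: "strict_mono r"
    and ug: "\<And>e. 0 < e \<Longrightarrow> \<exists>N. \<forall>n x. n \<ge> N \<and> x \<in> closure \<Omega> \<longrightarrow> norm (?A (r n) x - g x) < e"
  proof (rule Arzela_Ascoli[OF comp, of ?A "sqrt (C * K / v)"])
    show "\<exists>d>0. \<forall>n y. y \<in> closure \<Omega> \<and> norm (x - y) < d \<longrightarrow> norm (?A n x - ?A n y) < e" if "0 < e" for x e
    proof (intro exI[of _ "e / (sqrt (K / v) + 1)"] conjI allI impI)
      have s: "0 < sqrt (K / v) + 1" using K0 v by (simp add: add_nonneg_pos)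
      then show "0 < e / (sqrt (K / v) + 1)" using that by simp
      fix n y assume "y \<in> closure \<Omega> \<and> norm (x - y) < e / (sqrt (K / v) + 1)"
      then have "norm (x - y) * (sqrt (K / v) + 1) < e" using s by (simp add: pos_less_divide_eq)
      moreover have "norm (x - y) * sqrt (K / v) \<le> norm (x - y) * (sqrt (K / v) + 1)"
        by (intro mult_left_mono) auto
      ultimately show "norm (?A n x - ?A n y) < e" using Al[of n x y] by linarith
    qed
  qed (use Ab in auto)
  \<comment> \<open>A uniform distance \<eta> on a set of measure m costs at most \<eta> sqrt m in
    L2. Half of \<eta> is spent on each of the two distances to the uniform limit.\<close>
  define \<eta> where "\<eta> = d / (sqrt m + 1)"
  have \<eta>: "\<eta> > 0" using d m0 by (simp add: \<eta>_def add_nonneg_pos)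
  have \<eta>m: "\<eta> * sqrt m \<le> d"
  proof -
    have "\<eta> * sqrt m \<le> \<eta> * (sqrt m + 1)" using \<eta> by (intro mult_left_mono) auto
    also have "\<dots> = d" using m0 by (simp add: \<eta>_def add_nonneg_eq_0_iff)
    finally show ?thesis .
  qed
  obtain N where N: "\<And>n x. n \<ge> N \<Longrightarrow> x \<in> closure \<Omega> \<Longrightarrow> norm (?A (r n) x - g x) < \<eta> / 2"
    using ug[of "\<eta> / 2"] \<eta> by auto
  have Am: "?A n \<in> borel_measurable LO" for n
    by (intro borel_measurable_lebesgue_on ball_mean_borel[OF \<phi> h])
  have As: "sq_int LO (?A n)" for n by (rule sq_int_bounded[OF Am]) (use Ab in simp)
  have Ac: "sqrt (sqn LO (\<lambda>x. ?A n x - \<phi> n x)) \<le> d" for n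
  proof -
    have s: "sq_int LO (\<lambda>x. ?A n x - \<phi> n x)" by (intro sq_int_diff As test_sq_int \<phi>)
    have "ennreal (sqn LO (\<lambda>x. ?A n x - \<phi> n x)) = (\<integral>\<^sup>+x. ennreal ((?A n x - \<phi> n x)\<^sup>2) \<partial>LO)"
      using nn_integral_sqn[OF s] by simp
    also have "\<dots> = (\<integral>\<^sup>+x. ennreal ((?A n x - \<phi> n x)\<^sup>2) * indicator \<Omega> x \<partial>lebesgue)"
      by (rule nn_integral_restrict_space) simp
    also have "\<dots> \<le> (\<integral>\<^sup>+x. ennreal ((?A n x - \<phi> n x)\<^sup>2) \<partial>lebesgue)"
      by (intro nn_integral_mono) (auto simp: indicator_def)
    also have "\<dots> = (\<integral>\<^sup>+x. ennreal ((?A n x - \<phi> n x)\<^sup>2) \<partial>lborel)"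
      by (rule nn_integral_completion)
    also have "\<dots> \<le> ennreal (h\<^sup>2 * sqn lborel (gradient (\<phi> n)))" by (rule ball_mean_close[OF \<phi> h])
    finally have "sqn LO (\<lambda>x. ?A n x - \<phi> n x) \<le> h\<^sup>2 * sqn LO (gradient (\<phi> n))"
      by (simp add: sqn_test \<phi>)
    also have "\<dots> \<le> h\<^sup>2 * K" by (intro mult_left_mono K) simp
    finally have "sqrt (sqn LO (\<lambda>x. ?A n x - \<phi> n x)) \<le> sqrt (h\<^sup>2 * K)" by (rule real_sqrt_le_mono)
    also have "\<dots> = h * sqrt K" using h by (simp add: real_sqrt_mult)
    finally show ?thesis using hK by linarith
  qed
  have "sqn LO (\<lambda>x. \<phi> (r j) x - \<phi> (r k) x) < e" if jk: "j \<ge> N" "k \<ge> N" for j k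
  proof -
    have "sqrt (sqn LO (\<lambda>x. ?A (r j) x - ?A (r k) x)) \<le> d"
    proof -
      have "\<bar>?A (r j) x - ?A (r k) x\<bar> \<le> \<eta>" if "x \<in> \<Omega>" for x
      proof -
        have "x \<in> closure \<Omega>" using that closure_subset by blast
        then show ?thesis using N[OF jk(1), of x] N[OF jk(2), of x] unfolding real_norm_def by linarith
      qed
      then have "sqn LO (\<lambda>x. ?A (r j) x - ?A (r k) x) \<le> \<eta>\<^sup>2 * m"
        unfolding m_def by (intro sq_int_bounded(2) sq_int_measurable[OF sq_int_diff[OF As As]])
      then have "sqrt (sqn LO (\<lambda>x. ?A (r j) x - ?A (r k) x)) \<le> sqrt (\<eta>\<^sup>2 * m)" by (rule real_sqrt_le_mono)
      also have "\<dots> = \<eta> * sqrt m" using \<eta> by (simp add: real_sqrt_mult)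
      finally show ?thesis using \<eta>m by linarith
    qed
    moreover have "sqrt (sqn LO (\<lambda>x. \<phi> (r j) x - \<phi> (r k) x)) \<le> sqrt (sqn LO (\<lambda>x. \<phi> (r j) x - ?A (r j) x))
        + (sqrt (sqn LO (\<lambda>x. ?A (r j) x - ?A (r k) x)) + sqrt (sqn LO (\<lambda>x. ?A (r k) x - \<phi> (r k) x)))"
      using sqrt_sqn_triangle_diff[OF test_sq_int(1)[OF \<phi>[of "r j"]] As[of "r j"] test_sq_int(1)[OF \<phi>[of "r k"]]]
        sqrt_sqn_triangle_diff[OF As[of "r j"] As[of "r k"] test_sq_int(1)[OF \<phi>[of "r k"]]] by linarith
    ultimately have "sqrt (sqn LO (\<lambda>x. \<phi> (r j) x - \<phi> (r k) x)) \<le> 3 * d"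
      using Ac[of "r j"] Ac[of "r k"] sqn_minus_commute[of LO "\<phi> (r j)" "?A (r j)"] by simp
    also have "3 * d < sqrt e" using e by (simp add: d_def)
    finally show ?thesis by simp
  qed
  with r show ?thesis by blast
qed

text \<open>Diagonal argument over the tolerances 1/(n+1): the approximate Cauchy condition
  \<open>P n\<close> survives the passage to a subsequence.\<close>

lemma rellich:
  assumes \<phi>: "\<And>k::nat. \<phi> k \<in> test_functions \<Omega>" and K: "\<And>k. sqn LO (gradient (\<phi> k)) \<le> K"
  shows "\<exists>r::nat \<Rightarrow> nat. strict_mono r \<and>
    (\<forall>e>0. \<exists>N. \<forall>j\<ge>N. \<forall>k\<ge>N. sqn LO (\<lambda>x. \<phi> (r j) x - \<phi> (r k) x) < e)"
proof -
  define P where "P n s \<longleftrightarrow> (\<exists>N. \<forall>j\<ge>N. \<forall>k\<ge>N. sqn LO (\<lambda>x. \<phi> (s j) x - \<phi> (s k) x) < inverse (real (Suc n)))"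
    for n :: nat and s :: "nat \<Rightarrow> nat"
  interpret subseqs P
  proof
    fix n and s :: "nat \<Rightarrow> nat"
    show "\<exists>r'. strict_mono r' \<and> P n (s \<circ> r')"
      unfolding P_def comp_def
      by (rule rellich_step[where \<phi> = "\<lambda>k. \<phi> (s k)" and K = K]) (simp_all add: \<phi> K)
  qed
  show ?thesis
  proof (intro exI[of _ diagseq] conjI subseq_diagseq allI impI)
    fix e :: real assume "e > 0"
    then obtain n where n: "inverse (real (Suc n)) < e" using reals_Archimedean by blast
    \<comment> \<open>Only after its first \<open>Suc n\<close> terms is the diagonal sequence a
      subsequence of one that satisfies \<open>P n\<close>.\<close>
    have "P n (diagseq \<circ> ((+) (Suc n)))"
    proof (rule diagseq_holds)
      fix r s :: "nat \<Rightarrow> nat" and n assume r: "strict_mono r" and "P n s"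
      then obtain N where N: "\<forall>j\<ge>N. \<forall>k\<ge>N. sqn LO (\<lambda>x. \<phi> (s j) x - \<phi> (s k) x) < inverse (real (Suc n))"
        unfolding P_def by blast
      have "r j \<ge> N" if "j \<ge> N" for j using seq_suble[OF r, of j] that by linarith
      then show "P n (s \<circ> r)" unfolding P_def comp_def using N by blast
    qed
    then obtain N where N: "\<And>j k. j \<ge> N \<Longrightarrow> k \<ge> N \<Longrightarrow>
        sqn LO (\<lambda>x. \<phi> (diagseq (Suc n + j)) x - \<phi> (diagseq (Suc n + k)) x) < inverse (real (Suc n))"
      unfolding P_def comp_def by blast
    have "sqn LO (\<lambda>x. \<phi> (diagseq j) x - \<phi> (diagseq k) x) < e" if "j \<ge> Suc n + N" "k \<ge> Suc n + N" for j k
      using N[of "j - Suc n" "k - Suc n"] that n by (simp add: le_diff_conv2)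
    then show "\<exists>N. \<forall>j\<ge>N. \<forall>k\<ge>N. sqn LO (\<lambda>x. \<phi> (diagseq j) x - \<phi> (diagseq k) x) < e" by blast
  qed
qed

end

subsection \<open>The first eigenvalue\<close>

lemma linear_term_zero:
  fixes p q :: real
  assumes "\<And>t. 0 \<le> 2 * t * p + t\<^sup>2 * q" shows "p = 0"
proof (rule ccontr)
  assume p: "p \<noteq> 0"
  \<comment> \<open>The test value t = -p / d is short enough for the linear term to outweigh the
    quadratic one, since q < d.\<close>
  define d where "d = \<bar>q\<bar> + 1"
  have d: "d > 0" "q < d" by (auto simp: d_def)
  have "0 \<le> 2 * (- p / d) * p + (- p / d)\<^sup>2 * q" by (rule assms)
  also have "\<dots> = p\<^sup>2 / d * (q / d - 2)"
    using d(1) by (simp add: field_simps power2_eq_square)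
  also have "\<dots> < 0"
    using d p by (intro mult_pos_neg) (auto simp: divide_less_eq)
  finally show False by simp
qed

section \<open>Minimizing the Rayleigh quotient\<close>

context bounded_open
begin

lemma sqn_inner: "(LINT x|M. u x \<bullet> u x) = sqn M u"
  by (simp add: sqn_def power2_norm_eq_inner)

lemma test_function_exists:
  assumes "\<Omega> \<noteq> {}"
  obtains \<phi> where "\<phi> \<in> test_functions \<Omega>" "0 < sqn LO \<phi>"
proof -
  obtain x where "x \<in> \<Omega>" using assms by blast
  then obtain a b where ab: "x \<in> box a b" "cbox a b \<subseteq> \<Omega>"
    using open_\<Omega> by (metis open_contains_cbox)
  let ?f = "bump a b 1"
  have f: "?f \<in> test_functions \<Omega>" by (rule bump_in_test_functions) (use ab in auto)
  have "sqn LO ?f \<noteq> 0"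
  proof
    assume "sqn LO ?f = 0"
    then have "AE x in LO. ?f x = 0" using sqn_eq_0_iff[OF test_sq_int(1)[OF f]] by simp
    then have "AE x in lebesgue. x \<in> \<Omega> \<longrightarrow> ?f x = 0" by (simp add: AE_restrict_space_iff)
    then have "AE x in lebesgue. x \<notin> box a b"
    proof eventually_elim
      case (elim x)
      then show ?case using bump_pos[of 1 x a b] ab(2) box_subset_cbox[of a b] by fastforce
    qed
    then have "negligible (box a b)" by (simp add: negligible_iff_null_sets AE_iff_null_sets)
    then show False using open_not_negligible[OF open_box] ab(1) by blast
  qed
  then have "0 < sqn LO ?f" using sqn_nonneg[of LO ?f] by linarith
  with f show thesis by (rule that)
qed

text \<open>Both sides are continuous along the approximating test functions.\<close>

lemma rayleigh_H10:
  assumes m: "\<And>\<phi>. \<phi> \<in> test_functions \<Omega> \<Longrightarrow> m * sqn LO \<phi> \<le> sqn LO (gradient \<phi>)" and u: "u \<in> H10 \<Omega>"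
  shows "m * sqn LO u \<le> sqn LO (weak_gradient \<Omega> u)"
proof -
  obtain \<phi> where \<phi>: "\<And>k. \<phi> k \<in> test_functions \<Omega>"
    "(\<lambda>k. sqn LO (\<lambda>x. \<phi> k x - u x)) \<longlonglongrightarrow> 0"
    "(\<lambda>k. sqn LO (\<lambda>x. gradient (\<phi> k) x - weak_gradient \<Omega> u x)) \<longlonglongrightarrow> 0" by (rule H10E[OF u]) (rule that)
  show ?thesis
  proof (rule LIMSEQ_le)
    show "(\<lambda>k. m * sqn LO (\<phi> k)) \<longlonglongrightarrow> m * sqn LO u"
      by (intro tendsto_mult_left tendsto_sqn[OF test_sq_int(1)[OF \<phi>(1)] H10D(1)[OF u] \<phi>(2)])
    show "(\<lambda>k. sqn LO (gradient (\<phi> k))) \<longlonglongrightarrow> sqn LO (weak_gradient \<Omega> u)"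
      by (rule tendsto_sqn[OF test_sq_int(2)[OF \<phi>(1)] H10D(2)[OF u] \<phi>(3)])
    show "\<exists>N. \<forall>n\<ge>N. m * sqn LO (\<phi> n) \<le> sqn LO (gradient (\<phi> n))" using m \<phi>(1) by blast
  qed
qed

lemma rayleigh_minimizing_sequence:
  assumes "\<Omega> \<noteq> {}"
  obtains m \<psi> where "m > 0" "\<And>\<phi>. \<phi> \<in> test_functions \<Omega> \<Longrightarrow> m * sqn LO \<phi> \<le> sqn LO (gradient \<phi>)"
    "\<And>k::nat. \<psi> k \<in> test_functions \<Omega>" "\<And>k. sqn LO (\<psi> k) = 1" 
    "\<And>k. sqn LO (gradient (\<psi> k)) < m + inverse (real (Suc k))"
proof -
  define T where "T = {\<phi> \<in> test_functions \<Omega>. 0 < sqn LO \<phi>}"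
  define Q where "Q \<phi> = sqn LO (gradient \<phi>) / sqn LO \<phi>" for \<phi>
  define m where "m = Inf (Q ` T)"
  have ne: "Q ` T \<noteq> {}" using test_function_exists[OF assms] by (auto simp: T_def)
  obtain C where C: "C > 0" "\<And>\<phi>. \<phi> \<in> test_functions \<Omega> \<Longrightarrow> sqn LO \<phi> \<le> C * sqn LO (gradient \<phi>)"
    using poincare by metis
  \<comment> \<open>The Poincare constant keeps the infimum away from zero.\<close>
  have "1 / C \<le> Q \<phi>" if "\<phi> \<in> T" for \<phi>
    using C(2)[of \<phi>] C(1) that by (simp add: Q_def T_def field_simps)
  then have "1 / C \<le> m" unfolding m_def by (intro cInf_greatest[OF ne]) auto
  moreover have "0 < 1 / C" using C(1) by simp
  ultimately have m0: "m > 0" by linarith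
  have bdd: "bdd_below (Q ` T)" unfolding bdd_below_def by (rule exI[of _ 0]) (auto simp: Q_def)
  have R: "m * sqn LO \<phi> \<le> sqn LO (gradient \<phi>)" if \<phi>: "\<phi> \<in> test_functions \<Omega>" for \<phi>
  proof (cases "sqn LO \<phi> = 0")
    case False
    then have pos: "0 < sqn LO \<phi>" using sqn_nonneg[of LO \<phi>] by linarith
    then have "m \<le> Q \<phi>" unfolding m_def using \<phi> by (intro cInf_lower bdd imageI) (simp add: T_def)
    then show ?thesis using pos by (simp add: Q_def pos_le_divide_eq)
  qed simp
  have ex: "\<exists>\<psi>. \<psi> \<in> test_functions \<Omega> \<and> sqn LO \<psi> = 1 \<and> sqn LO (gradient \<psi>) < m + inverse (real (Suc k))" for k
  proof -
    have "Inf (Q ` T) < m + inverse (real (Suc k))" unfolding m_def[symmetric] by simp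
    then obtain \<phi> where "\<phi> \<in> T" and q: "Q \<phi> < m + inverse (real (Suc k))"
      using cInf_lessD[OF ne] by blast
    then have \<phi>: "\<phi> \<in> test_functions \<Omega>" and pos: "0 < sqn LO \<phi>" by (auto simp: T_def)
    \<comment> \<open>Normalizes the L2 norm to 1; the gradient energy of the scaled function is
      then the Rayleigh quotient.\<close>
    define c where "c = 1 / sqrt (sqn LO \<phi>)"
    have c2: "c\<^sup>2 = 1 / sqn LO \<phi>" using pos by (simp add: c_def power_divide)
    have t: "(\<lambda>x. c * \<phi> x) \<in> test_functions \<Omega>" "gradient (\<lambda>x. c * \<phi> x) = (\<lambda>x. c *\<^sub>R gradient \<phi> x)"
      using test_lincomb[OF \<phi> \<phi>, of c 0] by auto
    have "sqn LO (\<lambda>x. c * \<phi> x) = 1" using sqn_scaleR[of LO c \<phi>] pos by (simp add: c2)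
    moreover have "sqn LO (gradient (\<lambda>x. c * \<phi> x)) = Q \<phi>" unfolding t(2) sqn_scaleR c2 Q_def by simp
    ultimately show ?thesis using t(1) q by (intro exI[of _ "\<lambda>x. c * \<phi> x"]) simp
  qed
  obtain \<psi> where "\<forall>k. \<psi> k \<in> test_functions \<Omega> \<and> sqn LO (\<psi> k) = 1 \<and> sqn LO (gradient (\<psi> k)) < m + inverse (real (Suc k))"
    using choice[of "\<lambda>k \<psi>. \<psi> \<in> test_functions \<Omega> \<and> sqn LO \<psi> = 1 \<and> sqn LO (gradient \<psi>) < m + inverse (real (Suc k))"] ex by blast
  then show thesis by (intro that[OF m0 R, of \<psi>]) auto
qed

text \<open>Compactness makes a subsequence of the minimizing sequence Cauchy in L2, and almost
  minimality makes its gradients Cauchy as well. By completeness both have limits, which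
  \<open>H10I\<close> joins into one element of \<open>H10\<close>.\<close>

lemma rayleigh_minimizer:
  assumes "\<Omega> \<noteq> {}"
  obtains m u where "m > 0" "\<And>v. v \<in> H10 \<Omega> \<Longrightarrow> m * sqn LO v \<le> sqn LO (weak_gradient \<Omega> v)"
    "u \<in> H10 \<Omega>" "sqn LO u = 1" "sqn LO (weak_gradient \<Omega> u) = m"
proof -
  obtain m \<psi> where m: "m > 0" and R: "\<And>\<phi>. \<phi> \<in> test_functions \<Omega> \<Longrightarrow> m * sqn LO \<phi> \<le> sqn LO (gradient \<phi>)"
    and \<psi>: "\<And>k::nat. \<psi> k \<in> test_functions \<Omega>" "\<And>k. sqn LO (\<psi> k) = 1" 
    "\<And>k. sqn LO (gradient (\<psi> k)) < m + inverse (real (Suc k))"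
    by (rule rayleigh_minimizing_sequence[OF assms]) (rule that)
  have "sqn LO (gradient (\<psi> k)) \<le> m + 1" for k
  proof -
    have "inverse (real (Suc k)) \<le> 1" by (simp add: inverse_le_1_iff)
    then show ?thesis using \<psi>(3)[of k] by linarith
  qed
  then obtain r :: "nat \<Rightarrow> nat" where r: "strict_mono r"
    and rc: "\<And>e. e > 0 \<Longrightarrow> \<exists>N. \<forall>j\<ge>N. \<forall>k\<ge>N. sqn LO (\<lambda>x. \<psi> (r j) x - \<psi> (r k) x) < e"
    using rellich[of \<psi> "m + 1", OF \<psi>(1)] by blast
  define \<xi> where "\<xi> k = \<psi> (r k)" for k
  have \<xi>: "\<xi> k \<in> test_functions \<Omega>" "sqn LO (\<xi> k) = 1" for k by (auto simp: \<xi>_def \<psi>)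
  have \<xi>g: "sqn LO (gradient (\<xi> k)) < m + inverse (real (Suc k))" for k
  proof -
    \<comment> \<open>Since r k >= k, the subsequence keeps the slack 1/(k+1).\<close>
    have "inverse (real (Suc (r k))) \<le> inverse (real (Suc k))"
      using seq_suble[OF r, of k] by (intro le_imp_inverse_le) auto
    then show ?thesis using \<psi>(3)[of "r k"] unfolding \<xi>_def by linarith
  qed
  note si = test_sq_int[OF \<xi>(1)]
  \<comment> \<open>Parallelogram law: the sum of two almost minimizers has energy at least m times
    its squared norm, which is 4 minus the squared distance of the two. What is left for the
    difference of the gradients is the slack and m times that squared distance.\<close>
  have gc: "sqn LO (\<lambda>x. gradient (\<xi> j) x - gradient (\<xi> k) x)
      \<le> 2 * inverse (real (Suc j)) + 2 * inverse (real (Suc k)) + m * sqn LO (\<lambda>x. \<xi> j x - \<xi> k x)" for j k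
  proof -
    have t: "(\<lambda>x. \<xi> j x + \<xi> k x) \<in> test_functions \<Omega>"
      "gradient (\<lambda>x. \<xi> j x + \<xi> k x) = (\<lambda>x. gradient (\<xi> j) x + gradient (\<xi> k) x)"
      using test_lincomb[OF \<xi>(1)[of j] \<xi>(1)[of k], of 1 1] by auto
    have par: "sqn LO (\<lambda>x. a x - b x) = 2 * sqn LO a + 2 * sqn LO b - sqn LO (\<lambda>x. a x + b x)"
      if "sq_int LO a" "sq_int LO b" for a b :: "real^'n \<Rightarrow> 'c::euclidean_space"
      using sqn_add[OF that] sqn_diff[OF that] by simp
    have "m * sqn LO (\<lambda>x. \<xi> j x + \<xi> k x) \<le> sqn LO (\<lambda>x. gradient (\<xi> j) x + gradient (\<xi> k) x)"
      using R[OF t(1)] unfolding t(2) .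
    moreover have "sqn LO (\<lambda>x. \<xi> j x + \<xi> k x) = 4 - sqn LO (\<lambda>x. \<xi> j x - \<xi> k x)"
      using par[OF si(1)[of j] si(1)[of k]] \<xi>(2)[of j] \<xi>(2)[of k] by linarith
    ultimately have "4 * m - m * sqn LO (\<lambda>x. \<xi> j x - \<xi> k x) \<le> sqn LO (\<lambda>x. gradient (\<xi> j) x + gradient (\<xi> k) x)"
      by (simp add: algebra_simps)
    then show ?thesis
      using par[OF si(2)[of j] si(2)[of k]] \<xi>g[of j] \<xi>g[of k] by linarith
  qed
  have cu: "\<exists>N. \<forall>j\<ge>N. \<forall>k\<ge>N. sqn LO (\<lambda>x. \<xi> j x - \<xi> k x) < e" if "e > 0" for e
    using rc[OF that] unfolding \<xi>_def .
  obtain u where u: "sq_int LO u" "(\<lambda>k. sqn LO (\<lambda>x. \<xi> k x - u x)) \<longlonglongrightarrow> 0"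
    by (rule sq_int_complete[OF si(1) cu]) (assumption | rule that)+
  have cg: "\<exists>N. \<forall>j\<ge>N. \<forall>k\<ge>N. sqn LO (\<lambda>x. gradient (\<xi> j) x - gradient (\<xi> k) x) < e" if e: "e > 0" for e
  proof -
    \<comment> \<open>The L2 term contributes at most e / 2, and the two slack terms stay below 2 e
      / 8 each.\<close>
    have "0 < e / (2 * m)" using e m by simp
    from cu[OF this] obtain N1 where N1: "\<forall>j\<ge>N1. \<forall>k\<ge>N1. sqn LO (\<lambda>x. \<xi> j x - \<xi> k x) < e / (2 * m)" by blast
    obtain N2 where N2: "inverse (real (Suc N2)) < e / 8" using reals_Archimedean[of "e / 8"] e by auto
    have "sqn LO (\<lambda>x. gradient (\<xi> j) x - gradient (\<xi> k) x) < e" if "j \<ge> max N1 N2" "k \<ge> max N1 N2" for j k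
    proof -
      have "inverse (real (Suc j)) \<le> inverse (real (Suc N2))" "inverse (real (Suc k)) \<le> inverse (real (Suc N2))"
        using that by (auto intro!: le_imp_inverse_le)
      moreover have "m * sqn LO (\<lambda>x. \<xi> j x - \<xi> k x) \<le> e / 2"
      proof -
        have "sqn LO (\<lambda>x. \<xi> j x - \<xi> k x) \<le> e / (2 * m)" using N1 that by (simp add: less_imp_le)
        from mult_left_mono[OF this, of m] m show ?thesis by simp
      qed
      ultimately show ?thesis using gc[of j k] N2 by linarith
    qed
    then show ?thesis by blast
  qed
  obtain g where g: "sq_int LO g" "(\<lambda>k. sqn LO (\<lambda>x. gradient (\<xi> k) x - g x)) \<longlonglongrightarrow> 0"
    by (rule sq_int_complete[OF si(2) cg]) (assumption | rule that)+
  note H = H10I[OF \<xi>(1) u(1) g(1) u(2) g(2)]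
  have u1: "sqn LO u = 1"
    using tendsto_sqn[OF si(1) u] \<xi>(2) by (simp add: LIMSEQ_const_iff)
  have gw: "sqn LO (weak_gradient \<Omega> u) = sqn LO g"
    by (rule sqn_cong_AE[OF H(2)]) (use H10D(2)[OF H(1)] g(1) in \<open>auto simp: sq_int_def\<close>)
  have "sqn LO g \<le> m"
  proof (rule LIMSEQ_le)
    show "(\<lambda>k. sqn LO (gradient (\<xi> k))) \<longlonglongrightarrow> sqn LO g" by (rule tendsto_sqn[OF si(2) g])
    show "(\<lambda>k. m + inverse (real (Suc k))) \<longlonglongrightarrow> m"
      using LIMSEQ_inverse_real_of_nat_add[of m] .
    show "\<exists>N. \<forall>n\<ge>N. sqn LO (gradient (\<xi> n)) \<le> m + inverse (real (Suc n))"
      using \<xi>g less_imp_le by blast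
  qed
  moreover have "m * sqn LO u \<le> sqn LO (weak_gradient \<Omega> u)" by (rule rayleigh_H10[OF R H(1)])
  ultimately have "sqn LO (weak_gradient \<Omega> u) = m" using gw u1 by simp
  with u1 m H(1) show thesis using rayleigh_H10[OF R] by (intro that[of m u]) auto
qed

text \<open>The minimum m of the Rayleigh quotient is an eigenvalue by the first variation at the
  minimizer. It is the least one because an eigenfunction tested with itself has Rayleigh quotient
  equal to its eigenvalue.\<close>

lemma first_eigenvalue:
  assumes "\<Omega> \<noteq> {}"
  shows "0 < first_dirichlet_eigenvalue \<Omega>"
    "u \<in> H10 \<Omega> \<Longrightarrow> first_dirichlet_eigenvalue \<Omega> * sqn LO u \<le> sqn LO (weak_gradient \<Omega> u)"
proof -
  obtain m w where m: "m > 0" and R: "\<And>v. v \<in> H10 \<Omega> \<Longrightarrow> m * sqn LO v \<le> sqn LO (weak_gradient \<Omega> v)"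
    and w: "w \<in> H10 \<Omega>" "sqn LO w = 1" "sqn LO (weak_gradient \<Omega> w) = m"
    by (rule rayleigh_minimizer[OF assms]) (rule that)
  have nt: "nontrivial_on \<Omega> v \<longleftrightarrow> sqn LO v \<noteq> 0" if "v \<in> H10 \<Omega>" for v
    using sqn_eq_0_iff[OF H10D(1)[OF that]] by (simp add: nontrivial_on_def)
  have "first_dirichlet_eigenvalue \<Omega> = m"
    unfolding first_dirichlet_eigenvalue_def
  proof (rule Least_equality)
    show "dirichlet_eigenvalue \<Omega> m"
      unfolding dirichlet_eigenvalue_def
    proof (intro bexI[OF _ w(1)] conjI ballI)
      show "nontrivial_on \<Omega> w" using nt[OF w(1)] w(2) by simp
      fix \<phi> assume \<phi>: "\<phi> \<in> H10 \<Omega>"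
      note si = H10D(1,2)[OF w(1)] H10D(1,2)[OF \<phi>]
      define B where "B = (LINT x|LO. weak_gradient \<Omega> w x \<bullet> weak_gradient \<Omega> \<phi> x)"
      define b where "b = (LINT x|LO. w x * \<phi> x)"
      \<comment> \<open>The Rayleigh inequality at \<open>w + t \<phi>\<close> is an equality at t =
        0, so its constant term drops out; the linear coefficient is the defect in the weak
        eigenvalue equation.\<close>
      have "0 \<le> 2 * t * (B - m * b) + t\<^sup>2 * (sqn LO (weak_gradient \<Omega> \<phi>) - m * sqn LO \<phi>)" for t
      proof -
        note L = H10_lincomb[OF w(1) \<phi>, of t]
        have "m * sqn LO (\<lambda>x. w x + t * \<phi> x) \<le> sqn LO (weak_gradient \<Omega> (\<lambda>x. w x + t * \<phi> x))"
          by (rule R[OF L(1)])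
        also have "\<dots> = sqn LO (\<lambda>x. weak_gradient \<Omega> w x + t *\<^sub>R weak_gradient \<Omega> \<phi> x)"
          by (rule sqn_cong_AE[OF L(2)]) (rule sq_int_measurable H10D(2)[OF L(1)] sq_int_add sq_int_scaleR si)+
        also have "\<dots> = m + 2 * t * B + t\<^sup>2 * sqn LO (weak_gradient \<Omega> \<phi>)"
          using sqn_add[OF si(2) sq_int_scaleR[OF si(4), of t]] w(3) by (simp add: sqn_scaleR B_def)
        finally show ?thesis
          using sqn_add[OF si(1) sq_int_scaleR[OF si(3), of t]] sqn_scaleR[of LO t \<phi>] w(2)
          by (simp add: b_def algebra_simps)
      qed
      from linear_term_zero[OF this] show "(LINT x|LO. weak_gradient \<Omega> w x \<bullet> weak_gradient \<Omega> \<phi> x) = m * (LINT x|LO. w x * \<phi> x)"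
        by (simp add: B_def b_def)
    qed
    fix \<mu> assume "dirichlet_eigenvalue \<Omega> \<mu>"
    then obtain v where v: "v \<in> H10 \<Omega>" "nontrivial_on \<Omega> v"
      and e: "(LINT x|LO. weak_gradient \<Omega> v x \<bullet> weak_gradient \<Omega> v x) = \<mu> * (LINT x|LO. v x * v x)"
      unfolding dirichlet_eigenvalue_def by blast
    have "(LINT x|LO. v x * v x) = sqn LO v" using sqn_inner[of LO v] by simp
    then have "m * sqn LO v \<le> \<mu> * sqn LO v" using e R[OF v(1)] by (simp add: sqn_inner)
    moreover have "0 < sqn LO v" using nt[OF v(1)] v(2) sqn_nonneg[of LO v] by linarith
    ultimately show "m \<le> \<mu>" by simp
  qed
  then show "0 < first_dirichlet_eigenvalue \<Omega>"
    "u \<in> H10 \<Omega> \<Longrightarrow> first_dirichlet_eigenvalue \<Omega> * sqn LO u \<le> sqn LO (weak_gradient \<Omega> u)"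
    using m R by auto
qed

end

subsection \<open>Dilations and the Pohozaev inequality\<close>

text \<open>Stated for \<open>lebesgue\<close> rather than \<open>lborel\<close> because elements of
  \<open>H10\<close> are only Lebesgue measurable.\<close>

lemma
  fixes f :: "'a::euclidean_space \<Rightarrow> 'b::euclidean_space"
  assumes f: "f \<in> borel_measurable lebesgue" and c: "c > 0"
  shows borel_measurable_lebesgue_affine: "(\<lambda>x. f (b + c *\<^sub>R x)) \<in> borel_measurable lebesgue"
    and integrable_lebesgue_affine_iff: "integrable lebesgue (\<lambda>x. f (b + c *\<^sub>R x)) \<longleftrightarrow> integrable lebesgue f"
    and integral_lebesgue_affine: "(LINT x|lebesgue. f (b + c *\<^sub>R x)) = (LINT x|lebesgue. f x) /\<^sub>R c ^ DIM('a)"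
proof -
  let ?T = "\<lambda>x::'a. b + c *\<^sub>R x"
  have Teq: "(\<lambda>x. b + (\<Sum>j\<in>Basis. (c * (x \<bullet> j)) *\<^sub>R j)) = ?T"
    unfolding scaleR_scaleR[symmetric] scaleR_sum_right[symmetric] euclidean_representation ..
  have T: "?T \<in> lebesgue \<rightarrow>\<^sub>M lebesgue"
    using lebesgue_affine_measurable[of "\<lambda>_. c" b] c unfolding Teq by simp
  have leb: "lebesgue = density (distr lebesgue lebesgue ?T) (\<lambda>_. ennreal (c ^ DIM('a)))"
    using lebesgue_affine_euclidean[of "\<lambda>_. c" b] c unfolding Teq by simp
  show m: "(\<lambda>x. f (?T x)) \<in> borel_measurable lebesgue"
    using measurable_compose[OF T f] .
  have "(LINT x|lebesgue. f x) = (LINT x|density (distr lebesgue lebesgue ?T) (\<lambda>_. ennreal (c ^ DIM('a))). f x)"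
    using leb by simp
  also have "\<dots> = (LINT x|distr lebesgue lebesgue ?T. c ^ DIM('a) *\<^sub>R f x)"
    by (rule integral_density) (use f c in auto)
  also have "\<dots> = (LINT x|lebesgue. c ^ DIM('a) *\<^sub>R f (?T x))"
    by (rule integral_distr[OF T]) (use f in auto)
  finally show "(LINT x|lebesgue. f (?T x)) = (LINT x|lebesgue. f x) /\<^sub>R c ^ DIM('a)"
    using c by simp
  have "integrable lebesgue f \<longleftrightarrow> integrable (density (distr lebesgue lebesgue ?T) (\<lambda>_. ennreal (c ^ DIM('a)))) f"
    using leb by simp
  also have "\<dots> \<longleftrightarrow> integrable (distr lebesgue lebesgue ?T) (\<lambda>x. c ^ DIM('a) *\<^sub>R f x)"
    by (rule integrable_density) (use f c in auto)
  also have "\<dots> \<longleftrightarrow> integrable lebesgue (\<lambda>x. c ^ DIM('a) *\<^sub>R f (?T x))"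
    by (rule integrable_distr_eq[OF T]) (use f in auto)
  also have "\<dots> \<longleftrightarrow> integrable lebesgue (\<lambda>x. f (?T x))"
    using integrable_scaleR_right[of "inverse (c ^ DIM('a))" lebesgue "\<lambda>x. c ^ DIM('a) *\<^sub>R f (?T x)"]
      integrable_scaleR_right[of "c ^ DIM('a)" lebesgue "\<lambda>x. f (?T x)"] c by auto
  finally show "integrable lebesgue (\<lambda>x. f (?T x)) \<longleftrightarrow> integrable lebesgue f" by simp
qed

locale bounded_starlike = bounded_open \<Omega> for \<Omega> :: "(real^'n) set" +
  fixes a :: "real^'n"
  assumes center: "a \<in> \<Omega>" and star: "\<And>x. x \<in> \<Omega> \<Longrightarrow> closed_segment a x \<subseteq> \<Omega>"
begin

text \<open>The dilation \<open>x \<mapsto> u (a + t (x - a))\<close> of the extension of \<open>u\<close> by zero outside \<open>\<Omega>\<close>.\<close>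

definition dil :: "real \<Rightarrow> (real^'n \<Rightarrow> 'b::euclidean_space) \<Rightarrow> real^'n \<Rightarrow> 'b" where
  "dil t u x = (let y = (1 - t) *\<^sub>R a + t *\<^sub>R x in indicator \<Omega> y *\<^sub>R u y)"

text \<open>As 1 / t <= 1, the point x lies on the segment from \<open>a\<close> to its dilated
  image. This is how starshapedness enters: dilations with t >= 1 push supports into
  \<open>\<Omega>\<close>, never out of it.\<close>

lemma dilate_in:
  assumes t: "1 \<le> t" and x: "(1 - t) *\<^sub>R a + t *\<^sub>R x \<in> \<Omega>"
  shows "x \<in> \<Omega>"
proof -
  let ?y = "(1 - t) *\<^sub>R a + t *\<^sub>R x"
  have "x = (1 - 1 / t) *\<^sub>R a + (1 / t) *\<^sub>R ?y"
  proof -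
    have "(1 - 1 / t) + (1 / t) * (1 - t) = 0" "(1 / t) * t = 1" using t by (simp_all add: field_simps)
    moreover have "(1 - 1 / t) *\<^sub>R a + (1 / t) *\<^sub>R ?y = ((1 - 1 / t) + (1 / t) * (1 - t)) *\<^sub>R a + ((1 / t) * t) *\<^sub>R x"
      by (simp only: scaleR_add_right scaleR_add_left scaleR_scaleR add.assoc)
    ultimately show ?thesis by simp
  qed
  then have "x \<in> closed_segment a ?y"
    unfolding in_segment using t by (intro exI[of _ "1 / t"]) simp
  then show ?thesis using star[OF x] by blast
qed

lemma dil_outside: "1 \<le> t \<Longrightarrow> x \<notin> \<Omega> \<Longrightarrow> dil t u x = 0"
  using dilate_in[of t x] by (auto simp: dil_def Let_def indicator_def)

lemma dil_indicator: "1 \<le> t \<Longrightarrow> indicator \<Omega> x *\<^sub>R dil t u x = dil t u x"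
  using dil_outside[of t x u] by (cases "x \<in> \<Omega>") auto

text \<open>The condition \<open>h 0 = 0\<close> matches the extension by zero. It yields the
  scaling of integrals of squared norms and of G(u) from the single formula
  \<open>dil_integral\<close>.\<close>

lemma dil_comp: "h 0 = 0 \<Longrightarrow> dil t (\<lambda>x. h (u x)) x = h (dil t u x)"
  by (simp add: dil_def Let_def indicator_def)

lemma dil_diff: "dil t (\<lambda>x. u x - v x) = (\<lambda>x. dil t u x - dil t v x)"
  by (rule ext) (simp add: dil_def Let_def scaleR_diff_right)

lemma dil_eqI: "(\<And>y. y \<notin> \<Omega> \<Longrightarrow> u y = 0) \<Longrightarrow> dil t u = (\<lambda>x. u ((1 - t) *\<^sub>R a + t *\<^sub>R x))"
  by (rule ext) (simp add: dil_def Let_def indicator_def)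

lemma
  fixes f :: "real^'n \<Rightarrow> 'b::euclidean_space"
  assumes t: "1 \<le> t" and f: "f \<in> borel_measurable LO"
  shows dil_measurable: "dil t f \<in> borel_measurable LO"
    and dil_integrable: "integrable LO (dil t f) \<longleftrightarrow> integrable LO f"
    and dil_integral: "(LINT x|LO. dil t f x) = (LINT x|LO. f x) /\<^sub>R t ^ CARD('n)"
proof -
  have \<Omega>l: "\<Omega> \<inter> space lebesgue \<in> sets lebesgue" by simp
  let ?F = "\<lambda>x. indicator \<Omega> x *\<^sub>R f x"
  have F: "?F \<in> borel_measurable lebesgue"
    using f by (simp add: borel_measurable_restrict_space_iff[OF \<Omega>l])
  have d: "dil t f = (\<lambda>x. ?F ((1 - t) *\<^sub>R a + t *\<^sub>R x))" by (rule ext) (simp add: dil_def Let_def)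
  have t0: "t > 0" using t by simp
  have i: "(\<lambda>x. indicator \<Omega> x *\<^sub>R dil t f x) = dil t f" using dil_indicator[OF t] by (intro ext)
  have "dil t f \<in> borel_measurable lebesgue"
    unfolding d by (rule borel_measurable_lebesgue_affine[OF F t0])
  then show "dil t f \<in> borel_measurable LO"
    by (simp only: borel_measurable_restrict_space_iff[OF \<Omega>l] i)
  show "integrable LO (dil t f) \<longleftrightarrow> integrable LO f"
    unfolding integrable_restrict_space[OF \<Omega>l] i unfolding d by (rule integrable_lebesgue_affine_iff[OF F t0])
  have "(LINT x|LO. dil t f x) = (LINT x|lebesgue. indicator \<Omega> x *\<^sub>R dil t f x)"
    by (rule integral_restrict_space[OF \<Omega>l])
  also have "\<dots> = (LINT x|lebesgue. ?F ((1 - t) *\<^sub>R a + t *\<^sub>R x))" unfolding i by (simp only: d)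
  also have "\<dots> = (LINT x|lebesgue. ?F x) /\<^sub>R t ^ CARD('n)" using integral_lebesgue_affine[OF F t0] by simp
  also have "(LINT x|lebesgue. ?F x) = (LINT x|LO. f x)" by (rule integral_restrict_space[OF \<Omega>l, symmetric])
  finally show "(LINT x|LO. dil t f x) = (LINT x|LO. f x) /\<^sub>R t ^ CARD('n)" .
qed

lemma
  assumes t: "1 \<le> t" and u: "sq_int LO u"
  shows dil_sq_int: "sq_int LO (dil t u)" and dil_sqn: "sqn LO (dil t u) = sqn LO u / t ^ CARD('n)"
proof -
  have m: "(\<lambda>x. (norm (u x))\<^sup>2) \<in> borel_measurable LO" using u by (auto simp: sq_int_def)
  have e: "dil t (\<lambda>x. (norm (u x))\<^sup>2) = (\<lambda>x. (norm (dil t u x))\<^sup>2)"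
    by (rule ext) (rule dil_comp, simp)
  show "sq_int LO (dil t u)"
    using dil_integrable[OF t m] dil_measurable[OF t sq_int_measurable[OF u]] u unfolding e
    by (simp add: sq_int_def)
  show "sqn LO (dil t u) = sqn LO u / t ^ CARD('n)"
    using dil_integral[OF t m] unfolding e by (simp add: sqn_def divide_inverse)
qed

lemma dil_test:
  assumes t: "1 \<le> t" and \<phi>: "\<phi> \<in> test_functions \<Omega>"
  shows "dil t \<phi> \<in> test_functions \<Omega>" "gradient (dil t \<phi>) = (\<lambda>x. t *\<^sub>R dil t (gradient \<phi>) x)"
proof -
  have e: "dil t \<phi> = (\<lambda>x. \<phi> ((1 - t) *\<^sub>R a + t *\<^sub>R x))" by (rule dil_eqI) (rule test_zero_outside(1)[OF \<phi>])
  have "cont_supp \<Omega> (dil t \<phi>)"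
    unfolding e by (rule cont_supp_affine[OF cont_supp_test[OF \<phi>]]) (use t dilate_in in auto)
  then obtain K where "compact K" "K \<subseteq> \<Omega>" "\<And>x. x \<notin> K \<Longrightarrow> dil t \<phi> x = 0"
    unfolding cont_supp_def by blast
  then show "dil t \<phi> \<in> test_functions \<Omega>"
    by (intro test_functionsI[of _ K]) (simp_all add: e smooth_affine[OF test_smooth[OF \<phi>]])
  have "dil t (gradient \<phi>) = (\<lambda>x. gradient \<phi> ((1 - t) *\<^sub>R a + t *\<^sub>R x))"
    by (rule dil_eqI) (rule test_zero_outside(2)[OF \<phi>])
  then show "gradient (dil t \<phi>) = (\<lambda>x. t *\<^sub>R dil t (gradient \<phi>) x)"
    unfolding e using gradient_affine[OF test_smooth[OF \<phi>]] by (intro ext) simp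
qed

lemma dil_tendsto:
  fixes v :: "nat \<Rightarrow> real^'n \<Rightarrow> 'b::euclidean_space"
  assumes t: "1 \<le> t" and "\<And>k. sq_int LO (v k)" "sq_int LO u" and lim: "(\<lambda>k. sqn LO (\<lambda>x. v k x - u x)) \<longlonglongrightarrow> 0"
  shows "(\<lambda>k. sqn LO (\<lambda>x. dil t (v k) x - dil t u x)) \<longlonglongrightarrow> 0"
proof -
  have "sqn LO (\<lambda>x. dil t (v k) x - dil t u x) = sqn LO (\<lambda>x. v k x - u x) / t ^ CARD('n)" for k
    unfolding dil_diff[symmetric] by (rule dil_sqn[OF t sq_int_diff[OF assms(2,3)]])
  then show ?thesis using tendsto_divide_zero[OF lim] by simp
qed

text \<open>Dilation scales squared L2 distances by a fixed factor, so the dilated test functions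
  approximate the dilated function together with its gradient.\<close>

lemma dil_H10:
  assumes t: "1 \<le> t" and u: "u \<in> H10 \<Omega>"
  shows "dil t u \<in> H10 \<Omega>" "AE x in LO. weak_gradient \<Omega> (dil t u) x = t *\<^sub>R dil t (weak_gradient \<Omega> u) x"
proof -
  obtain \<phi> where \<phi>: "\<And>k. \<phi> k \<in> test_functions \<Omega>"
    "(\<lambda>k. sqn LO (\<lambda>x. \<phi> k x - u x)) \<longlonglongrightarrow> 0"
    "(\<lambda>k. sqn LO (\<lambda>x. gradient (\<phi> k) x - weak_gradient \<Omega> u x)) \<longlonglongrightarrow> 0" by (rule H10E[OF u]) (rule that)
  note si = H10D(1,2)[OF u] test_sq_int[OF \<phi>(1)]
  have "(\<lambda>k. sqn LO (\<lambda>x. dil t (gradient (\<phi> k)) x - dil t (weak_gradient \<Omega> u) x)) \<longlonglongrightarrow> 0"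
    by (rule dil_tendsto[OF t si(4) si(2) \<phi>(3)])
  then have "(\<lambda>k. t\<^sup>2 * sqn LO (\<lambda>x. dil t (gradient (\<phi> k)) x - dil t (weak_gradient \<Omega> u) x)) \<longlonglongrightarrow> t\<^sup>2 * 0"
    by (rule tendsto_mult_left)
  moreover have "sqn LO (\<lambda>x. gradient (dil t (\<phi> k)) x - t *\<^sub>R dil t (weak_gradient \<Omega> u) x)
      = t\<^sup>2 * sqn LO (\<lambda>x. dil t (gradient (\<phi> k)) x - dil t (weak_gradient \<Omega> u) x)" for k
    unfolding dil_test(2)[OF t \<phi>(1)] scaleR_diff_right[symmetric] by (rule sqn_scaleR)
  ultimately have "(\<lambda>k. sqn LO (\<lambda>x. gradient (dil t (\<phi> k)) x - t *\<^sub>R dil t (weak_gradient \<Omega> u) x)) \<longlonglongrightarrow> 0"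
    by simp
  from H10I[OF dil_test(1)[OF t \<phi>(1)] dil_sq_int[OF t si(1)] sq_int_scaleR[OF dil_sq_int[OF t si(2)]]
      dil_tendsto[OF t si(3) si(1) \<phi>(2)] this]
  show "dil t u \<in> H10 \<Omega>" "AE x in LO. weak_gradient \<Omega> (dil t u) x = t *\<^sub>R dil t (weak_gradient \<Omega> u) x"
    by blast+
qed

text \<open>A dilation by t moves x by (t - 1)(x - a), so the squared radius of
  \<open>\<Omega>\<close> about \<open>a\<close> serves as M. The bound is proved for test functions
  and passes to \<open>H10\<close> by density.\<close>

lemma dil_displacement:
  obtains M where "0 \<le> M" "\<And>t u. 1 \<le> t \<Longrightarrow> u \<in> H10 \<Omega> \<Longrightarrow>
    sqn LO (\<lambda>x. dil t u x - u x) \<le> M * (t - 1)\<^sup>2 * sqn LO (weak_gradient \<Omega> u)"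
proof -
  obtain R where R: "R > 0" "\<And>x. x \<in> \<Omega> \<Longrightarrow> norm (x - a) \<le> R"
  proof -
    have "bounded ((\<lambda>x. x - a) ` \<Omega>)" using bounded_\<Omega> by (rule bounded_translation_minus)
    then show thesis using that unfolding bounded_pos by blast
  qed
  have test: "sqn LO (\<lambda>x. dil t \<phi> x - \<phi> x) \<le> R\<^sup>2 * (t - 1)\<^sup>2 * sqn LO (gradient \<phi>)"
    if t: "1 \<le> t" and \<phi>: "\<phi> \<in> test_functions \<Omega>" for t \<phi>
  proof -
    let ?\<tau> = "t - 1" and ?p = "- ((t - 1) *\<^sub>R a)"
    have "sqn lborel (\<lambda>x. \<phi> (?p + (1 + ?\<tau>) *\<^sub>R x) - \<phi> x) \<le> (?\<tau> * R)\<^sup>2 * sqn lborel (gradient \<phi>)"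
    proof (rule displacement_estimate[OF \<phi>])
      fix x and s :: real
      assume s: "0 \<le> s" "s \<le> 1" and y: "s *\<^sub>R ?p + (1 + s * ?\<tau>) *\<^sub>R x \<in> \<Omega>"
      have "s *\<^sub>R ?p + (1 + s * ?\<tau>) *\<^sub>R x - a = (1 + s * ?\<tau>) *\<^sub>R (x - a)" by (simp add: algebra_simps)
      \<comment> \<open>The bound is known for the moved point, which is at least as far from
        \<open>a\<close> as x is.\<close>
      then have "(1 + s * ?\<tau>) * norm (x - a) \<le> R" using R(2)[OF y] s t by simp
      moreover have "1 * norm (x - a) \<le> (1 + s * ?\<tau>) * norm (x - a)"
        using s t by (intro mult_right_mono) auto
      ultimately have "norm (x - a) \<le> R" by linarith
      moreover have "?p + ?\<tau> *\<^sub>R x = ?\<tau> *\<^sub>R (x - a)" by (simp add: algebra_simps)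
      ultimately show "norm (?p + ?\<tau> *\<^sub>R x) \<le> ?\<tau> * R" using t by (simp add: mult_left_mono)
    qed (use t R(1) in auto)
    moreover have "(\<lambda>x. \<phi> (?p + (1 + ?\<tau>) *\<^sub>R x) - \<phi> x) = (\<lambda>x. dil t \<phi> x - \<phi> x)"
      using dil_eqI[of \<phi> t] test_zero_outside(1)[OF \<phi>] by (simp add: algebra_simps)
    moreover have "(\<lambda>x. dil t \<phi> x - \<phi> x) \<in> test_functions \<Omega>"
      using test_lincomb(1)[OF dil_test(1)[OF t \<phi>] \<phi>, of 1 "-1"] by simp
    ultimately show ?thesis by (simp add: sqn_test \<phi> power_mult_distrib mult.commute)
  qed
  have "sqn LO (\<lambda>x. dil t u x - u x) \<le> R\<^sup>2 * (t - 1)\<^sup>2 * sqn LO (weak_gradient \<Omega> u)"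
    if t: "1 \<le> t" and u: "u \<in> H10 \<Omega>" for t u
  proof -
    obtain \<phi> where \<phi>: "\<And>k. \<phi> k \<in> test_functions \<Omega>"
      "(\<lambda>k. sqn LO (\<lambda>x. \<phi> k x - u x)) \<longlonglongrightarrow> 0"
      "(\<lambda>k. sqn LO (\<lambda>x. gradient (\<phi> k) x - weak_gradient \<Omega> u x)) \<longlonglongrightarrow> 0" by (rule H10E[OF u]) (rule that)
    note si = H10D(1,2)[OF u] test_sq_int[OF \<phi>(1)]
    note sd = dil_sq_int[OF t si(1)] dil_sq_int[OF t si(3)]
    have 1: "(\<lambda>k. sqn LO (\<lambda>x. (dil t (\<phi> k) x - \<phi> k x) - (dil t u x - u x))) \<longlonglongrightarrow> 0"
      using tendsto_sqn_lincomb[OF dil_tendsto[OF t si(3) si(1) \<phi>(2)] \<phi>(2) sd(2) si(3) sd(1) si(1), of "-1"] by simp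
    show ?thesis
    proof (rule LIMSEQ_le)
      show "(\<lambda>k. sqn LO (\<lambda>x. dil t (\<phi> k) x - \<phi> k x)) \<longlonglongrightarrow> sqn LO (\<lambda>x. dil t u x - u x)"
        by (rule tendsto_sqn[OF sq_int_diff[OF sd(2) si(3)] sq_int_diff[OF sd(1) si(1)] 1])
      show "(\<lambda>k. R\<^sup>2 * (t - 1)\<^sup>2 * sqn LO (gradient (\<phi> k))) \<longlonglongrightarrow> R\<^sup>2 * (t - 1)\<^sup>2 * sqn LO (weak_gradient \<Omega> u)"
        by (intro tendsto_mult_left tendsto_sqn[OF si(4) si(2) \<phi>(3)])
    qed (use test[OF t \<phi>(1)] in blast)
  qed
  then show thesis by (intro that[of "R\<^sup>2"]) auto
qed

text \<open>The excess of |u| over C has L2 norm zero, and dilation preserves this. The scaling of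
  norms thus replaces an argument about preimages of null sets.\<close>

lemma dil_AE_bound:
  fixes u :: "real^'n \<Rightarrow> real"
  assumes t: "1 \<le> t" and u: "u \<in> borel_measurable LO" and C: "0 \<le> C" "AE x in LO. \<bar>u x\<bar> \<le> C"
  shows "AE x in LO. \<bar>dil t u x\<bar> \<le> C"
proof -
  define h where "h y = max 0 (\<bar>y\<bar> - C)" for y :: real
  have [measurable]: "u \<in> borel_measurable LO" by (rule u)
  have m: "(\<lambda>x. h (u x)) \<in> borel_measurable LO" unfolding h_def by measurable
  have ae: "AE x in LO. h (u x) = 0" using C(2) by eventually_elim (simp add: h_def)
  have s: "sq_int LO (\<lambda>x. h (u x))"
    unfolding sq_int_def
  proof
    show "integrable LO (\<lambda>x. (norm (h (u x)))\<^sup>2)"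
      by (rule integrable_cong_AE_imp[OF Bochner_Integration.integrable_zero]) (use m ae in \<open>auto elim: eventually_mono\<close>)
  qed (rule m)
  have "sqn LO (dil t (\<lambda>x. h (u x))) = 0"
    using dil_sqn[OF t s] sqn_eq_0_iff[OF s] ae by simp
  then have "AE x in LO. dil t (\<lambda>x. h (u x)) x = 0"
    using sqn_eq_0_iff[OF dil_sq_int[OF t s]] by simp
  then show ?thesis
  proof eventually_elim
    case (elim x)
    moreover have "h 0 = 0" using C(1) by (simp add: h_def)
    ultimately have "h (dil t u x) = 0" by (simp add: dil_comp)
    then show ?case by (simp add: h_def max_def split: if_splits)
  qed
qed

end

section \<open>The nonlinearity and its primitive\<close>

lemma locally_lipschitz_on_compact:
  assumes "locally_lipschitz f" "compact X"
  obtains L where "L-lipschitz_on X f"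
proof -
  \<comment> \<open>A dummy parameter that ranges over one point turns \<open>f\<close> into a
    parametrized family, the form required by
    \<open>local_lipschitz_compact_implies_lipschitz\<close>.\<close>
  have "local_lipschitz {0::real} X (\<lambda>_. f)"
    unfolding local_lipschitz_def
  proof (intro ballI)
    fix x t :: real
    obtain d L where d: "d > 0" "L-lipschitz_on (ball x d) f"
      using assms(1) unfolding locally_lipschitz_def by blast
    have "cball x (d/2) \<inter> X \<subseteq> ball x d" using d(1) by auto
    then have "L-lipschitz_on (cball x (d/2) \<inter> X) f" by (rule lipschitz_on_subset[OF d(2)])
    then show "\<exists>u>0. \<exists>L. \<forall>t\<in>cball t u \<inter> {0}. L-lipschitz_on (cball x u \<inter> X) f"
      using d(1) by (intro exI[of _ "d/2"] conjI exI[of _ L]) auto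
  qed
  from local_lipschitz_compact_implies_lipschitz[OF this assms(2)] show thesis
    using that by (metis compact_sing continuous_on_const singletonI)
qed

lemma locally_lipschitz_continuous:
  assumes "locally_lipschitz f" shows "continuous_on UNIV f"
  unfolding continuous_on_eq_continuous_at[OF open_UNIV]
proof
  fix x
  obtain d L where d: "d > 0" "L-lipschitz_on (ball x d) f"
    using assms unfolding locally_lipschitz_def by blast
  show "isCont f x"
    using lipschitz_on_continuous_on[OF d(2)] d(1) by (simp add: continuous_on_eq_continuous_at)
qed

lemma DERIV_interval_integral:
  fixes f :: "real \<Rightarrow> real"
  assumes "continuous_on UNIV f"
  shows "DERIV (\<lambda>s. LBINT t=0..ereal s. f t) s :> f s"
proof -
  \<comment> \<open>The added 1 makes s an interior point of an interval that also contains 0, so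
    the one-sided restriction of the derivative can be removed.\<close>
  define b where "b = \<bar>s\<bar> + 1"
  have "((\<lambda>u. LBINT y=ereal 0..ereal u. f y) has_vector_derivative f s) (at s within {-b..b})"
    by (rule interval_integral_FTC2) (auto simp: b_def intro: continuous_on_subset[OF assms])
  then have "((\<lambda>u. LBINT y=ereal 0..ereal u. f y) has_vector_derivative f s) (at s within {-b<..<b})"
    by (rule has_vector_derivative_within_subset) auto
  moreover have "s \<in> {-b<..<b}" by (auto simp: b_def)
  ultimately have "((\<lambda>u. LBINT y=ereal 0..ereal u. f y) has_vector_derivative f s) (at s)"
    by (simp add: at_within_open[of s "{-b<..<b}"])
  then show ?thesis by (simp add: has_real_derivative_iff_has_vector_derivative zero_ereal_def)
qed

text \<open>By the mean value theorem the increment is \<open>g z * (y - x)\<close> with z between x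
  and y; replacing \<open>g z\<close> by \<open>g x\<close> costs one Lipschitz factor.\<close>

lemma primitive_second_order:
  fixes G g :: "real \<Rightarrow> real"
  assumes G: "\<And>s. DERIV G s :> g s" and L: "L-lipschitz_on {-C..C} g"
    and xy: "\<bar>x\<bar> \<le> C" "\<bar>y\<bar> \<le> C"
  shows "G y - G x \<le> g x * (y - x) + L * (y - x)\<^sup>2"
proof -
  have "\<exists>z. \<bar>z - x\<bar> \<le> \<bar>y - x\<bar> \<and> \<bar>z\<bar> \<le> C \<and> G y - G x = g z * (y - x)"
  proof (cases x y rule: linorder_cases)
    case less
    from MVT2[OF less, of G g] G obtain z where "x < z" "z < y" "G y - G x = (y - x) * g z" by blast
    then show ?thesis using xy by (intro exI[of _ z]) (auto simp: mult.commute abs_le_iff)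
  next
    case greater
    from MVT2[OF greater, of G g] G obtain z where "y < z" "z < x" "G x - G y = (x - y) * g z" by blast
    then show ?thesis using xy by (intro exI[of _ z]) (auto simp: algebra_simps abs_le_iff)
  qed (use xy in auto)
  then obtain z where z: "\<bar>z - x\<bar> \<le> \<bar>y - x\<bar>" "\<bar>z\<bar> \<le> C" "G y - G x = g z * (y - x)" by blast
  have "\<bar>g z - g x\<bar> \<le> L * \<bar>z - x\<bar>"
    using lipschitz_onD[OF L, of z x] z(2) xy(1) by (simp add: dist_real_def abs_le_iff)
  also have "\<dots> \<le> L * \<bar>y - x\<bar>" using z(1) lipschitz_on_nonneg[OF L] by (rule mult_left_mono)
  finally have "\<bar>(g z - g x) * (y - x)\<bar> \<le> L * \<bar>y - x\<bar> * \<bar>y - x\<bar>"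
    unfolding abs_mult by (rule mult_right_mono) simp
  also have "\<dots> = L * (y - x)\<^sup>2" by (simp add: power2_eq_square mult.assoc)
  finally show ?thesis using z(3) by (simp add: left_diff_distrib abs_le_iff)
qed

text \<open>Both sides of the hypothesis vanish at \<open>t = 1\<close>, so their right derivatives there are comparable.\<close>

lemma derivative_at_one:
  fixes A E K :: real and n :: nat
  assumes "\<And>t. 1 < t \<Longrightarrow> A / t ^ n - A \<le> t * sqrt (1 / t ^ n) * E - E + K * (t - 1)\<^sup>2"
  shows "(real n - 2) / 2 * E \<le> real n * A"
proof (rule ccontr)
  assume neg: "\<not> ?thesis"
  \<comment> \<open>The left side minus the right side, with t sqrt(1 / t^n) written as a power with
    exponent 1 - n/2. It vanishes at 1 and is at most 0 for t > 1, which a positive derivative at 1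
    would contradict.\<close>
  define h where "h t = (A * t powr (- real n) - A) - (t powr (1 - real n / 2) * E - E) - K * (t - 1)\<^sup>2" for t
  have "DERIV h 1 :> (A * (- real n)) - ((1 - real n / 2) * E)"
    unfolding h_def by (auto intro!: derivative_eq_intros)
  moreover have "0 < (A * (- real n)) - ((1 - real n / 2) * E)" using neg by (simp add: field_simps)
  ultimately obtain d where d: "d > 0" "\<And>s. 0 < s \<Longrightarrow> s < d \<Longrightarrow> h 1 < h (1 + s)"
    using DERIV_pos_inc_right by blast
  define t where "t = 1 + d / 2"
  have t: "t > 1" using d(1) by (simp add: t_def)
  have "h 1 < h t" unfolding t_def by (rule d(2)) (use d(1) in auto)
  moreover have "h 1 = 0" by (simp add: h_def)
  moreover have "h t \<le> 0"
  proof -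
    have 1: "t powr (- real n) = 1 / t ^ n" using t by (simp add: powr_minus powr_realpow divide_inverse)
    have "sqrt (1 / t ^ n) = t powr (- real n / 2)"
      using t by (simp add: 1[symmetric] powr_half_sqrt[symmetric] powr_powr)
    then have "t powr (1 - real n / 2) = t * sqrt (1 / t ^ n)"
      using t powr_add[of t 1 "- real n / 2"] by simp
    then show ?thesis using assms[OF t] by (simp add: h_def 1)
  qed
  ultimately show False by simp
qed

section \<open>The Pohozaev inequality\<close>

context bounded_starlike
begin

lemma bounded_composition:
  fixes h :: "real \<Rightarrow> real"
  assumes h: "continuous_on UNIV h" and u: "u \<in> borel_measurable LO" and C: "AE x in LO. \<bar>u x\<bar> \<le> C"
  shows "sq_int LO (\<lambda>x. h (u x))" "integrable LO (\<lambda>x. h (u x))"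
proof -
  have "bounded (h ` {-C..C})"
    by (intro compact_imp_bounded compact_continuous_image continuous_on_subset[OF h]) auto
  then obtain B where "\<forall>z\<in>h ` {-C..C}. norm z \<le> B" unfolding bounded_iff by blast
  then have B: "\<bar>h y\<bar> \<le> B" if "\<bar>y\<bar> \<le> C" for y using that by (simp add: abs_le_iff)
  have m: "(\<lambda>x. h (u x)) \<in> borel_measurable LO"
    using measurable_compose[OF u borel_measurable_continuous_onI[OF h]] .
  show "sq_int LO (\<lambda>x. h (u x))"
    unfolding sq_int_def
  proof
    show "integrable LO (\<lambda>x. (norm (h (u x)))\<^sup>2)"
    proof (rule Bochner_Integration.integrable_bound)
      show "integrable LO (\<lambda>x. B\<^sup>2)" by simp
      show "AE x in LO. norm ((norm (h (u x)))\<^sup>2) \<le> norm (B\<^sup>2)"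
        using C
      proof eventually_elim
        case (elim x)
        have "(h (u x))\<^sup>2 \<le> B\<^sup>2" using power_mono[OF B[OF elim] abs_ge_zero, of 2] by simp
        then show ?case by simp
      qed
    qed (use m in simp)
  qed (rule m)
  then show "integrable LO (\<lambda>x. h (u x))" by (rule integrable_sq_int)
qed

text \<open>The equation is tested with v = \<open>dil t u\<close> and with u. Since G(v) - G(u) is
  only bounded from above, it is enough to bound the product of the two gradients from above by
  Cauchy-Schwarz.\<close>

lemma pohozaev_inequality:
  assumes sol: "bounded_weak_solution \<Omega> lam f u" and f: "locally_lipschitz f"
  defines "G \<equiv> \<lambda>s. lam * s\<^sup>2 / 2 + (LBINT t=0..ereal s. f t)"
  shows "(real CARD('n) - 2) / 2 * sqn LO (weak_gradient \<Omega> u) \<le> real CARD('n) * (LINT x|LO. G (u x))"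
proof -
  define g where "g s = lam * s + f s" for s
  have fc: "continuous_on UNIV f" by (rule locally_lipschitz_continuous[OF f])
  have gc: "continuous_on UNIV g" unfolding g_def by (intro continuous_intros fc)
  have G': "DERIV G s :> g s" for s
    unfolding G_def g_def using DERIV_interval_integral[OF fc, of s]
    by (auto intro!: derivative_eq_intros)
  have Gc: "continuous_on UNIV G" using G' by (intro DERIV_continuous_on) blast
  have G0: "G 0 = 0" by (simp add: G_def zero_ereal_def[symmetric])
  have uH: "u \<in> H10 \<Omega>" and uL: "u \<in> Linf \<Omega>"
    and eq: "\<And>\<phi>. \<phi> \<in> H10 \<Omega> \<Longrightarrow> (LINT x|LO. weak_gradient \<Omega> u x \<bullet> weak_gradient \<Omega> \<phi> x)
        = lam * (LINT x|LO. u x * \<phi> x) + (LINT x|LO. f (u x) * \<phi> x)"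
    using sol unfolding bounded_weak_solution_def by blast+
  have um: "u \<in> borel_measurable LO" using uL by (simp add: Linf_def)
  obtain C0 where C0: "AE x in LO. \<bar>u x\<bar> \<le> C0" using uL by (auto simp: Linf_def)
  \<comment> \<open>A nonnegative bound is needed because the dilated function takes the value 0
    where the extension by zero is used.\<close>
  define C where "C = max C0 0"
  have C: "0 \<le> C" "AE x in LO. \<bar>u x\<bar> \<le> C" using C0 by (auto simp: C_def elim: eventually_mono)
  obtain Lf where Lf: "Lf-lipschitz_on {-C..C} f"
    using locally_lipschitz_on_compact[OF f compact_Icc] by metis
  define L where "L = \<bar>lam\<bar> + Lf"
  have "\<bar>lam\<bar>-lipschitz_on {-C..C} (\<lambda>s. lam * s)"
    by (rule lipschitz_onI) (simp_all add: dist_real_def right_diff_distrib[symmetric] abs_mult)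
  from lipschitz_on_add[OF this Lf] have L: "L-lipschitz_on {-C..C} g" unfolding g_def L_def .
  have L0: "0 \<le> L" by (rule lipschitz_on_nonneg[OF L])
  define E where "E = sqn LO (weak_gradient \<Omega> u)"
  define A where "A = (LINT x|LO. G (u x))"
  note us = H10D(1,2)[OF uH]
  have gu: "sq_int LO (\<lambda>x. g (u x))" "sq_int LO (\<lambda>x. f (u x))"
    by (rule bounded_composition[OF gc um C(2)] bounded_composition[OF fc um C(2)])+
  have Gu: "integrable LO (\<lambda>x. G (u x))" by (rule bounded_composition[OF Gc um C(2)])
  have eqg: "(LINT x|LO. weak_gradient \<Omega> u x \<bullet> weak_gradient \<Omega> \<phi> x) = (LINT x|LO. g (u x) * \<phi> x)"
    if \<phi>: "\<phi> \<in> H10 \<Omega>" for \<phi>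
  proof -
    have "integrable LO (\<lambda>x. lam * (u x * \<phi> x))" "integrable LO (\<lambda>x. f (u x) * \<phi> x)"
      using integrable_mult_real[OF us(1) H10D(1)[OF \<phi>]] integrable_mult_real[OF gu(2) H10D(1)[OF \<phi>]] by auto
    then show ?thesis using eq[OF \<phi>] by (simp add: g_def distrib_right mult.assoc)
  qed
  obtain M where M: "0 \<le> M" "\<And>t u. 1 \<le> t \<Longrightarrow> u \<in> H10 \<Omega> \<Longrightarrow>
    sqn LO (\<lambda>x. dil t u x - u x) \<le> M * (t - 1)\<^sup>2 * sqn LO (weak_gradient \<Omega> u)"
    by (rule dil_displacement) (rule that)
  \<comment> \<open>The quadratic constant combines the Lipschitz constant L of g with the
    displacement bound M E.\<close>
  have "A / t ^ CARD('n) - A \<le> t * sqrt (1 / t ^ CARD('n)) * E - E + (L * M * E) * (t - 1)\<^sup>2" if "1 < t" for t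
  proof -
    have t: "1 \<le> t" using that by simp
    define v where "v = dil t u"
    have vH: "v \<in> H10 \<Omega>" and vg: "AE x in LO. weak_gradient \<Omega> v x = t *\<^sub>R dil t (weak_gradient \<Omega> u) x"
      unfolding v_def by (rule dil_H10[OF t uH])+
    note vs = H10D(1,2)[OF vH]
    have vC: "AE x in LO. \<bar>v x\<bar> \<le> C" unfolding v_def by (rule dil_AE_bound[OF t um C])
    have Gv: "integrable LO (\<lambda>x. G (v x))"
      by (rule bounded_composition[OF Gc sq_int_measurable[OF vs(1)] vC])
    have Av: "(LINT x|LO. G (v x)) = A / t ^ CARD('n)"
      using dil_integral[OF t, of "\<lambda>x. G (u x)"] Gu dil_comp[of G t u, OF G0]
      by (simp add: v_def A_def divide_inverse)
    have "sqn LO (weak_gradient \<Omega> v) = sqn LO (\<lambda>x. t *\<^sub>R dil t (weak_gradient \<Omega> u) x)"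
      by (rule sqn_cong_AE[OF vg sq_int_measurable[OF vs(2)]
          sq_int_measurable[OF sq_int_scaleR[OF dil_sq_int[OF t us(2)]]]])
    also have "\<dots> = t\<^sup>2 * (E / t ^ CARD('n))" by (simp add: sqn_scaleR dil_sqn[OF t us(2)] E_def)
    \<comment> \<open>The factor t comes from the chain rule, the root from the change of
      variables.\<close>
    finally have Ev: "sqrt (sqn LO (weak_gradient \<Omega> v)) = t * sqrt (1 / t ^ CARD('n)) * sqrt E"
      using t by (simp add: real_sqrt_mult real_sqrt_divide)
    have i1: "integrable LO (\<lambda>x. g (u x) * v x)" "integrable LO (\<lambda>x. g (u x) * u x)"
      by (rule integrable_mult_real[OF gu(1) vs(1)] integrable_mult_real[OF gu(1) us(1)])+
    have i2: "integrable LO (\<lambda>x. (v x - u x)\<^sup>2)" using sq_int_diff[OF vs(1) us(1)] by (simp add: sq_int_def)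
    have "A / t ^ CARD('n) - A = (LINT x|LO. G (v x) - G (u x))" using Gv Gu Av by (simp add: A_def)
    \<comment> \<open>The expansion is centred at u, not at v, because the equation evaluates
      integrals against g(u).\<close>
    also have "\<dots> \<le> (LINT x|LO. (g (u x) * v x - g (u x) * u x) + L * (v x - u x)\<^sup>2)"
    proof (rule integral_mono_AE)
      show "AE x in LO. G (v x) - G (u x) \<le> (g (u x) * v x - g (u x) * u x) + L * (v x - u x)\<^sup>2"
        using C(2) vC
      proof eventually_elim
        case (elim x)
        from primitive_second_order[OF G' L elim] show ?case by (simp add: right_diff_distrib)
      qed
    qed (use Gv Gu i1 i2 in auto)
    also have "\<dots> = (LINT x|LO. g (u x) * v x) - (LINT x|LO. g (u x) * u x) + L * sqn LO (\<lambda>x. v x - u x)"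
      using i1 i2 by (simp add: sqn_def)
    also have "(LINT x|LO. g (u x) * v x) = (LINT x|LO. weak_gradient \<Omega> u x \<bullet> weak_gradient \<Omega> v x)"
      by (rule eqg[OF vH, symmetric])
    also have "(LINT x|LO. g (u x) * u x) = E" using eqg[OF uH] sqn_inner[of LO "weak_gradient \<Omega> u"] by (simp add: E_def)
    also have "(LINT x|LO. weak_gradient \<Omega> u x \<bullet> weak_gradient \<Omega> v x) - E + L * sqn LO (\<lambda>x. v x - u x)
        \<le> t * sqrt (1 / t ^ CARD('n)) * E - E + (L * M * E) * (t - 1)\<^sup>2"
    proof -
      have "(LINT x|LO. weak_gradient \<Omega> u x \<bullet> weak_gradient \<Omega> v x) \<le> sqrt E * (t * sqrt (1 / t ^ CARD('n)) * sqrt E)"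
        using Cauchy_Schwarz_sqn[OF us(2) vs(2)] unfolding Ev E_def[symmetric] by linarith
      also have "\<dots> = t * sqrt (1 / t ^ CARD('n)) * (sqrt E * sqrt E)" by (simp only: mult_ac)
      also have "sqrt E * sqrt E = E" by (simp add: E_def)
      finally have a: "(LINT x|LO. weak_gradient \<Omega> u x \<bullet> weak_gradient \<Omega> v x) \<le> t * sqrt (1 / t ^ CARD('n)) * E" .
      have "L * sqn LO (\<lambda>x. v x - u x) \<le> L * (M * (t - 1)\<^sup>2 * E)"
        unfolding v_def E_def by (intro mult_left_mono M(2) t uH L0)
      then show ?thesis using a by (simp add: mult_ac)
    qed
    finally show ?thesis .
  qed
  from derivative_at_one[OF this] show ?thesis by (simp add: A_def E_def)
qed

end

section \<open>Comparison of the Pohozaev inequality with the first eigenvalue\<close>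

theorem theorem2p2:
  fixes \<Omega> :: "(real^'n) set" and lam :: real and f :: "real \<Rightarrow> real"
  assumes "CARD('n) \<ge> 3"
    and "smooth_bounded_domain \<Omega>"
    and "starlike \<Omega>"
    and "lam \<le> (real CARD('n) - 2) / real CARD('n) * first_dirichlet_eigenvalue \<Omega>"
    and "locally_lipschitz f"
    and "\<And>s :: real. (LBINT t=0..ereal s. f t) \<le> 0"
  shows "\<not> (\<exists>u. bounded_weak_solution \<Omega> lam f u \<and> nontrivial_on \<Omega> u)"
proof
  assume "\<exists>u. bounded_weak_solution \<Omega> lam f u \<and> nontrivial_on \<Omega> u"
  then obtain u where sol: "bounded_weak_solution \<Omega> lam f u" and nt: "nontrivial_on \<Omega> u" by blast
  obtain a where a: "a \<in> \<Omega>" "\<And>x. x \<in> \<Omega> \<Longrightarrow> closed_segment a x \<subseteq> \<Omega>"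
    using assms(3) unfolding starlike_def by blast
  interpret bounded_starlike \<Omega> a
    by unfold_locales (use assms(2) a in \<open>auto simp: smooth_bounded_domain_def\<close>)
  define F where "F s = (LBINT t=0..ereal s. f t)" for s :: real
  have fc: "continuous_on UNIV f" by (rule locally_lipschitz_continuous[OF assms(5)])
  have F': "DERIV F s :> f s" for s unfolding F_def by (rule DERIV_interval_integral[OF fc])
  have Fc: "continuous_on UNIV F" using F' by (intro DERIV_continuous_on) blast
  have F0: "F s \<le> 0" for s unfolding F_def by (rule assms(6))
  have uH: "u \<in> H10 \<Omega>" and uL: "u \<in> Linf \<Omega>"
    and eq: "(LINT x|LO. weak_gradient \<Omega> u x \<bullet> weak_gradient \<Omega> u x)
        = lam * (LINT x|LO. u x * u x) + (LINT x|LO. f (u x) * u x)"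
    using sol unfolding bounded_weak_solution_def by blast+
  have um: "u \<in> borel_measurable LO" using uL by (simp add: Linf_def)
  obtain C where C: "AE x in LO. \<bar>u x\<bar> \<le> C" using uL by (auto simp: Linf_def)
  have us: "sq_int LO u" by (rule H10D(1)[OF uH])
  define E where "E = sqn LO (weak_gradient \<Omega> u)"
  define B where "B = sqn LO u"
  define n where "n = real CARD('n)"
  define \<mu> where "\<mu> = first_dirichlet_eigenvalue \<Omega>"
  have n: "n \<ge> 3" using assms(1) by (simp add: n_def)
  have "\<Omega> \<noteq> {}" using a(1) by blast
  note fe = first_eigenvalue[OF this]
  have \<mu>: "\<mu> > 0" "\<mu> * B \<le> E" using fe(1) fe(2)[OF uH] by (simp_all add: \<mu>_def B_def E_def)
  have B: "B > 0"
    using nt sqn_eq_0_iff[OF us] sqn_nonneg[of LO u] unfolding nontrivial_on_def B_def by linarith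
  have lam: "n * lam \<le> (n - 2) * \<mu>"
    using assms(4) n by (simp add: n_def[symmetric] \<mu>_def[symmetric] field_simps)
  have iF: "integrable LO (\<lambda>x. F (u x))" by (rule bounded_composition[OF Fc um C])
  have "(LINT x|LO. lam * (u x)\<^sup>2 / 2 + F (u x)) = lam * B / 2 + (LINT x|LO. F (u x))"
    using iF us by (simp add: sq_int_def sqn_def B_def)
  with pohozaev_inequality[OF sol assms(5)]
  have "(n - 2) / 2 * E \<le> n * (lam * B / 2 + (LINT x|LO. F (u x)))"
    by (simp add: F_def E_def n_def)
  then have "(n - 2) * E \<le> n * lam * B + 2 * n * (LINT x|LO. F (u x))" by (simp add: algebra_simps)
  moreover have "n * lam * B \<le> (n - 2) * \<mu> * B" using lam B by (intro mult_right_mono) auto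
  moreover have "(n - 2) * (\<mu> * B) \<le> (n - 2) * E" using \<mu>(2) n by (intro mult_left_mono) auto
  \<comment> \<open>The Pohozaev inequality, the bound on \<open>lam\<close> and the Rayleigh bound
    combine to (n - 2) E <= (n - 2) E + 2 n times the integral of F(u). As F <= 0, equality is then
    forced throughout.\<close>
  ultimately have "0 \<le> n * (LINT x|LO. F (u x))" by (simp add: mult.assoc)
  then have "0 \<le> (LINT x|LO. F (u x))" using n by (simp add: zero_le_mult_iff)
  moreover have "0 \<le> (LINT x|LO. - F (u x))" using F0 by (intro integral_nonneg_AE) auto
  ultimately have "(LINT x|LO. - F (u x)) = 0" by simp
  then have "AE x in LO. - F (u x) = 0"
    using integral_nonneg_eq_0_iff_AE[of LO "\<lambda>x. - F (u x)"] iF F0 by simp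
  then have fu: "AE x in LO. f (u x) * u x = 0"
  proof eventually_elim
    case (elim x)
    have "f (u x) = 0"
      \<comment> \<open>The maximum is global, so any radius would do; 1 is taken.\<close>
      by (rule DERIV_local_max[OF F', of 1]) (use elim F0 in auto)
    then show ?case by simp
  qed
  have "E = lam * B"
    using eq integral_eq_zero_AE[OF fu] sqn_inner[of LO "weak_gradient \<Omega> u"] sqn_inner[of LO u]
    by (simp add: E_def B_def)
  then have "\<mu> \<le> lam" using \<mu>(2) B by simp
  then have "n * \<mu> \<le> n * lam" using n by simp
  with lam have "n * \<mu> \<le> (n - 2) * \<mu>" by linarith
  \<comment> \<open>The factor (n - 2) / n in the hypothesis on \<open>lam\<close> is strictly below
    1, which leaves 2 \<mu> <= 0.\<close>
  then show False using \<mu>(1) by (simp add: left_diff_distrib)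
qed

end
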